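(* Let $M$ be a Weil exponentiable and microlinear Frölicher space. The canonical projection $\pi_M^{M\otimes\mathcal{W}_D}:M\otimes\mathcal{W}_D\to M$ is naturally a vector bundle over $M$.
   Context: A Frölicher space is a set $X$ with a set of structure curves $\mathbb{R}\to X$ and a set of structure functions $X\to\mathbb{R}$ such that a map $c:\mathbb{R}\to X$ is a structure curve iff $\chi\circ c\in C^\infty(\mathbb{R},\mathbb{R})$ for all structure functions $\chi$, and a map $\chi:X\to\mathbb{R}$ is a structure function iff $\chi\circ c\in C^\infty(\mathbb{R},\mathbb{R})$ for all structure curves $c$. Smooth mappings are the maps carrying structure curves to structure curves by composition; $\mathbf{FS}$ is the category of Frölicher spaces and smooth mappings, $\mathcal{C}^\infty(X,Y)$ is the set of smooth mappings, and $\mathbb{R}^n$ has its standard structure. $\mathbf{FS}/M$ is the slice category over $M$. $\mathbf{W}$ is the category of Weil algebras (finite-dimensional commutative local $\mathbb{R}$-algebras $W=\mathbb{R}\oplus\mathfrak{m}$ with nilpotent maximal ideal $\mathfrak{m}$) and $\mathbb{R}$-algebra homomorphisms preserving maximal ideals. Each Weil algebra is presented as $W=\mathcal{C}^\infty(\mathbb{R}^n)/I$, its augmentation being evaluation at $0$. For $W_1=\mathcal{C}^\infty(\mathbb{R}^n)/I$ and $W_2=\mathcal{C}^\infty(\mathbb{R}^m)/J$, $W_1\otimes_\infty W_2=\mathcal{C}^\infty(\mathbb{R}^{n+m})/(I,J)$, where $(I,J)$ is generated by the pullbacks of $I$ and $J$ (this is the tensor product $W_1\otimes_{\mathbb{R}}W_2$).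 $\mathcal{W}_D=\mathbb{R}[X]/(X^2)$ and $\mathcal{W}_{D(2)}=\mathbb{R}[X_1,X_2]/(X_1^2,X_2^2,X_1X_2)$. Relative Weil prolongation: given a smooth mapping $\pi_M^E:E\to M$ and $W=\mathcal{C}^\infty(\mathbb{R}^n)/I$, let $\mathcal{C}^\infty(\mathbb{R}^n,E)_M$ be the set of smooth $f:\mathbb{R}^n\to E$ with $\pi_M^E\circ f$ constant, and put $f\equiv g \bmod I$ iff $f(0)=g(0)$ and $\chi\circ f-\chi\circ g\in I$ for all $\chi\in\mathcal{C}^\infty(E,\mathbb{R})$. $E\otimes_M W$ is the set of equivalence classes, with projection $[f]\mapsto\pi_M^E(f(0))$ to $M$, and with the initial smooth structure for the maps $E\otimes_M W\to\mathbb{R}\otimes W=W$, $[f]\mapsto[\chi\circ f]$, $\chi\in\mathcal{C}^\infty(E,\mathbb{R})$. A morphism $W\to W'$ of $\mathbf{W}$ induced by a smooth $g:\mathbb{R}^m\to\mathbb{R}^n$ with $g(0)=0$ induces $E\otimes_M W\to E\otimes_M W'$, $[f]\mapsto[f\circ g]$. For $M=1$ one writes $E\otimes W$ for $E\otimes_1 W$; for a Frölicher space $M$, the canonical projection $\pi_M^{M\otimes W}:M\otimes W\to M$ is $[f]\mapsto f(0)$. $M$ is Weil exponentiable if $M\otimes(W_1\otimes_\infty W_2)=(M\otimes W_1)\otimes W_2$ holds naturally for all Weil algebras $W_1,W_2$ (the canonical comparison sending the class of $f(x,y)$ to the class of $y\mapsto[x\mapsto f(x,y)]$ is an isomorphism,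 natural in $W_1,W_2$). $M$ is microlinear if every finite limit diagram $\mathbb{D}$ in $\mathbf{W}$ yields a limit diagram $M\otimes\mathbb{D}$ in $\mathbf{FS}$. A prevector bundle over $M$ is a smooth mapping $\pi_M^E:E\to M$ endowed with a linear structure in $\mathbf{FS}/M$, i.e. a (real) vector space object in $\mathbf{FS}/M$. It is a vector bundle over $M$ if it is $M$-Euclidean: $E\otimes_M\mathcal{W}_D=E\times_M E$ holds naturally (the canonical map $E\times_M E\to E\otimes_M\mathcal{W}_D$, $(a,b)\mapsto[t\mapsto a+tb]$, is an isomorphism). The natural linear structure on $\pi_M^{M\otimes\mathcal{W}_D}$: scalar multiplication by $a\in\mathbb{R}$ is $[f]\mapsto[t\mapsto f(at)]$; addition is the composite $(M\otimes\mathcal{W}_D)\times_M(M\otimes\mathcal{W}_D)\cong M\otimes\mathcal{W}_{D(2)}\to M\otimes\mathcal{W}_D$, where the isomorphism comes from microlinearity applied to $\mathcal{W}_{D(2)}=\mathcal{W}_D\times_{\mathbb{R}}\mathcal{W}_D$ and the last map is $[f]\mapsto[t\mapsto f(t,t)]$; the zero section sends $x$ to the class of the constant map $x$. *)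

theory Defs
  imports
    "HOL-Analysis.Derivative"
    "HOL-Library.FuncSet"
    "HOL-Algebra.QuotRing"
    "HOL-Algebra.Ideal_Product"
    "HOL-Algebra.Embedded_Algebras"
    "Jordan_Normal_Form.Matrix"
begin

section \<open>Smooth functions of one real variable\<close>

definition smooth_real :: "(real \<Rightarrow> real) \<Rightarrow> bool" where
  "smooth_real f \<longleftrightarrow> (\<forall>k x. (deriv ^^ k) f differentiable (at x))"


section \<open>Froelicher spaces\<close>

text \<open>Maps out of a carrier set are represented by extensional functions throughout, so that
  equality of maps is equality in HOL. Curves are total functions on the reals.\<close>

record 'a fspace =
  points :: "'a set"
  curves :: "(real \<Rightarrow> 'a) set"
  funcs :: "('a \<Rightarrow> real) set"

definition is_fspace :: "'a fspace \<Rightarrow> bool" where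
  "is_fspace X \<longleftrightarrow>
     curves X = {c \<in> UNIV \<rightarrow> points X. \<forall>\<theta> \<in> funcs X. smooth_real (\<theta> \<circ> c)} \<and>
     funcs X = {\<theta> \<in> points X \<rightarrow>\<^sub>E UNIV. \<forall>c \<in> curves X. smooth_real (\<theta> \<circ> c)}"

definition smooth_maps :: "'a fspace \<Rightarrow> 'b fspace \<Rightarrow> ('a \<Rightarrow> 'b) set" where
  "smooth_maps X Y = {f \<in> points X \<rightarrow>\<^sub>E points Y. \<forall>c \<in> curves X. f \<circ> c \<in> curves Y}"

definition fs_iso :: "'a fspace \<Rightarrow> 'b fspace \<Rightarrow> ('a \<Rightarrow> 'b) \<Rightarrow> bool" where
  "fs_iso X Y f \<longleftrightarrow> f \<in> smooth_maps X Y \<and>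
     (\<exists>g \<in> smooth_maps Y X. (\<forall>x \<in> points X. g (f x) = x) \<and> (\<forall>y \<in> points Y. f (g y) = y))"

text \<open>The initial structure on \<^term>\<open>A\<close> for a family of real-valued maps. The initial structure
  for maps into Froelicher spaces \<open>Y\<^sub>i\<close> is obtained by composing them with all structure
  functions of the \<open>Y\<^sub>i\<close>.\<close>

definition initial_fspace :: "'a set \<Rightarrow> ('a \<Rightarrow> real) set \<Rightarrow> 'a fspace" where
  "initial_fspace A F =
     (let C = {c \<in> UNIV \<rightarrow> A. \<forall>\<phi> \<in> F. smooth_real (\<phi> \<circ> c)}
      in \<lparr>points = A, curves = C, funcs = {\<theta> \<in> A \<rightarrow>\<^sub>E UNIV. \<forall>c \<in> C. smooth_real (\<theta> \<circ> c)}\<rparr>)"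

definition real_line :: "real fspace" where
  "real_line = \<lparr>points = UNIV, curves = Collect smooth_real, funcs = Collect smooth_real\<rparr>"

text \<open>\<open>\<real>\<^sup>n\<close> with its standard structure: the curves are the componentwise smooth ones. By Boman's
  theorem the structure functions are then exactly the usual smooth functions of \<open>n\<close> variables.\<close>

definition euclid :: "nat \<Rightarrow> real vec fspace" where
  "euclid n = initial_fspace (carrier_vec n) {\<lambda>v. v $ i |i. i < n}"

definition fs_pullback ::
  "'a fspace \<Rightarrow> 'b fspace \<Rightarrow> ('a \<Rightarrow> 'c) \<Rightarrow> ('b \<Rightarrow> 'c) \<Rightarrow> ('a \<times> 'b) fspace" where
  "fs_pullback X Y p q =
     initial_fspace {(x, y). x \<in> points X \<and> y \<in> points Y \<and> p x = q y}
       ({\<theta> \<circ> fst |\<theta>. \<theta> \<in> funcs X} \<union> {\<theta> \<circ> snd |\<theta>. \<theta> \<in> funcs Y})"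

definition fs_prod :: "'a fspace \<Rightarrow> 'b fspace \<Rightarrow> ('a \<times> 'b) fspace" where
  "fs_prod X Y = fs_pullback X Y (\<lambda>_. ()) (\<lambda>_. ())"


section \<open>Weil algebras\<close>

definition Cinf :: "nat \<Rightarrow> (real vec \<Rightarrow> real) ring" where
  "Cinf n =
     \<lparr>carrier = smooth_maps (euclid n) real_line,
      mult = (\<lambda>f g. \<lambda>x \<in> carrier_vec n. f x * g x),
      one = (\<lambda>x \<in> carrier_vec n. 1),
      zero = (\<lambda>x \<in> carrier_vec n. 0),
      add = (\<lambda>f g. \<lambda>x \<in> carrier_vec n. f x + g x)\<rparr>"

text \<open>A presentation \<open>C\<^sup>\<infinity>(\<real>\<^sup>n)/I\<close>, and the algebra it presents.\<close>

record presentation =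
  wdim :: nat
  wideal :: "(real vec \<Rightarrow> real) set"

definition walg :: "presentation \<Rightarrow> (real vec \<Rightarrow> real) set ring" where
  "walg W = Cinf (wdim W) Quot wideal W"

definition wclass :: "presentation \<Rightarrow> (real vec \<Rightarrow> real) \<Rightarrow> (real vec \<Rightarrow> real) set" where
  "wclass W h = wideal W +>\<^bsub>Cinf (wdim W)\<^esub> h"

definition wconst :: "presentation \<Rightarrow> real \<Rightarrow> (real vec \<Rightarrow> real) set" where
  "wconst W a = wclass W (\<lambda>x \<in> carrier_vec (wdim W). a)"

definition wmax :: "presentation \<Rightarrow> (real vec \<Rightarrow> real) set set" where
  "wmax W = wclass W ` {h \<in> carrier (Cinf (wdim W)). h (0\<^sub>v (wdim W)) = 0}"

text \<open>Finite-dimensional over the copy \<^term>\<open>range (wconst W)\<close> of the reals, and local, the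
  maximal ideal being nilpotent and equal to the kernel of evaluation at 0. (The third clause
  forces the ideal to consist of functions vanishing at 0, so that evaluation is well defined on
  the quotient.)\<close>

definition weil_algebra :: "presentation \<Rightarrow> bool" where
  "weil_algebra W \<longleftrightarrow>
     ideal (wideal W) (Cinf (wdim W)) \<and>
     ring.finite_dimension (walg W) (range (wconst W)) (carrier (walg W)) \<and>
     (\<forall>N. maximalideal N (walg W) \<longleftrightarrow> N = wmax W) \<and>
     (\<exists>k. (ideal_prod (walg W) (wmax W) ^^ k) (wmax W) = {\<zero>\<^bsub>walg W\<^esub>})"

definition weil_hom ::
  "presentation \<Rightarrow> presentation \<Rightarrow> ((real vec \<Rightarrow> real) set \<Rightarrow> (real vec \<Rightarrow> real) set) set" where
  "weil_hom W W' =
     {\<phi> \<in> carrier (walg W) \<rightarrow>\<^sub>E carrier (walg W').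
        \<phi> \<in> Ring.ring_hom (walg W) (walg W') \<and>
        (\<forall>a. \<phi> (wconst W a) = wconst W' a) \<and>
        \<phi> ` wmax W \<subseteq> wmax W'}"

definition weil_induced ::
  "presentation \<Rightarrow> presentation \<Rightarrow> ((real vec \<Rightarrow> real) set \<Rightarrow> (real vec \<Rightarrow> real) set) \<Rightarrow>
     (real vec \<Rightarrow> real vec) \<Rightarrow> bool" where
  "weil_induced W W' \<phi> g \<longleftrightarrow>
     \<phi> \<in> weil_hom W W' \<and>
     g \<in> smooth_maps (euclid (wdim W')) (euclid (wdim W)) \<and>
     g (0\<^sub>v (wdim W')) = 0\<^sub>v (wdim W) \<and>
     (\<forall>h \<in> carrier (Cinf (wdim W)).
        \<phi> (wclass W h) = wclass W' (compose (carrier_vec (wdim W')) h g))"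

definition weil_tensor :: "presentation \<Rightarrow> presentation \<Rightarrow> presentation" where
  "weil_tensor W1 W2 =
     (let n = wdim W1; m = wdim W2
      in \<lparr>wdim = n + m,
          wideal = Idl\<^bsub>Cinf (n + m)\<^esub>
            ({\<lambda>z \<in> carrier_vec (n + m). h (vec_first z n) |h. h \<in> wideal W1} \<union>
             {\<lambda>z \<in> carrier_vec (n + m). h (vec_last z m) |h. h \<in> wideal W2})\<rparr>)"

definition W_D :: presentation where
  "W_D = \<lparr>wdim = 1, wideal = Idl\<^bsub>Cinf 1\<^esub> {\<lambda>x \<in> carrier_vec 1. (x $ 0)\<^sup>2}\<rparr>"

definition W_D2 :: presentation where
  "W_D2 = \<lparr>wdim = 2,
     wideal = Idl\<^bsub>Cinf 2\<^esub> {\<lambda>x \<in> carrier_vec 2. (x $ 0)\<^sup>2, \<lambda>x \<in> carrier_vec 2. (x $ 1)\<^sup>2,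
                          \<lambda>x \<in> carrier_vec 2. x $ 0 * x $ 1}\<rparr>"

text \<open>A Weil algebra as a Froelicher space: the standard structure of a finite-dimensional real
  vector space, which is initial for the linear functionals.\<close>

definition weil_dual :: "presentation \<Rightarrow> ((real vec \<Rightarrow> real) set \<Rightarrow> real) set" where
  "weil_dual W =
     {l \<in> carrier (walg W) \<rightarrow>\<^sub>E UNIV.
        \<forall>u \<in> carrier (walg W). \<forall>v \<in> carrier (walg W).
          l (u \<oplus>\<^bsub>walg W\<^esub> v) = l u + l v \<and>
          (\<forall>a. l (wconst W a \<otimes>\<^bsub>walg W\<^esub> u) = a * l u)}"

definition weil_fspace :: "presentation \<Rightarrow> (real vec \<Rightarrow> real) set fspace" where
  "weil_fspace W = initial_fspace (carrier (walg W)) (weil_dual W)"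


section \<open>Relative Weil prolongation\<close>

definition prolong_maps :: "'e fspace \<Rightarrow> ('e \<Rightarrow> 'm) \<Rightarrow> nat \<Rightarrow> (real vec \<Rightarrow> 'e) set" where
  "prolong_maps E \<pi> n =
     {f \<in> smooth_maps (euclid n) E. \<forall>x \<in> carrier_vec n. \<pi> (f x) = \<pi> (f (0\<^sub>v n))}"

definition prolong_rel ::
  "'e fspace \<Rightarrow> ('e \<Rightarrow> 'm) \<Rightarrow> presentation \<Rightarrow> ((real vec \<Rightarrow> 'e) \<times> (real vec \<Rightarrow> 'e)) set" where
  "prolong_rel E \<pi> W =
     {(f, g). f \<in> prolong_maps E \<pi> (wdim W) \<and> g \<in> prolong_maps E \<pi> (wdim W) \<and>
        f (0\<^sub>v (wdim W)) = g (0\<^sub>v (wdim W)) \<and>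
        (\<forall>\<theta> \<in> smooth_maps E real_line.
           (\<lambda>x \<in> carrier_vec (wdim W). \<theta> (f x) - \<theta> (g x)) \<in> wideal W)}"

definition prolong_class ::
  "'e fspace \<Rightarrow> ('e \<Rightarrow> 'm) \<Rightarrow> presentation \<Rightarrow> (real vec \<Rightarrow> 'e) \<Rightarrow> (real vec \<Rightarrow> 'e) set" where
  "prolong_class E \<pi> W f = prolong_rel E \<pi> W `` {f}"

text \<open>The map \<open>[f] \<mapsto> [\<theta> \<circ> f]\<close> to \<open>\<real> \<otimes> W = W\<close>. Here and below, \<open>THE\<close> transcribes a definition on
  representatives.\<close>

definition prolong_eval ::
  "presentation \<Rightarrow> ('e \<Rightarrow> real) \<Rightarrow> (real vec \<Rightarrow> 'e) set \<Rightarrow> (real vec \<Rightarrow> real) set" where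
  "prolong_eval W \<theta> c = (THE w. \<exists>f \<in> c. w = wclass W (compose (carrier_vec (wdim W)) \<theta> f))"

definition prolong ::
  "'e fspace \<Rightarrow> ('e \<Rightarrow> 'm) \<Rightarrow> presentation \<Rightarrow> (real vec \<Rightarrow> 'e) set fspace" where
  "prolong E \<pi> W =
     initial_fspace (prolong_maps E \<pi> (wdim W) // prolong_rel E \<pi> W)
       {\<psi> \<circ> prolong_eval W \<theta> |\<psi> \<theta>. \<psi> \<in> funcs (weil_fspace W) \<and> \<theta> \<in> smooth_maps E real_line}"

text \<open>The absolute case \<open>M \<otimes> W = M \<otimes>\<^sub>1 W\<close>.\<close>

abbreviation aprolong :: "'a fspace \<Rightarrow> presentation \<Rightarrow> (real vec \<Rightarrow> 'a) set fspace" where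
  "aprolong M W \<equiv> prolong M (\<lambda>_. ()) W"

abbreviation aclass ::
  "'a fspace \<Rightarrow> presentation \<Rightarrow> (real vec \<Rightarrow> 'a) \<Rightarrow> (real vec \<Rightarrow> 'a) set" where
  "aclass M W f \<equiv> prolong_class M (\<lambda>_. ()) W f"

definition abase :: "'a fspace \<Rightarrow> presentation \<Rightarrow> (real vec \<Rightarrow> 'a) set \<Rightarrow> 'a" where
  "abase M W = (\<lambda>c \<in> points (aprolong M W). THE x. \<exists>f \<in> c. x = f (0\<^sub>v (wdim W)))"

text \<open>The map \<open>[f] \<mapsto> [f \<circ> g]\<close>, and the functorial action of a morphism of Weil algebras, which is
  that of any map \<^term>\<open>g\<close> inducing it.\<close>

definition aprolong_along ::
  "'a fspace \<Rightarrow> presentation \<Rightarrow> presentation \<Rightarrow> (real vec \<Rightarrow> real vec) \<Rightarrow>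
     (real vec \<Rightarrow> 'a) set \<Rightarrow> (real vec \<Rightarrow> 'a) set" where
  "aprolong_along M W W' g =
     (\<lambda>c \<in> points (aprolong M W).
        THE d. \<exists>f \<in> c. d = aclass M W' (compose (carrier_vec (wdim W')) f g))"

definition aprolong_hom ::
  "'a fspace \<Rightarrow> presentation \<Rightarrow> presentation \<Rightarrow>
     ((real vec \<Rightarrow> real) set \<Rightarrow> (real vec \<Rightarrow> real) set) \<Rightarrow>
     (real vec \<Rightarrow> 'a) set \<Rightarrow> (real vec \<Rightarrow> 'a) set" where
  "aprolong_hom M W W' \<phi> =
     (\<lambda>c \<in> points (aprolong M W).
        THE d. \<exists>g. weil_induced W W' \<phi> g \<and> d = aprolong_along M W W' g c)"

text \<open>The functorial action \<open>[f] \<mapsto> [h \<circ> f]\<close> of a smooth mapping \<open>h : M \<rightarrow> N\<close>.\<close>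

definition aprolong_push ::
  "'a fspace \<Rightarrow> 'b fspace \<Rightarrow> presentation \<Rightarrow> ('a \<Rightarrow> 'b) \<Rightarrow>
     (real vec \<Rightarrow> 'a) set \<Rightarrow> (real vec \<Rightarrow> 'b) set" where
  "aprolong_push M N W h =
     (\<lambda>c \<in> points (aprolong M W).
        THE d. \<exists>f \<in> c. d = aclass N W (compose (carrier_vec (wdim W)) h f))"


section \<open>Weil exponentiability\<close>

definition weil_curry ::
  "'a fspace \<Rightarrow> presentation \<Rightarrow> presentation \<Rightarrow> (real vec \<Rightarrow> 'a) \<Rightarrow>
     real vec \<Rightarrow> (real vec \<Rightarrow> 'a) set" where
  "weil_curry M W1 W2 f =
     (\<lambda>y \<in> carrier_vec (wdim W2). aclass M W1 (\<lambda>x \<in> carrier_vec (wdim W1). f (x @\<^sub>v y)))"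

text \<open>The map \<open>(x, y) \<mapsto> (g1 x, g2 y)\<close>, inducing the tensor product of the morphisms induced by
  \<^term>\<open>g1\<close> and \<^term>\<open>g2\<close>.\<close>

definition prod_vec_map ::
  "nat \<Rightarrow> nat \<Rightarrow> (real vec \<Rightarrow> real vec) \<Rightarrow> (real vec \<Rightarrow> real vec) \<Rightarrow> real vec \<Rightarrow> real vec" where
  "prod_vec_map n m g1 g2 =
     (\<lambda>z \<in> carrier_vec (n + m). g1 (vec_first z n) @\<^sub>v g2 (vec_last z m))"

definition weil_exponentiable :: "'a fspace \<Rightarrow> bool" where
  "weil_exponentiable M \<longleftrightarrow>
     (\<exists>\<Phi>.
        (\<forall>W1 W2. weil_algebra W1 \<and> weil_algebra W2 \<longrightarrow>
           fs_iso (aprolong M (weil_tensor W1 W2)) (aprolong (aprolong M W1) W2) (\<Phi> W1 W2) \<and>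
           (\<forall>f \<in> smooth_maps (euclid (wdim W1 + wdim W2)) M.
              weil_curry M W1 W2 f \<in> smooth_maps (euclid (wdim W2)) (aprolong M W1) \<and>
              \<Phi> W1 W2 (aclass M (weil_tensor W1 W2) f) =
                aclass (aprolong M W1) W2 (weil_curry M W1 W2 f))) \<and>
        (\<forall>W1 W1' W2 W2' \<phi>1 \<phi>2 g1 g2.
           weil_algebra W1 \<and> weil_algebra W1' \<and> weil_algebra W2 \<and> weil_algebra W2' \<and>
           weil_induced W1 W1' \<phi>1 g1 \<and> weil_induced W2 W2' \<phi>2 g2 \<longrightarrow>
           (\<forall>c \<in> points (aprolong M (weil_tensor W1 W2)).
              \<Phi> W1' W2' (aprolong_along M (weil_tensor W1 W2) (weil_tensor W1' W2')
                           (prod_vec_map (wdim W1') (wdim W2') g1 g2) c) =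
              aprolong_push (aprolong M W1) (aprolong M W1') W2' (aprolong_hom M W1 W1' \<phi>1)
                (aprolong_hom (aprolong M W1) W2 W2' \<phi>2 (\<Phi> W1 W2 c)))))"


section \<open>Finite limits and microlinearity\<close>

text \<open>The shape of a diagram is a directed multigraph; cones have to commute with its arrows.
  A diagram indexed by a finite category has the same cones as its underlying graph diagram, and
  finite graphs give no further limits: a graph diagram has the same cones as the
  diagram indexed by the finite category with the vertices and edges as objects and
  non-identity arrows \<open>src a \<rightarrow> a\<close> and \<open>tgt a \<rightarrow> a\<close>.\<close>

record shape =
  verts :: "nat set"
  arrs :: "nat set"
  src :: "nat \<Rightarrow> nat"
  tgt :: "nat \<Rightarrow> nat"

definition finite_shape :: "shape \<Rightarrow> bool" where
  "finite_shape S \<longleftrightarrow> finite (verts S) \<and> finite (arrs S) \<and>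
     src S ` arrs S \<subseteq> verts S \<and> tgt S ` arrs S \<subseteq> verts S"

definition connected_shape :: "shape \<Rightarrow> bool" where
  "connected_shape S \<longleftrightarrow> verts S \<noteq> {} \<and>
     (\<forall>u \<in> verts S. \<forall>v \<in> verts S.
        (u, v) \<in> (\<Union>a \<in> arrs S. {(src S a, tgt S a), (tgt S a, src S a)})\<^sup>*)"

definition weil_diagram ::
  "shape \<Rightarrow> (nat \<Rightarrow> presentation) \<Rightarrow>
     (nat \<Rightarrow> (real vec \<Rightarrow> real) set \<Rightarrow> (real vec \<Rightarrow> real) set) \<Rightarrow> bool" where
  "weil_diagram S D \<delta> \<longleftrightarrow>
     (\<forall>v \<in> verts S. weil_algebra (D v)) \<and>
     (\<forall>a \<in> arrs S. \<delta> a \<in> weil_hom (D (src S a)) (D (tgt S a)))"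

definition weil_cone ::
  "shape \<Rightarrow> (nat \<Rightarrow> presentation) \<Rightarrow>
     (nat \<Rightarrow> (real vec \<Rightarrow> real) set \<Rightarrow> (real vec \<Rightarrow> real) set) \<Rightarrow>
     presentation \<Rightarrow> (nat \<Rightarrow> (real vec \<Rightarrow> real) set \<Rightarrow> (real vec \<Rightarrow> real) set) \<Rightarrow> bool" where
  "weil_cone S D \<delta> W q \<longleftrightarrow>
     weil_algebra W \<and>
     (\<forall>v \<in> verts S. q v \<in> weil_hom W (D v)) \<and>
     (\<forall>a \<in> arrs S. compose (carrier (walg W)) (\<delta> a) (q (src S a)) = q (tgt S a))"

definition weil_limit ::
  "shape \<Rightarrow> (nat \<Rightarrow> presentation) \<Rightarrow>
     (nat \<Rightarrow> (real vec \<Rightarrow> real) set \<Rightarrow> (real vec \<Rightarrow> real) set) \<Rightarrow>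
     presentation \<Rightarrow> (nat \<Rightarrow> (real vec \<Rightarrow> real) set \<Rightarrow> (real vec \<Rightarrow> real) set) \<Rightarrow> bool" where
  "weil_limit S D \<delta> L p \<longleftrightarrow>
     weil_cone S D \<delta> L p \<and>
     (\<forall>W q. weil_cone S D \<delta> W q \<longrightarrow>
        (\<exists>!u. u \<in> weil_hom W L \<and>
           (\<forall>v \<in> verts S. compose (carrier (walg W)) (p v) u = q v)))"

definition fs_cone ::
  "shape \<Rightarrow> (nat \<Rightarrow> 'a fspace) \<Rightarrow> (nat \<Rightarrow> 'a \<Rightarrow> 'a) \<Rightarrow> 'x fspace \<Rightarrow> (nat \<Rightarrow> 'x \<Rightarrow> 'a) \<Rightarrow> bool" where
  "fs_cone S D \<delta> X q \<longleftrightarrow>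
     is_fspace X \<and>
     (\<forall>v \<in> verts S. q v \<in> smooth_maps X (D v)) \<and>
     (\<forall>a \<in> arrs S. compose (points X) (\<delta> a) (q (src S a)) = q (tgt S a))"

text \<open>The universal property among the Froelicher spaces whose points have type \<^typ>\<open>'x\<close>.\<close>

definition fs_limit ::
  "'x itself \<Rightarrow> shape \<Rightarrow> (nat \<Rightarrow> 'a fspace) \<Rightarrow> (nat \<Rightarrow> 'a \<Rightarrow> 'a) \<Rightarrow>
     'b fspace \<Rightarrow> (nat \<Rightarrow> 'b \<Rightarrow> 'a) \<Rightarrow> bool" where
  "fs_limit T S D \<delta> L p \<longleftrightarrow>
     fs_cone S D \<delta> L p \<and>
     (\<forall>(X :: 'x fspace) q. fs_cone S D \<delta> X q \<longrightarrow>
        (\<exists>!u. u \<in> smooth_maps X L \<and> (\<forall>v \<in> verts S. compose (points X) (p v) u = q v)))"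

text \<open>The type \<^typ>\<open>real\<close> of test spaces is no restriction: by the lemma \<open>fs_limit_any_type\<close> below it
  gives the universal property for test spaces of every type.

  The shapes are required to be connected. The real numbers are terminal in the category of Weil
  algebras, so the empty diagram has limit \<open>\<real>\<close> there, while \<open>M \<otimes> \<real> \<cong> M\<close>; similarly \<open>W_D2\<close> is the
  product of two copies of \<open>W_D\<close>. If disconnected diagrams were admitted, only one-point
  spaces would be microlinear. For connected shapes, limits in Weil algebras are
  limits in the category of all real algebras, and they include the fibre product of two copies
  of \<open>W_D\<close> over \<open>\<real>\<close>.\<close>

definition microlinear :: "'a fspace \<Rightarrow> bool" where
  "microlinear M \<longleftrightarrow>
     (\<forall>S D \<delta> L p.
        finite_shape S \<and> connected_shape S \<and> weil_diagram S D \<delta> \<and> weil_limit S D \<delta> L p \<longrightarrow>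
        fs_limit TYPE(real) S
          (\<lambda>v. aprolong M (D v)) (\<lambda>a. aprolong_hom M (D (src S a)) (D (tgt S a)) (\<delta> a))
          (aprolong M L) (\<lambda>v. aprolong_hom M L (D v) (p v)))"


section \<open>Vector bundles\<close>

text \<open>A vector space object over the field object \<open>\<real> \<times> M \<rightarrow> M\<close> of the slice over \<open>M\<close>; the scalar
  multiplication \<open>(\<real> \<times> M) \<times>\<^sub>M E \<rightarrow> E\<close> is written as a map \<open>\<real> \<times> E \<rightarrow> E\<close>.\<close>

definition prevector_bundle ::
  "'e fspace \<Rightarrow> 'm fspace \<Rightarrow> ('e \<Rightarrow> 'm) \<Rightarrow>
     ('e \<times> 'e \<Rightarrow> 'e) \<Rightarrow> ('m \<Rightarrow> 'e) \<Rightarrow> (real \<times> 'e \<Rightarrow> 'e) \<Rightarrow> bool" where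
  "prevector_bundle E M \<pi> plusE zeroE scaleE \<longleftrightarrow>
     is_fspace E \<and> is_fspace M \<and>
     \<pi> \<in> smooth_maps E M \<and>
     plusE \<in> smooth_maps (fs_pullback E E \<pi> \<pi>) E \<and>
     zeroE \<in> smooth_maps M E \<and>
     scaleE \<in> smooth_maps (fs_prod real_line E) E \<and>
     (\<forall>a \<in> points E. \<forall>b \<in> points E. \<pi> a = \<pi> b \<longrightarrow> \<pi> (plusE (a, b)) = \<pi> a) \<and>
     (\<forall>x \<in> points M. \<pi> (zeroE x) = x) \<and>
     (\<forall>r. \<forall>a \<in> points E. \<pi> (scaleE (r, a)) = \<pi> a) \<and>
     (\<forall>a \<in> points E. \<forall>b \<in> points E. \<forall>c \<in> points E. \<pi> a = \<pi> b \<and> \<pi> b = \<pi> c \<longrightarrow>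
        plusE (plusE (a, b), c) = plusE (a, plusE (b, c))) \<and>
     (\<forall>a \<in> points E. \<forall>b \<in> points E. \<pi> a = \<pi> b \<longrightarrow> plusE (a, b) = plusE (b, a)) \<and>
     (\<forall>a \<in> points E. plusE (zeroE (\<pi> a), a) = a) \<and>
     (\<forall>a \<in> points E. plusE (scaleE (- 1, a), a) = zeroE (\<pi> a)) \<and>
     (\<forall>r. \<forall>a \<in> points E. \<forall>b \<in> points E. \<pi> a = \<pi> b \<longrightarrow>
        scaleE (r, plusE (a, b)) = plusE (scaleE (r, a), scaleE (r, b))) \<and>
     (\<forall>r s. \<forall>a \<in> points E. scaleE (r + s, a) = plusE (scaleE (r, a), scaleE (s, a))) \<and>
     (\<forall>r s. \<forall>a \<in> points E. scaleE (r * s, a) = scaleE (r, scaleE (s, a))) \<and>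
     (\<forall>a \<in> points E. scaleE (1, a) = a)"

text \<open>The canonical map \<open>(a, b) \<mapsto> [t \<mapsto> a + t b]\<close> from \<open>E \<times>\<^sub>M E\<close> to \<open>E \<otimes>\<^sub>M W_D\<close>.\<close>

definition euclidean_map ::
  "'e fspace \<Rightarrow> ('e \<Rightarrow> 'm) \<Rightarrow> ('e \<times> 'e \<Rightarrow> 'e) \<Rightarrow> (real \<times> 'e \<Rightarrow> 'e) \<Rightarrow>
     'e \<times> 'e \<Rightarrow> (real vec \<Rightarrow> 'e) set" where
  "euclidean_map E \<pi> plusE scaleE =
     (\<lambda>(a, b) \<in> points (fs_pullback E E \<pi> \<pi>).
        prolong_class E \<pi> W_D (\<lambda>t \<in> carrier_vec 1. plusE (a, scaleE (t $ 0, b))))"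

definition vector_bundle ::
  "'e fspace \<Rightarrow> 'm fspace \<Rightarrow> ('e \<Rightarrow> 'm) \<Rightarrow>
     ('e \<times> 'e \<Rightarrow> 'e) \<Rightarrow> ('m \<Rightarrow> 'e) \<Rightarrow> (real \<times> 'e \<Rightarrow> 'e) \<Rightarrow> bool" where
  "vector_bundle E M \<pi> plusE zeroE scaleE \<longleftrightarrow>
     prevector_bundle E M \<pi> plusE zeroE scaleE \<and>
     fs_iso (fs_pullback E E \<pi> \<pi>) (prolong E \<pi> W_D) (euclidean_map E \<pi> plusE scaleE)"


section \<open>The natural linear structure of the tangent projection\<close>

abbreviation tangent :: "'a fspace \<Rightarrow> (real vec \<Rightarrow> 'a) set fspace" where
  "tangent M \<equiv> aprolong M W_D"

definition tangent_proj :: "'a fspace \<Rightarrow> (real vec \<Rightarrow> 'a) set \<Rightarrow> 'a" where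
  "tangent_proj M = abase M W_D"

definition tangent_scale ::
  "'a fspace \<Rightarrow> real \<times> (real vec \<Rightarrow> 'a) set \<Rightarrow> (real vec \<Rightarrow> 'a) set" where
  "tangent_scale M =
     (\<lambda>(r, u) \<in> UNIV \<times> points (tangent M).
        aprolong_along M W_D W_D (\<lambda>t \<in> carrier_vec 1. vec_of_list [r * t $ 0]) u)"

definition tangent_zero :: "'a fspace \<Rightarrow> 'a \<Rightarrow> (real vec \<Rightarrow> 'a) set" where
  "tangent_zero M = (\<lambda>x \<in> points M. aclass M W_D (\<lambda>t \<in> carrier_vec 1. x))"

text \<open>The element \<^term>\<open>k\<close> below is the image of \<^term>\<open>(u, v)\<close> under the inverse of the map
  \<open>[f] \<mapsto> ([t \<mapsto> f (t, 0)], [t \<mapsto> f (0, t)])\<close> from \<open>M \<otimes> W_D2\<close> to the fibre product.\<close>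

definition tangent_add ::
  "'a fspace \<Rightarrow> (real vec \<Rightarrow> 'a) set \<times> (real vec \<Rightarrow> 'a) set \<Rightarrow> (real vec \<Rightarrow> 'a) set" where
  "tangent_add M =
     (\<lambda>(u, v) \<in> points (fs_pullback (tangent M) (tangent M) (tangent_proj M) (tangent_proj M)).
        let k = (THE k. k \<in> points (aprolong M W_D2) \<and>
               aprolong_along M W_D2 W_D (\<lambda>t \<in> carrier_vec 1. vec_of_list [t $ 0, 0]) k = u \<and>
               aprolong_along M W_D2 W_D (\<lambda>t \<in> carrier_vec 1. vec_of_list [0, t $ 0]) k = v)
        in aprolong_along M W_D2 W_D (\<lambda>t \<in> carrier_vec 1. vec_of_list [t $ 0, t $ 0]) k)"


section \<open>Independence of the type of test spaces\<close>

lemma smooth_real_differentiable: "smooth_real f \<Longrightarrow> f differentiable (at x)"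
  unfolding smooth_real_def by (metis funpow_0)

lemma smooth_real_deriv: "smooth_real f \<Longrightarrow> smooth_real (deriv f)"
  unfolding smooth_real_def by (metis funpow_Suc_right o_apply)

lemma smooth_realI:
  assumes "P f" "\<And>g x. P g \<Longrightarrow> g differentiable (at x)" "\<And>g. P g \<Longrightarrow> P (deriv g)"
  shows "smooth_real f"
proof -
  have "P ((deriv ^^ k) f)" for k
    by (induction k) (use assms in auto)
  then show ?thesis
    unfolding smooth_real_def using assms(2) by blast
qed

text \<open>The algebra generated by the smooth functions and their composites with \<^term>\<open>g\<close>; it is
  closed under differentiation.\<close>

inductive smooth_comp_algebra :: "(real \<Rightarrow> real) \<Rightarrow> (real \<Rightarrow> real) \<Rightarrow> bool" for g where
  base: "smooth_real f \<Longrightarrow> smooth_comp_algebra g f"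
| comp: "smooth_real f \<Longrightarrow> smooth_comp_algebra g (\<lambda>x. f (g x))"
| add: "smooth_comp_algebra g a \<Longrightarrow> smooth_comp_algebra g b \<Longrightarrow>
    smooth_comp_algebra g (\<lambda>x. a x + b x)"
| mult: "smooth_comp_algebra g a \<Longrightarrow> smooth_comp_algebra g b \<Longrightarrow>
    smooth_comp_algebra g (\<lambda>x. a x * b x)"

lemma smooth_comp_algebra_deriv:
  assumes "smooth_comp_algebra g f" "smooth_real g"
  shows "\<exists>f'. (\<forall>x. (f has_real_derivative f' x) (at x)) \<and> smooth_comp_algebra g f'"
  using assms
proof (induction rule: smooth_comp_algebra.induct)
  case (base f)
  then show ?case
    by (metis DERIV_deriv_iff_real_differentiable smooth_comp_algebra.base
        smooth_real_deriv smooth_real_differentiable)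
next
  case (comp f)
  have "((\<lambda>x. f (g x)) has_real_derivative deriv f (g x) * deriv g x) (at x)" for x
    by (rule DERIV_chain2; use comp in
        \<open>simp add: DERIV_deriv_iff_real_differentiable smooth_real_differentiable\<close>)
  moreover have "smooth_comp_algebra g (\<lambda>x. deriv f (g x) * deriv g x)"
    using comp by (intro smooth_comp_algebra.intros smooth_real_deriv)
  ultimately show ?case by (intro exI conjI allI)
next
  case (add a b)
  then obtain a' b' where "\<forall>x. (a has_real_derivative a' x) (at x)" "smooth_comp_algebra g a'"
    "\<forall>x. (b has_real_derivative b' x) (at x)" "smooth_comp_algebra g b'"
    by blast
  then show ?case
    by (intro exI[of _ "\<lambda>x. a' x + b' x"])
      (auto intro: smooth_comp_algebra.intros DERIV_add)
next
  case (mult a b)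
  then obtain a' b' where "\<forall>x. (a has_real_derivative a' x) (at x)" "smooth_comp_algebra g a'"
    "\<forall>x. (b has_real_derivative b' x) (at x)" "smooth_comp_algebra g b'"
    by blast
  with mult.hyps show ?case
    by (intro exI[of _ "\<lambda>x. a' x * b x + b' x * a x"])
      (auto intro: smooth_comp_algebra.intros DERIV_mult)
qed

lemma smooth_real_comp:
  assumes "smooth_real f" "smooth_real g"
  shows "smooth_real (f \<circ> g)"
proof (rule smooth_realI[of "smooth_comp_algebra g"])
  show "smooth_comp_algebra g (f \<circ> g)"
    using assms by (auto simp: comp_def intro: smooth_comp_algebra.comp)
next
  fix h x assume "smooth_comp_algebra g h"
  then show "h differentiable at x"
    using smooth_comp_algebra_deriv assms(2) real_differentiable_def by blast
next
  fix h assume "smooth_comp_algebra g h"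
  then obtain h' where h': "\<forall>x. (h has_real_derivative h' x) (at x)" "smooth_comp_algebra g h'"
    using smooth_comp_algebra_deriv assms(2) by blast
  then have "deriv h = h'"
    by (auto intro: DERIV_imp_deriv)
  with h'(2) show "smooth_comp_algebra g (deriv h)" by simp
qed

lemma smooth_real_id: "smooth_real id"
proof (rule smooth_realI[of "\<lambda>f. f = id \<or> (\<exists>c. f = (\<lambda>_. c))"])
  fix f :: "real \<Rightarrow> real" and x
  assume "f = id \<or> (\<exists>c. f = (\<lambda>_. c))"
  then show "f differentiable at x"
    by (auto simp: id_def)
next
  fix f :: "real \<Rightarrow> real"
  assume "f = id \<or> (\<exists>c. f = (\<lambda>_. c))"
  then show "deriv f = id \<or> (\<exists>c. deriv f = (\<lambda>_. c))"
    by (auto simp: id_def)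
qed simp

lemma smooth_real_const: "smooth_real (\<lambda>_. c)"
  by (rule smooth_realI[of "\<lambda>f. \<exists>c. f = (\<lambda>_. c)"]) auto

lemma is_fspace_real_line: "is_fspace real_line"
proof -
  have "smooth_real c" if "\<forall>\<theta>. smooth_real \<theta> \<longrightarrow> smooth_real (\<theta> \<circ> c)" for c
    using that smooth_real_id by (metis id_comp)
  moreover have "smooth_real \<theta>" if "\<forall>c. smooth_real c \<longrightarrow> smooth_real (\<theta> \<circ> c)" for \<theta>
    using that smooth_real_id by (metis comp_id)
  ultimately have
    "Collect smooth_real = {c \<in> UNIV \<rightarrow> UNIV. \<forall>\<theta> \<in> Collect smooth_real. smooth_real (\<theta> \<circ> c)}"
    "Collect smooth_real = {\<theta> \<in> UNIV \<rightarrow>\<^sub>E UNIV. \<forall>c \<in> Collect smooth_real. smooth_real (\<theta> \<circ> c)}"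
    unfolding PiE_UNIV_domain Pi_UNIV using smooth_real_comp by blast+
  then show ?thesis
    unfolding is_fspace_def real_line_def fspace.simps by (rule conjI)
qed

lemma is_fspace_initial: "is_fspace (initial_fspace A F)"
proof -
  let ?X = "initial_fspace A F"
  have "c \<in> curves ?X" if c: "c \<in> UNIV \<rightarrow> A" "\<forall>\<theta> \<in> funcs ?X. smooth_real (\<theta> \<circ> c)" for c
  proof -
    have "smooth_real (\<phi> \<circ> c)" if "\<phi> \<in> F" for \<phi>
    proof -
      have eq: "restrict \<phi> A \<circ> d = \<phi> \<circ> d" if "d \<in> UNIV \<rightarrow> A" for d :: "real \<Rightarrow> 'a"
        using that by (auto simp: fun_eq_iff)
      have "restrict \<phi> A \<in> funcs ?X"
        using \<open>\<phi> \<in> F\<close> eq by (auto simp: initial_fspace_def Let_def)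
      then show ?thesis using c eq by metis
    qed
    with c(1) show ?thesis by (simp add: initial_fspace_def Let_def)
  qed
  moreover have "points ?X = A"
    by (simp add: initial_fspace_def Let_def)
  ultimately have "{c \<in> UNIV \<rightarrow> points ?X. \<forall>\<theta> \<in> funcs ?X. smooth_real (\<theta> \<circ> c)} \<subseteq> curves ?X"
    by blast
  moreover have "curves ?X \<subseteq> {c \<in> UNIV \<rightarrow> points ?X. \<forall>\<theta> \<in> funcs ?X. smooth_real (\<theta> \<circ> c)}"
    by (auto simp: initial_fspace_def Let_def)
  ultimately have "curves ?X = {c \<in> UNIV \<rightarrow> points ?X. \<forall>\<theta> \<in> funcs ?X. smooth_real (\<theta> \<circ> c)}"
    by (rule subset_antisym[rotated])
  moreover have "funcs ?X = {\<theta> \<in> points ?X \<rightarrow>\<^sub>E UNIV. \<forall>c \<in> curves ?X. smooth_real (\<theta> \<circ> c)}"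
    by (simp add: initial_fspace_def Let_def)
  ultimately show ?thesis
    unfolding is_fspace_def by (rule conjI)
qed

lemma is_fspaceD:
  assumes "is_fspace X" "c \<in> curves X"
  shows "c t \<in> points X" "\<theta> \<in> funcs X \<Longrightarrow> smooth_real (\<theta> \<circ> c)"
  using assms unfolding is_fspace_def by blast+

lemma is_fspace_curveI:
  assumes "is_fspace X" "\<And>t. c t \<in> points X" "\<And>\<theta>. \<theta> \<in> funcs X \<Longrightarrow> smooth_real (\<theta> \<circ> c)"
  shows "c \<in> curves X"
  using assms unfolding is_fspace_def by blast

lemma const_in_curves:
  assumes "is_fspace X" "x \<in> points X"
  shows "(\<lambda>_. x) \<in> curves X"
  using assms smooth_real_const by (auto intro: is_fspace_curveI simp: comp_def)

lemma curve_reparametrize: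
  assumes "is_fspace X" "c \<in> curves X" "smooth_real s"
  shows "c \<circ> s \<in> curves X"
proof (rule is_fspace_curveI)
  fix \<theta> assume "\<theta> \<in> funcs X"
  then have "smooth_real ((\<theta> \<circ> c) \<circ> s)"
    using assms by (intro smooth_real_comp is_fspaceD)
  then show "smooth_real (\<theta> \<circ> (c \<circ> s))" by (simp add: o_assoc)
qed (use assms is_fspaceD in auto)

lemma curve_smooth_map:
  assumes "is_fspace X" "c \<in> curves X"
  shows "c \<in> smooth_maps real_line X"
  using is_fspaceD[OF assms] curve_reparametrize[OF assms]
  by (auto simp: smooth_maps_def real_line_def)

lemma smooth_maps_compose:
  assumes "is_fspace X" "f \<in> smooth_maps X Y" "g \<in> smooth_maps Y Z"
  shows "compose (points X) g f \<in> smooth_maps X Z"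
proof -
  have "compose (points X) g f \<circ> c = g \<circ> (f \<circ> c)" if "c \<in> curves X" for c
    using is_fspaceD(1)[OF assms(1) that] by (auto simp: fun_eq_iff compose_def)
  then show ?thesis
    using assms(2,3) unfolding smooth_maps_def by (auto simp: compose_def)
qed

lemma fs_limit_any_type:
  assumes L: "fs_limit TYPE(real) S D \<delta> L p"
  shows "fs_limit TYPE('x) S D \<delta> L p"
proof -
  have cone_L: "fs_cone S D \<delta> L p" using L unfolding fs_limit_def by blast
  have "\<exists>!u. u \<in> smooth_maps X L \<and> (\<forall>v \<in> verts S. compose (points X) (p v) u = q v)"
    if q: "fs_cone S D \<delta> X q" for X :: "'x fspace" and q
  proof -
    have X: "is_fspace X" using q unfolding fs_cone_def by blast
    have curve: "\<exists>!u. u \<in> smooth_maps real_line L \<and> (\<forall>v \<in> verts S. p v \<circ> u = q v \<circ> c)"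
      if c: "c \<in> curves X" for c
    proof -
      have cX: "c t \<in> points X" for t
        using X c by (rule is_fspaceD)
      have "q v \<circ> c \<in> smooth_maps real_line (D v)" if "v \<in> verts S" for v
      proof -
        have "compose (points real_line) (q v) c \<in> smooth_maps real_line (D v)"
          using that q curve_smooth_map[OF X c] is_fspace_real_line
          by (intro smooth_maps_compose) (auto simp: fs_cone_def)
        then show ?thesis by (simp add: real_line_def compose_def comp_def restrict_def)
      qed
      moreover have "compose UNIV (\<delta> a) (q (src S a) \<circ> c) = q (tgt S a) \<circ> c" if "a \<in> arrs S" for a
      proof -
        have "compose (points X) (\<delta> a) (q (src S a)) = q (tgt S a)"
          using q that unfolding fs_cone_def by blast
        then have "\<delta> a (q (src S a) x) = q (tgt S a) x" if "x \<in> points X" for x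
          using that by (metis compose_eq)
        then show ?thesis using cX by (auto simp: compose_def fun_eq_iff)
      qed
      ultimately have "fs_cone S D \<delta> real_line (\<lambda>v. q v \<circ> c)"
        unfolding fs_cone_def using is_fspace_real_line by (simp add: real_line_def)
      then have "\<exists>!u. u \<in> smooth_maps real_line L \<and>
          (\<forall>v \<in> verts S. compose (points real_line) (p v) u = q v \<circ> c)"
        using L unfolding fs_limit_def by blast
      moreover have "compose (points real_line) (p v) u = p v \<circ> u" for v u
        by (simp add: real_line_def compose_def comp_def restrict_def)
      ultimately show ?thesis by simp
    qed
    have point: "\<exists>!l. l \<in> points L \<and> (\<forall>v \<in> verts S. p v l = q v x)" if x: "x \<in> points X" for x
    proof -
      have cx: "(\<lambda>_. x) \<in> curves X" using X x by (rule const_in_curves)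
      then obtain u where u: "u \<in> smooth_maps real_line L" "\<forall>v \<in> verts S. p v \<circ> u = q v \<circ> (\<lambda>_. x)"
        and u_unique: "\<And>u'. u' \<in> smooth_maps real_line L \<Longrightarrow>
            \<forall>v \<in> verts S. p v \<circ> u' = q v \<circ> (\<lambda>_. x) \<Longrightarrow> u' = u"
        using curve by metis
      show ?thesis
      proof (rule ex1I[of _ "u 0"])
        show "u 0 \<in> points L \<and> (\<forall>v \<in> verts S. p v (u 0) = q v x)"
          using u by (auto simp: smooth_maps_def real_line_def fun_eq_iff)
      next
        fix l assume l: "l \<in> points L \<and> (\<forall>v \<in> verts S. p v l = q v x)"
        have "(\<lambda>_. l) \<in> smooth_maps real_line L"
          using l cone_L by (intro curve_smooth_map const_in_curves) (auto simp: fs_cone_def)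
        moreover have "\<forall>v \<in> verts S. p v \<circ> (\<lambda>_. l) = q v \<circ> (\<lambda>_. x)"
          using l by (auto simp: fun_eq_iff)
        ultimately show "l = u 0" using u_unique by metis
      qed
    qed
    define U where "U = (\<lambda>x \<in> points X. THE l. l \<in> points L \<and> (\<forall>v \<in> verts S. p v l = q v x))"
    have U: "U x \<in> points L \<and> (\<forall>v \<in> verts S. p v (U x) = q v x)" if "x \<in> points X" for x
      using theI'[OF point[OF that]] that by (simp add: U_def)
    have "U \<circ> c \<in> curves L" if c: "c \<in> curves X" for c
    proof -
      obtain u where u: "u \<in> smooth_maps real_line L" "\<forall>v \<in> verts S. p v \<circ> u = q v \<circ> c"
        using curve[OF c] by blast
      have cX: "c t \<in> points X" for t
        using X c by (rule is_fspaceD)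
      have "U (c t) = u t" for t
      proof -
        have "u t \<in> points L \<and> (\<forall>v \<in> verts S. p v (u t) = q v (c t))"
          using u by (auto simp: smooth_maps_def real_line_def fun_eq_iff)
        then show ?thesis using U[OF cX] point[OF cX] by blast
      qed
      then have "U \<circ> c = u \<circ> id" by auto
      also have "u \<circ> id \<in> curves L"
        using u(1) smooth_real_id unfolding smooth_maps_def real_line_def by auto
      finally show ?thesis .
    qed
    moreover have "U \<in> extensional (points X)" by (simp add: U_def)
    ultimately have U_smooth: "U \<in> smooth_maps X L"
      using U unfolding smooth_maps_def by (auto simp: PiE_def)
    have q_ext: "q v \<in> extensional (points X)" if "v \<in> verts S" for v
      using q that unfolding fs_cone_def smooth_maps_def PiE_def by blast
    show ?thesis
    proof (rule ex1I[of _ U])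
      show "U \<in> smooth_maps X L \<and> (\<forall>v \<in> verts S. compose (points X) (p v) U = q v)"
        using U_smooth U q_ext
        by (auto intro!: extensionalityI[of _ "points X"] simp: compose_eq)
    next
      fix u assume u: "u \<in> smooth_maps X L \<and> (\<forall>v \<in> verts S. compose (points X) (p v) u = q v)"
      have "u x = U x" if x: "x \<in> points X" for x
      proof -
        have "u x \<in> points L \<and> (\<forall>v \<in> verts S. p v (u x) = q v x)"
          using u x unfolding smooth_maps_def by (metis (no_types, lifting) PiE_mem compose_eq mem_Collect_eq)
        then show ?thesis using U[OF x] point[OF x] by blast
      qed
      then show "u = U"
        using u U_smooth unfolding smooth_maps_def PiE_def
        by (intro extensionalityI[of u "points X" U]) blast+
    qed
  qed
  with cone_L show ?thesis unfolding fs_limit_def by blast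
qed

end

theory Submission
  imports Defs "HOL-Analysis.Interval_Integral" "HOL-Computational_Algebra.Polynomial"
begin

text \<open>A point of the tangent space \<open>M \<otimes> W_D\<close> is the class of a curve \<open>F\<close> in \<open>M\<close>, and it is determined by
  its first-order jet: the point \<open>F 0\<close> together with the derivatives at \<open>0\<close> of \<open>\<theta> \<circ> F\<close> for the smooth
  functions \<open>\<theta>\<close> on \<open>M\<close> (\<open>W_D_point_eqI\<close>). A family of tangent points is a structure curve iff these
  data depend smoothly on the parameter (\<open>curves_prolong_W_D\<close>). Microlinearity, applied to the fibre
  product \<open>W_D2\<close> of two copies of \<open>W_D\<close> (\<open>weil_limit_pair\<close>), represents two tangent points over the same
  point of \<open>M\<close> as the classes of \<open>K t 0\<close> and \<open>K 0 t\<close> for one surface \<open>K\<close>. Their sum is the class of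
  \<open>K t t\<close>, so that derivatives add; in the same way scalar multiplication multiplies derivatives
  (\<open>tangent_add_jet\<close>, \<open>tangent_scale_jet\<close>). The laws of a vector space and the smoothness of the
  operations then reduce to statements about real numbers.

  The Euclidean property asks that \<open>(a, b) \<mapsto> [t \<mapsto> a + t b]\<close> is an isomorphism. It is injective because
  the value at \<open>0\<close> recovers \<open>a\<close> and the derivative of the jets recovers \<open>b\<close>. For surjectivity, take a
  curve \<open>F\<close> in one fibre of the tangent projection. By Weil exponentiability it agrees to first
  order with a curve \<open>y \<mapsto> [x \<mapsto> f x y]\<close> for a surface \<open>f\<close> in \<open>M\<close>; since \<open>F\<close> stays in one fibre, \<open>f\<close> is
  constant to first order along the axis \<open>x = 0\<close>. The algebra \<open>W_D2\<close> is also an equalizer: it consists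
  of the elements of \<open>W_D \<otimes> W_D\<close> that are constant on this axis, via the blow-down map
  \<open>(x, y) \<mapsto> (x, x * y)\<close> (\<open>weil_limit_equalizer\<close>). By microlinearity \<open>f x y\<close> may therefore be replaced
  by \<open>h x (x * y)\<close>, and for each \<open>y\<close> the class of \<open>x \<mapsto> h x (x * y)\<close> is \<open>a + y b\<close> with \<open>a = [x \<mapsto> h x 0]\<close>
  and \<open>b = [z \<mapsto> h 0 z]\<close> (\<open>euclidean_surj\<close>).

  The analytic input is Boman's theorem in the plane. A function of two variables counts as smooth
  when it is smooth along all smooth curves, and it has to be shown that its partial derivatives are
  smooth in this sense. Derivatives in one variable are locally bounded, since otherwise a
  single smooth curve would run through a sequence of points where they explode
  (\<open>smooth2_deriv_locally_bounded\<close>). Difference quotients then converge geometrically, and an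
  interpolation inequality upgrades this to all derivatives (\<open>smooth2_normal_derivative\<close>). This gives
  the smoothness of the Euclidean map, and it gives Hadamard's lemma, hence the
  Taylor normal forms that show \<open>W_D\<close>, \<open>W_D2\<close> and \<open>W_D \<otimes> W_D\<close> to be Weil algebras and the two diagrams
  above to be limits.\<close>

section \<open>Smooth functions of one variable\<close>

text \<open>Smoothness by coinduction: it suffices to exhibit a class of functions that is closed under
  differentiation. This form asks for a derivative of each member instead of the value of
  \<open>deriv\<close>.\<close>

lemma smooth_realI_deriv:
  assumes "P f" "\<And>g. P g \<Longrightarrow> \<exists>g'. P g' \<and> (\<forall>x. (g has_real_derivative g' x) (at x))"
  shows "smooth_real f"
proof (rule smooth_realI[of P])
  fix g x assume "P g"
  then show "g differentiable at x"
    using assms(2) real_differentiable_def by blast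
next
  fix g assume "P g"
  then obtain g' where g': "P g'" "\<forall>x. (g has_real_derivative g' x) (at x)"
    using assms(2) by blast
  then have "deriv g = g'" by (auto intro: DERIV_imp_deriv)
  with g' show "P (deriv g)" by simp
qed fact

lemma smooth_real_algebra:
  assumes "smooth_comp_algebra id f"
  shows "smooth_real f"
proof (rule smooth_realI_deriv[of "smooth_comp_algebra id", OF assms])
  fix g assume "smooth_comp_algebra id g"
  then show "\<exists>g'. smooth_comp_algebra id g' \<and> (\<forall>x. (g has_real_derivative g' x) (at x))"
    using smooth_comp_algebra_deriv[OF _ smooth_real_id] by blast
qed

lemma smooth_real_add:
  "smooth_real f \<Longrightarrow> smooth_real g \<Longrightarrow> smooth_real (\<lambda>x. f x + g x)"
  by (rule smooth_real_algebra) (intro smooth_comp_algebra.add smooth_comp_algebra.mult smooth_comp_algebra.base)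

lemma smooth_real_mult:
  "smooth_real f \<Longrightarrow> smooth_real g \<Longrightarrow> smooth_real (\<lambda>x. f x * g x)"
  by (rule smooth_real_algebra) (intro smooth_comp_algebra.add smooth_comp_algebra.mult smooth_comp_algebra.base)

lemma smooth_real_cmult: "smooth_real f \<Longrightarrow> smooth_real (\<lambda>x. c * f x)"
  by (intro smooth_real_mult smooth_real_const)

lemma smooth_real_diff:
  assumes "smooth_real f" "smooth_real g" shows "smooth_real (\<lambda>x. f x - g x)"
  using smooth_real_add[OF assms(1) smooth_real_cmult[OF assms(2), of "- 1"]] by simp

lemma smooth_real_ident: "smooth_real (\<lambda>x. x)"
  using smooth_real_id by (simp add: id_def)

lemma smooth_real_compose:
  "smooth_real f \<Longrightarrow> smooth_real g \<Longrightarrow> smooth_real (\<lambda>x. f (g x))"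
  using smooth_real_comp by (simp add: comp_def)

lemmas smooth_real_intros =
  smooth_real_add smooth_real_diff smooth_real_mult smooth_real_ident smooth_real_const

lemma smooth_real_deriv_iter: "smooth_real f \<Longrightarrow> smooth_real ((deriv ^^ k) f)"
  by (induction k) (auto intro: smooth_real_deriv)

lemma smooth_real_has_derivative:
  "smooth_real f \<Longrightarrow> (f has_real_derivative deriv f x) (at x)"
  by (simp add: DERIV_deriv_iff_real_differentiable smooth_real_differentiable)

lemma smooth_real_has_derivative_iter:
  "smooth_real f \<Longrightarrow> ((deriv ^^ k) f has_real_derivative (deriv ^^ Suc k) f x) (at x)"
  using smooth_real_has_derivative[OF smooth_real_deriv_iter] by simp

lemma smooth_real_continuous_on: "smooth_real f \<Longrightarrow> continuous_on S f"
  by (meson DERIV_isCont continuous_at_imp_continuous_on smooth_real_has_derivative)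

lemma smooth_real_bounded_on_Icc:
  assumes "smooth_real f"
  shows "\<exists>C. \<forall>t \<in> {a..b}. \<bar>f t\<bar> \<le> C"
proof -
  have "compact (f ` {a..b})"
    by (intro compact_continuous_image smooth_real_continuous_on assms compact_Icc)
  then have "bounded (f ` {a..b})" by (rule compact_imp_bounded)
  then obtain C where "\<forall>x \<in> f ` {a..b}. norm x \<le> C" unfolding bounded_iff by (rule exE)
  then show ?thesis by (intro exI[of _ C]) simp
qed

text \<open>Iterated derivatives only depend on the germ; so a function may be computed from a simpler one
  that agrees with it near the given point.\<close>

lemma deriv_iter_local:
  assumes "open S" "\<And>x. x \<in> S \<Longrightarrow> f x = g x" "x \<in> S"
  shows "(deriv ^^ k) f x = (deriv ^^ k) (g :: real \<Rightarrow> real) x"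
  using assms(3)
proof (induction k arbitrary: x)
  case 0 then show ?case using assms by simp
next
  case (Suc k)
  have "\<forall>\<^sub>F y in nhds x. (deriv ^^ k) f y = (deriv ^^ k) g y"
    using Suc assms(1) eventually_nhds by blast
  then show ?case by (simp add: deriv_cong_ev)
qed

lemma deriv_iter_affine:
  assumes "smooth_real f"
  shows "(deriv ^^ k) (\<lambda>x. c * f (a * x + b)) = (\<lambda>x. c * a ^ k * (deriv ^^ k) f (a * x + b))"
proof (induction k)
  case (Suc k)
  have "((\<lambda>x. c * a ^ k * (deriv ^^ k) f (a * x + b)) has_real_derivative
      c * a ^ Suc k * (deriv ^^ Suc k) f (a * x + b)) (at x)" for x
    by (rule derivative_eq_intros refl
        DERIV_chain2[OF smooth_real_has_derivative_iter[OF assms]])+ simp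
  then show ?case unfolding funpow.simps(2) o_apply Suc by (auto intro: DERIV_imp_deriv)
qed simp

lemma deriv_iter_cmult:
  "smooth_real f \<Longrightarrow> (deriv ^^ k) (\<lambda>x. c * f x) = (\<lambda>x. c * (deriv ^^ k) f x)"
  using deriv_iter_affine[of f k c 1 0] by simp

lemma deriv_iter_add:
  assumes "smooth_real f" "smooth_real g"
  shows "(deriv ^^ k) (\<lambda>x. f x + g x) = (\<lambda>x. (deriv ^^ k) f x + (deriv ^^ k) g x)"
proof (induction k)
  case (Suc k)
  have "((\<lambda>x. (deriv ^^ k) f x + (deriv ^^ k) g x) has_real_derivative
      (deriv ^^ Suc k) f x + (deriv ^^ Suc k) g x) (at x)" for x
    by (intro DERIV_add smooth_real_has_derivative_iter assms)
  then show ?case unfolding funpow.simps(2) o_apply Suc by (auto intro: DERIV_imp_deriv)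
qed simp

lemma deriv_iter_diff:
  assumes "smooth_real f" "smooth_real g"
  shows "(deriv ^^ k) (\<lambda>x. f x - g x) = (\<lambda>x. (deriv ^^ k) f x - (deriv ^^ k) g x)"
  using deriv_iter_add[OF assms(1) smooth_real_cmult[OF assms(2), of "- 1"], of k]
    deriv_iter_cmult[OF assms(2), of k "- 1"] by simp

text \<open>Termwise differentiation under the Weierstrass criterion. The class of all sums of series
  satisfying the majorisation hypothesis is closed under differentiation, so the coinduction
  rule applies.\<close>

lemma smooth_real_series:
  fixes f :: "nat \<Rightarrow> real \<Rightarrow> real"
  assumes "\<And>n. smooth_real (f n)"
    and "\<And>k R. \<exists>M. summable M \<and> (\<forall>n x. \<bar>x\<bar> \<le> R \<longrightarrow> \<bar>(deriv ^^ k) (f n) x\<bar> \<le> M n)"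
  shows "smooth_real (\<lambda>x. \<Sum>n. f n x)"
proof -
  define P where "P g \<longleftrightarrow> (\<exists>f. (\<forall>n. smooth_real (f n)) \<and>
      (\<forall>k R. \<exists>M. summable M \<and> (\<forall>n x. \<bar>x\<bar> \<le> R \<longrightarrow> \<bar>(deriv ^^ k) (f n) x\<bar> \<le> M n)) \<and>
      g = (\<lambda>x. \<Sum>n. f n x))" for g :: "real \<Rightarrow> real"
  have step: "\<exists>g'. P g' \<and> (\<forall>x. (g has_real_derivative g' x) (at x))" if "P g" for g
  proof -
    obtain f where f: "\<And>n. smooth_real (f n)"
      and bound: "\<And>k R. \<exists>M. summable M \<and> (\<forall>n x. \<bar>x\<bar> \<le> R \<longrightarrow> \<bar>(deriv ^^ k) (f n) x\<bar> \<le> M n)"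
      and g: "g = (\<lambda>x. \<Sum>n. f n x)"
      using \<open>P g\<close> unfolding P_def by metis
    have "P (\<lambda>x. \<Sum>n. deriv (f n) x)"
      unfolding P_def
    proof (intro exI[of _ "\<lambda>n. deriv (f n)"] conjI allI)
      fix k R
      show "\<exists>M. summable M \<and> (\<forall>n x. \<bar>x\<bar> \<le> R \<longrightarrow> \<bar>(deriv ^^ k) (deriv (f n)) x\<bar> \<le> M n)"
        using bound[of R "Suc k"] by (simp only: funpow_Suc_right o_apply)
    qed (use f smooth_real_deriv in auto)
    moreover have "(g has_real_derivative (\<Sum>n. deriv (f n) x)) (at x)" for x
    proof -
      define S where "S = {- (\<bar>x\<bar> + 1)..\<bar>x\<bar> + 1}"
      obtain M where M: "summable M" "\<And>n y. \<bar>y\<bar> \<le> \<bar>x\<bar> + 1 \<Longrightarrow> \<bar>deriv (f n) y\<bar> \<le> M n"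
        using bound[of "\<bar>x\<bar> + 1" 1] by auto
      obtain M0 where M0: "summable M0" "\<And>n y. \<bar>y\<bar> \<le> \<bar>x\<bar> + 1 \<Longrightarrow> \<bar>f n y\<bar> \<le> M0 n"
        using bound[of "\<bar>x\<bar> + 1" 0] by auto
      have "uniform_limit S (\<lambda>n x. \<Sum>i<n. deriv (f i) x) (\<lambda>x. \<Sum>i. deriv (f i) x) sequentially"
        using M by (intro Weierstrass_m_test) (auto simp: S_def)
      then have "uniformly_convergent_on S (\<lambda>n x. \<Sum>i<n. deriv (f i) x)"
        by (auto simp: uniformly_convergent_on_def)
      moreover have "summable (\<lambda>n. f n x)"
        using M0(2)[of x] by (intro summable_comparison_test'[OF M0(1)]) auto
      ultimately show ?thesis
        unfolding g
      proof (intro has_field_derivative_series'(2)[of S f "\<lambda>n. deriv (f n)" x])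
        show "(f n has_real_derivative deriv (f n) y) (at y within S)" for n y
          using smooth_real_has_derivative[OF f] by (rule has_field_derivative_at_within)
      qed (auto simp: S_def)
    qed
    ultimately show ?thesis by blast
  qed
  have "P (\<lambda>x. \<Sum>n. f n x)"
    unfolding P_def by (intro exI[of _ f] conjI allI assms refl)
  then show ?thesis
    by (rule smooth_realI_deriv[of P]) (rule step)
qed

section \<open>Bump functions\<close>

text \<open>The polynomial factor makes this family closed under differentiation; the constant polynomial
  \<open>1\<close> gives the classical function \<open>exp (- 1 / t)\<close>, extended by zero.\<close>

definition flat_exp :: "real poly \<Rightarrow> real \<Rightarrow> real" where
  "flat_exp p t = (if t > 0 then poly p (1 / t) * exp (- (1 / t)) else 0)"

lemma flat_exp_tendsto: "(flat_exp p \<longlongrightarrow> 0) (at 0)"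
proof -
  have "((\<lambda>y. \<Sum>i\<le>degree p. coeff p i * (y ^ i / exp y)) \<longlongrightarrow> (\<Sum>i\<le>degree p. coeff p i * 0)) at_top"
    by (intro tendsto_intros tendsto_power_div_exp_0)
  then have "((\<lambda>y. poly p y * exp (- y)) \<longlongrightarrow> 0) at_top"
    by (simp add: poly_altdef sum_distrib_right exp_minus divide_inverse mult.assoc)
  then have "((\<lambda>t. poly p (inverse t) * exp (- inverse t)) \<longlongrightarrow> 0) (at_right 0)"
    by (rule filterlim_compose[OF _ filterlim_inverse_at_top_right])
  then have "(flat_exp p \<longlongrightarrow> 0) (at_right 0)"
    by (rule Lim_transform_eventually)
      (auto simp: flat_exp_def inverse_eq_divide eventually_at_filter)
  moreover have "(flat_exp p \<longlongrightarrow> 0) (at_left 0)"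
    by (rule Lim_transform_eventually[of "\<lambda>_. 0"])
      (auto simp: flat_exp_def eventually_at_filter)
  ultimately show ?thesis by (intro filterlim_split_at)
qed

lemma flat_exp_deriv:
  "(flat_exp p has_real_derivative flat_exp ([:0, 0, 1:] * (p - pderiv p)) t) (at t)"
proof -
  consider "t > 0" | "t < 0" | "t = 0" by linarith
  then show ?thesis
  proof cases
    case 1
    have inv: "((\<lambda>t. 1 / t) has_real_derivative (- ((1 / t) ^ 2))) (at t)"
      using 1 by (auto intro!: derivative_eq_intros simp: power2_eq_square)
    have "((\<lambda>t. poly p (1 / t) * exp (- (1 / t))) has_real_derivative
        poly (pderiv p) (1 / t) * (- ((1 / t) ^ 2)) * exp (- (1 / t)) +
        exp (- (1 / t)) * (- (- ((1 / t) ^ 2))) * poly p (1 / t)) (at t)"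
      by (rule DERIV_mult[OF DERIV_chain2[OF poly_DERIV inv] DERIV_chain2[OF DERIV_exp DERIV_minus[OF inv]]])
    also have "poly (pderiv p) (1 / t) * (- ((1 / t) ^ 2)) * exp (- (1 / t)) +
        exp (- (1 / t)) * (- (- ((1 / t) ^ 2))) * poly p (1 / t) = flat_exp ([:0, 0, 1:] * (p - pderiv p)) t"
      using 1 by (simp add: flat_exp_def power2_eq_square right_diff_distrib left_diff_distrib)
    finally have "((\<lambda>t. poly p (1 / t) * exp (- (1 / t))) has_real_derivative
        flat_exp ([:0, 0, 1:] * (p - pderiv p)) t) (at t)" .
    moreover have "\<forall>\<^sub>F x in nhds t. poly p (1 / x) * exp (- (1 / x)) = flat_exp p x"
      using eventually_nhds_in_open[of "{0<..}" t] 1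
      by (simp add: flat_exp_def eventually_mono)
    ultimately show ?thesis
      using DERIV_cong_ev[OF refl _ refl, of "\<lambda>t. poly p (1 / t) * exp (- (1 / t))" "flat_exp p" t]
      by simp
  next
    case 2
    have "\<forall>\<^sub>F x in nhds t. 0 = flat_exp p x"
      using eventually_nhds_in_open[of "{..<0}" t] 2
      by (simp add: flat_exp_def eventually_mono)
    moreover have "((\<lambda>_. 0) has_real_derivative flat_exp ([:0, 0, 1:] * (p - pderiv p)) t) (at t)"
      using 2 by (simp add: flat_exp_def)
    ultimately show ?thesis
      using DERIV_cong_ev[OF refl _ refl, of "\<lambda>_. 0" "flat_exp p" t] by simp
  next
    case 3
    have "((\<lambda>h. (flat_exp p h - flat_exp p 0) / (h - 0)) \<longlongrightarrow> 0) (at 0)"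
      by (rule Lim_transform_eventually[OF flat_exp_tendsto[of "[:0, 1:] * p"]])
        (auto simp: flat_exp_def eventually_at_filter)
    then show ?thesis using 3 by (simp add: has_field_derivative_iff flat_exp_def)
  qed
qed

lemma smooth_real_flat_exp: "smooth_real (flat_exp p)"
proof (rule smooth_realI_deriv[of "\<lambda>f. \<exists>p. f = flat_exp p"])
  fix g assume "\<exists>p. g = flat_exp p"
  then obtain q where "g = flat_exp q" by (rule exE)
  then show "\<exists>g'. (\<exists>p. g' = flat_exp p) \<and> (\<forall>x. (g has_real_derivative g' x) (at x))"
    using flat_exp_deriv[of q] by auto
qed (rule exI, rule refl)

text \<open>A rescaled difference of two translates of a primitive of a bump function; the primitive is a
  smooth step, constant outside the support of the bump.\<close>

lemma smooth_plateau:
  obtains \<eta> where "smooth_real \<eta>" "\<And>t. \<bar>t\<bar> \<le> 1/3 \<Longrightarrow> \<eta> t = 1" "\<And>t. \<bar>t\<bar> \<ge> 1 \<Longrightarrow> \<eta> t = (0::real)"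
proof -
  define b where "b = (\<lambda>t. flat_exp 1 (1 - t) * flat_exp 1 (1 + t))"
  have b: "smooth_real b"
    unfolding b_def by (intro smooth_real_mult smooth_real_compose[OF smooth_real_flat_exp] smooth_real_intros)
  have b_pos: "b t > 0" if "\<bar>t\<bar> < 1" for t
    using that by (auto simp: b_def flat_exp_def)
  have b_zero: "b t = 0" if "\<bar>t\<bar> \<ge> 1" for t
    using that by (auto simp: b_def flat_exp_def)
  have "\<exists>F. \<forall>x :: real. -\<infinity> < ereal x \<longrightarrow> ereal x < \<infinity> \<longrightarrow> (F has_vector_derivative b x) (at x)"
    by (rule einterval_antiderivative) (use DERIV_isCont smooth_real_has_derivative[OF b] in auto)
  then obtain F where "\<And>x. (F has_vector_derivative b x) (at x)"
    by auto
  then have F: "(F has_real_derivative b x) (at x)" for x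
    by (simp add: has_real_derivative_iff_has_vector_derivative)
  have Fs: "smooth_real F"
  proof (rule smooth_realI_deriv[of "\<lambda>f. f = F \<or> smooth_real f"])
    fix g assume "g = F \<or> smooth_real g"
    then show "\<exists>g'. (g' = F \<or> smooth_real g') \<and> (\<forall>x. (g has_real_derivative g' x) (at x))"
    proof
      assume "smooth_real g"
      then show ?thesis
        by (intro exI[of _ "deriv g"]) (simp add: smooth_real_deriv smooth_real_has_derivative)
    qed (use F b in \<open>intro exI[of _ b], simp\<close>)
  qed simp
  have right: "F x = F 1" if "x \<ge> 1" for x
  proof (cases "x = 1")
    case False
    then have "\<exists>z>1. z < x \<and> F x - F 1 = (x - 1) * b z"
      using that F by (intro MVT2) auto
    then show ?thesis using b_zero by auto
  qed simp
  have left: "F x = F (- 1)" if "x \<le> - 1" for x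
  proof (cases "x = - 1")
    case False
    then have "\<exists>z>x. z < - 1 \<and> F (- 1) - F x = (- 1 - x) * b z"
      using that F by (intro MVT2) auto
    then show ?thesis using b_zero by auto
  qed simp
  have "\<exists>z>- 1. z < 1 \<and> F 1 - F (- 1) = (1 - (- 1)) * b z"
    using F by (intro MVT2) auto
  then obtain z where z: "\<bar>z\<bar> < 1" "F 1 - F (- 1) = (1 - (- 1)) * b z"
    by (metis abs_less_iff minus_less_iff)
  then have pos: "F 1 - F (- 1) > 0" using b_pos[of z] by simp
  define \<eta> where "\<eta> = (\<lambda>t. (1 / (F 1 - F (- 1))) * (F (3 * t + 2) - F (3 * t - 2)))"
  show thesis
  proof
    show "smooth_real \<eta>" unfolding \<eta>_def
      by (intro smooth_real_cmult smooth_real_diff smooth_real_compose[OF Fs] smooth_real_intros)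
    show "\<eta> t = 1" if "\<bar>t\<bar> \<le> 1/3" for t
      using that right[of "3 * t + 2"] left[of "3 * t - 2"] pos by (simp add: \<eta>_def)
    show "\<eta> t = 0" if "\<bar>t\<bar> \<ge> 1" for t
      using that right[of "3 * t + 2"] left[of "3 * t - 2"] right[of "3 * t - 2"] left[of "3 * t + 2"]
      by (cases "t \<ge> 1") (auto simp: \<eta>_def)
  qed
qed

lemma smooth_compact_support_bounded:
  assumes "smooth_real f" "\<And>t. \<bar>t\<bar> \<ge> 1 \<Longrightarrow> f t = 0"
  shows "\<exists>C. \<forall>t. \<bar>(deriv ^^ k) f t\<bar> \<le> C"
proof -
  obtain C where C: "\<forall>t \<in> {- 1..1}. \<bar>(deriv ^^ k) f t\<bar> \<le> C"
    using smooth_real_bounded_on_Icc[OF smooth_real_deriv_iter[OF assms(1)], of "- 1" 1 k] by (rule exE)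
  have "(deriv ^^ k) f t = 0" if "\<bar>t\<bar> > 1" for t
  proof -
    have "(deriv ^^ k) f t = (deriv ^^ k) (\<lambda>_. 0) t"
      using assms(2) that
      by (intro deriv_iter_local[of "{t. \<bar>t\<bar> > 1}"] open_Collect_less continuous_intros) auto
    also have "(deriv ^^ k) (\<lambda>_. 0 :: real) = (\<lambda>_. 0)" by (induction k) auto
    finally show ?thesis .
  qed
  moreover have "\<bar>(deriv ^^ k) f t\<bar> \<le> \<bar>C\<bar>" if "\<not> \<bar>t\<bar> > 1" for t
  proof -
    have "t \<in> {- 1..1}" using that by (auto simp: abs_le_iff not_less)
    then show ?thesis using C abs_ge_self[of C] order_trans by blast
  qed
  ultimately have "\<bar>(deriv ^^ k) f t\<bar> \<le> \<bar>C\<bar>" for t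
    by (metis abs_ge_zero abs_zero)
  then show ?thesis by blast
qed

section \<open>Boman's theorem in the plane\<close>

text \<open>Scaled copies of \<open>\<psi>\<close>, the \<open>n\<close>-th one with height \<open>\<beta> n\<close> and centred at \<open>1 / 2 ^ n\<close>. The factor
  \<open>8\<close> makes the supports disjoint.\<close>

definition pulses :: "(real \<Rightarrow> real) \<Rightarrow> (nat \<Rightarrow> real) \<Rightarrow> real \<Rightarrow> real" where
  "pulses \<psi> \<beta> t = (\<Sum>n. \<beta> n * \<psi> (8 * 2 ^ n * t + (- 8)))"

text \<open>The \<open>k\<close>-th derivative of the \<open>n\<close>-th pulse grows only like \<open>(2 ^ k) ^ n\<close>, which the factorial
  decay of the heights outweighs.\<close>

lemma smooth_real_pulses:
  assumes \<psi>: "smooth_real \<psi>" "\<And>t. \<bar>t\<bar> \<ge> 1 \<Longrightarrow> \<psi> t = 0"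
    and \<beta>: "\<And>n. \<bar>\<beta> n\<bar> \<le> inverse (fact n)"
  shows "smooth_real (pulses \<psi> \<beta>)"
  unfolding pulses_def
proof (rule smooth_real_series)
  fix n show "smooth_real (\<lambda>t. \<beta> n * \<psi> (8 * 2 ^ n * t + (- 8)))"
    by (intro smooth_real_cmult smooth_real_compose[OF \<psi>(1)] smooth_real_intros)
next
  fix k R
  obtain C where C: "\<And>t. \<bar>(deriv ^^ k) \<psi> t\<bar> \<le> C"
    using smooth_compact_support_bounded[OF \<psi>] by blast
  define M where "M n = C * 8 ^ k * (inverse (fact n) * (2 ^ k) ^ n)" for n
  have "\<bar>(deriv ^^ k) (\<lambda>t. \<beta> n * \<psi> (8 * 2 ^ n * t + (- 8))) t\<bar> \<le> M n" for n t
  proof -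
    have "\<bar>(deriv ^^ k) (\<lambda>t. \<beta> n * \<psi> (8 * 2 ^ n * t + (- 8))) t\<bar> =
        \<bar>\<beta> n\<bar> * (8 * 2 ^ n) ^ k * \<bar>(deriv ^^ k) \<psi> (8 * 2 ^ n * t + (- 8))\<bar>"
      unfolding deriv_iter_affine[OF \<psi>(1)] by (simp add: abs_mult)
    also have "\<dots> \<le> inverse (fact n) * (8 * 2 ^ n) ^ k * C"
      using \<beta> C by (intro mult_mono) auto
    also have "\<dots> = M n"
      by (simp add: M_def power_mult_distrib power_mult[symmetric] mult.commute)
    finally show ?thesis .
  qed
  moreover have "summable M"
    unfolding M_def by (intro summable_mult summable_exp)
  ultimately show "\<exists>M. summable M \<and> (\<forall>n x. \<bar>x\<bar> \<le> R \<longrightarrow>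
      \<bar>(deriv ^^ k) (\<lambda>t. \<beta> n * \<psi> (8 * 2 ^ n * t + (- 8))) x\<bar> \<le> M n)"
    by blast
qed

lemma pulses_near:
  assumes \<psi>: "\<And>t. \<bar>t\<bar> \<ge> 1 \<Longrightarrow> \<psi> t = 0"
    and t: "\<bar>8 * 2 ^ n * t - 8\<bar> < 1/3"
  shows "pulses \<psi> \<beta> t = \<beta> n * \<psi> (8 * 2 ^ n * t - 8)"
proof -
  have "\<beta> j * \<psi> (8 * 2 ^ j * t + (- 8)) = 0" if "j \<noteq> n" for j
  proof -
    define s where "s = 2 ^ n * t"
    have s: "s < 25/24" "s > 23/24" using t by (auto simp: s_def abs_if split: if_splits)
    consider i where "j = n + Suc i" | i where "n = j + Suc i"
      using \<open>j \<noteq> n\<close> by (metis less_imp_Suc_add nat_neq_iff add_Suc_right)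
    then have "\<bar>8 * 2 ^ j * t + (- 8)\<bar> \<ge> 1"
    proof cases
      case 1
      have "2 ^ j * t = 2 * 2 ^ i * s" by (simp add: 1 s_def power_add)
      moreover have "1 * s \<le> 2 ^ i * s" using s by (intro mult_right_mono) auto
      ultimately show ?thesis using s by linarith
    next
      case 2
      have "s = 2 * 2 ^ i * (2 ^ j * t)" by (simp add: 2 s_def power_add)
      moreover have "t > 0" using s zero_less_mult_pos[of "2 ^ n" t] by (simp add: s_def)
      then have "1 * (2 ^ j * t) \<le> 2 ^ i * (2 ^ j * t)" by (intro mult_right_mono) auto
      ultimately show ?thesis using s by linarith
    qed
    then show ?thesis using \<psi> by simp
  qed
  then have "pulses \<psi> \<beta> t = (\<Sum>j\<in>{n}. \<beta> j * \<psi> (8 * 2 ^ j * t + (- 8)))"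
    unfolding pulses_def by (intro suminf_finite) auto
  then show ?thesis by simp
qed

text \<open>The functions on the plane that are smooth along every smooth curve. These are the structure
  functions of the standard structure on the plane, and the definition makes their closure under
  substitution immediate; what takes work is that they are differentiable in the usual sense.\<close>

definition smooth2 :: "(real \<Rightarrow> real \<Rightarrow> real) \<Rightarrow> bool" where
  "smooth2 H \<longleftrightarrow> (\<forall>a b. smooth_real a \<longrightarrow> smooth_real b \<longrightarrow> smooth_real (\<lambda>t. H (a t) (b t)))"

lemma smooth2D: "smooth2 H \<Longrightarrow> smooth_real a \<Longrightarrow> smooth_real b \<Longrightarrow> smooth_real (\<lambda>t. H (a t) (b t))"
  by (simp add: smooth2_def)

lemma smooth2_fix:
  "smooth2 H \<Longrightarrow> smooth_real (\<lambda>s. H s y)" "smooth2 H \<Longrightarrow> smooth_real (H x)"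
  using smooth2D[of H "\<lambda>s. s" "\<lambda>_. y"] smooth2D[of H "\<lambda>_. x" "\<lambda>s. s"]
  by (auto intro: smooth_real_intros)

lemma smooth2_compose:
  assumes "smooth2 H" "smooth2 A" "smooth2 B"
  shows "smooth2 (\<lambda>x y. H (A x y) (B x y))"
  using assms by (simp add: smooth2_def)

lemma smooth2_real: "smooth_real f \<Longrightarrow> smooth2 A \<Longrightarrow> smooth2 (\<lambda>x y. f (A x y))"
  by (auto simp: smooth2_def intro!: smooth_real_compose[of f])

lemma smooth2_intros:
  "smooth2 (\<lambda>x y. x)" "smooth2 (\<lambda>x y. y)" "smooth2 (\<lambda>x y. c)"
  "smooth2 A \<Longrightarrow> smooth2 B \<Longrightarrow> smooth2 (\<lambda>x y. A x y + B x y)"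
  "smooth2 A \<Longrightarrow> smooth2 B \<Longrightarrow> smooth2 (\<lambda>x y. A x y - B x y)"
  "smooth2 A \<Longrightarrow> smooth2 B \<Longrightarrow> smooth2 (\<lambda>x y. A x y * B x y)"
  by (simp_all add: smooth2_def smooth_real_const smooth_real_add smooth_real_diff smooth_real_mult)

lemma smooth2_swap: "smooth2 H \<Longrightarrow> smooth2 (\<lambda>x y. H y x)"
  by (simp add: smooth2_def)

text \<open>The core of Boman's theorem. If the \<open>m\<close>-th derivative were unbounded near \<open>(x0, y0)\<close>, there
  would be points \<open>(X n, Y n)\<close> converging to it factorially fast at which that derivative
  exceeds any prescribed size. The pulses produce one smooth curve that runs through
  \<open>(X n, Y n)\<close> at time \<open>1 / 2 ^ n\<close>, moving horizontally with speed \<open>\<delta> n\<close> there. Along it the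
  \<open>m\<close>-th derivative at that time is \<open>\<delta> n ^ m\<close> times the derivative at the bad point, at least
  \<open>n\<close>; this contradicts boundedness on the unit interval.\<close>

lemma smooth2_deriv_locally_bounded:
  assumes "smooth2 H"
  shows "\<exists>e>0. \<exists>B. \<forall>x y. \<bar>x - x0\<bar> \<le> e \<longrightarrow> \<bar>y - y0\<bar> \<le> e \<longrightarrow> \<bar>(deriv ^^ m) (\<lambda>s. H s y) x\<bar> \<le> B"
proof (rule ccontr)
  assume none: "\<not> ?thesis"
  have neg: "\<exists>x y. \<bar>x - x0\<bar> \<le> e \<and> \<bar>y - y0\<bar> \<le> e \<and> \<not> \<bar>(deriv ^^ m) (\<lambda>s. H s y) x\<bar> \<le> B"
    if "e > 0" for e B
  proof (rule ccontr)
    assume "\<not> ?thesis"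
    then have "\<forall>x y. \<bar>x - x0\<bar> \<le> e \<longrightarrow> \<bar>y - y0\<bar> \<le> e \<longrightarrow> \<bar>(deriv ^^ m) (\<lambda>s. H s y) x\<bar> \<le> B"
      by (simp only: not_ex de_Morgan_conj not_not imp_conv_disj simp_thms)
    then show False
      by - (rule notE[OF none], intro exI[of _ e] exI[of _ B] conjI that)
  qed
  define \<delta> :: "nat \<Rightarrow> real" where "\<delta> n = inverse (fact n)" for n
  have \<delta>: "\<delta> n > 0" for n by (simp add: \<delta>_def)
  have "\<forall>n. \<exists>x y. \<bar>x - x0\<bar> \<le> \<delta> n \<and> \<bar>y - y0\<bar> \<le> \<delta> n \<and>
      \<not> \<bar>(deriv ^^ m) (\<lambda>s. H s y) x\<bar> \<le> real n / \<delta> n ^ m"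
    by (intro allI neg \<delta>)
  then obtain X Y where XY: "\<forall>n. \<bar>X n - x0\<bar> \<le> \<delta> n \<and> \<bar>Y n - y0\<bar> \<le> \<delta> n \<and>
      \<not> \<bar>(deriv ^^ m) (\<lambda>s. H s (Y n)) (X n)\<bar> \<le> real n / \<delta> n ^ m"
    unfolding choice_iff by (elim exE)
  then have X: "\<And>n. \<bar>X n - x0\<bar> \<le> \<delta> n" and Y: "\<And>n. \<bar>Y n - y0\<bar> \<le> \<delta> n"
    and big: "\<And>n. \<bar>(deriv ^^ m) (\<lambda>s. H s (Y n)) (X n)\<bar> > real n / \<delta> n ^ m"
    by (simp_all add: not_le)
  obtain \<eta> where \<eta>: "smooth_real \<eta>" "\<And>t. \<bar>t\<bar> \<le> 1/3 \<Longrightarrow> \<eta> t = 1" "\<And>t. \<bar>t\<bar> \<ge> 1 \<Longrightarrow> \<eta> t = (0::real)"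
    using smooth_plateau by blast
  define \<psi> where "\<psi> = (\<lambda>t. t * \<eta> t)"
  have \<psi>: "smooth_real \<psi>" "\<And>t. \<bar>t\<bar> \<ge> 1 \<Longrightarrow> \<psi> t = 0"
    using \<eta> by (auto simp: \<psi>_def intro: smooth_real_intros)
  \<comment> \<open>The plateau \<open>\<eta>\<close> moves the curve to the bad point; \<open>\<psi>\<close> is the identity near its centre and
    adds the horizontal motion, with \<open>\<delta> n / (8 * 2 ^ n)\<close> compensating the rate \<open>8 * 2 ^ n\<close> of
    the pulse.\<close>
  define a where "a t = x0 + pulses \<eta> (\<lambda>n. X n - x0) t + pulses \<psi> (\<lambda>n. \<delta> n / (8 * 2 ^ n)) t" for t
  define b where "b t = y0 + pulses \<eta> (\<lambda>n. Y n - y0) t" for t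
  have small: "\<bar>\<delta> n / (8 * 2 ^ n)\<bar> \<le> \<delta> n" for n
  proof -
    have "(1::real) \<le> 8 * 2 ^ n" using one_le_power[of "2::real" n] by linarith
    then show ?thesis using \<delta>[of n] by (simp add: divide_le_eq)
  qed
  have "smooth_real (pulses \<eta> (\<lambda>n. X n - x0))" "smooth_real (pulses \<eta> (\<lambda>n. Y n - y0))"
    "smooth_real (pulses \<psi> (\<lambda>n. \<delta> n / (8 * 2 ^ n)))"
    by (rule smooth_real_pulses; use \<eta> \<psi> X Y small in \<open>simp add: \<delta>_def\<close>)+
  then have "smooth_real a" "smooth_real b"
    unfolding a_def b_def by (simp_all add: smooth_real_add smooth_real_const)
  then have c: "smooth_real (\<lambda>t. H (a t) (b t))" using assms by (simp add: smooth2_def)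
  have at_n: "(deriv ^^ m) (\<lambda>t. H (a t) (b t)) (1 / 2 ^ n) = \<delta> n ^ m * (deriv ^^ m) (\<lambda>s. H s (Y n)) (X n)" for n
  proof -
    define S :: "real set" where "S = {t. \<bar>8 * 2 ^ n * t - 8\<bar> < 1/3}"
    have "H (a t) (b t) = 1 * H (\<delta> n * t + (X n - \<delta> n * (1 / 2 ^ n))) (Y n)" if "t \<in> S" for t
    proof -
      have t: "\<bar>8 * 2 ^ n * t - 8\<bar> < 1/3" using that by (simp add: S_def)
      have near: "pulses \<eta> \<beta> t = \<beta> n * \<eta> (8 * 2 ^ n * t - 8)"
        "pulses \<psi> \<beta> t = \<beta> n * \<psi> (8 * 2 ^ n * t - 8)" for \<beta>
        by (rule pulses_near[OF _ t]; use \<eta>(3) \<psi>(2) in simp)+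
      have "a t = \<delta> n * t + (X n - \<delta> n * (1 / 2 ^ n))"
        unfolding a_def near
        using t \<eta>(2)[of "8 * 2 ^ n * t - 8"] by (simp add: \<psi>_def field_simps)
      moreover have "b t = Y n"
        unfolding b_def near using t \<eta>(2)[of "8 * 2 ^ n * t - 8"] by simp
      ultimately show ?thesis by simp
    qed
    moreover have "open S" unfolding S_def by (intro open_Collect_less continuous_intros)
    ultimately have "(deriv ^^ m) (\<lambda>t. H (a t) (b t)) (1 / 2 ^ n) =
        (deriv ^^ m) (\<lambda>t. 1 * H (\<delta> n * t + (X n - \<delta> n * (1 / 2 ^ n))) (Y n)) (1 / 2 ^ n)"
      by (intro deriv_iter_local[of S]) (auto simp: S_def)
    also have "\<dots> = \<delta> n ^ m * (deriv ^^ m) (\<lambda>s. H s (Y n)) (X n)"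
      by (subst deriv_iter_affine[where f = "\<lambda>s. H s (Y n)", OF smooth2_fix(1)[OF assms]]) simp
    finally show ?thesis .
  qed
  obtain C where C: "\<forall>t \<in> {0..1}. \<bar>(deriv ^^ m) (\<lambda>t. H (a t) (b t)) t\<bar> \<le> C"
    using smooth_real_bounded_on_Icc[OF smooth_real_deriv_iter[OF c], of 0 1 m] by (rule exE)
  have "real n \<le> C" for n
  proof -
    have "real n = \<delta> n ^ m * (real n / \<delta> n ^ m)" using \<delta>[of n] by simp
    also have "\<dots> \<le> \<delta> n ^ m * \<bar>(deriv ^^ m) (\<lambda>s. H s (Y n)) (X n)\<bar>"
      using big[of n] \<delta>[of n] by (intro mult_left_mono) auto
    also have "\<dots> = \<bar>(deriv ^^ m) (\<lambda>t. H (a t) (b t)) (1 / 2 ^ n)\<bar>"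
      using \<delta>[of n] by (simp add: at_n abs_mult)
    also have "\<dots> \<le> C" using C by (simp add: divide_le_eq)
    finally show ?thesis .
  qed
  then show False using reals_Archimedean2 by (metis linorder_not_less)
qed

text \<open>Compactness of the box turns the local bounds into a uniform one.\<close>

lemma smooth2_deriv_bounded_on_box:
  assumes "smooth2 H"
  shows "\<exists>B. \<forall>x y. \<bar>x\<bar> \<le> R \<longrightarrow> \<bar>y\<bar> \<le> R \<longrightarrow> \<bar>(deriv ^^ m) (\<lambda>s. H s y) x\<bar> \<le> B"
proof (rule ccontr)
  assume none: "\<not> ?thesis"
  have ex: "\<exists>p. p \<in> {- R..R} \<times> {- R..R} \<and> \<bar>(deriv ^^ m) (\<lambda>s. H s (snd p)) (fst p)\<bar> > real n" for n
  proof (rule ccontr)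
    assume not_ex: "\<not> ?thesis"
    have *: "\<not> (p \<in> {- R..R} \<times> {- R..R} \<and> \<bar>(deriv ^^ m) (\<lambda>s. H s (snd p)) (fst p)\<bar> > real n)" for p
      by (rule notI, rule notE[OF not_ex], rule exI)
    have "\<bar>(deriv ^^ m) (\<lambda>s. H s y) x\<bar> \<le> real n" if "\<bar>x\<bar> \<le> R" "\<bar>y\<bar> \<le> R" for x y
    proof -
      have "(x, y) \<in> {- R..R} \<times> {- R..R}" using that by (auto simp: abs_le_iff)
      with *[of "(x, y)"] show ?thesis by (simp only: fst_conv snd_conv simp_thms not_less)
    qed
    then show False by - (rule notE[OF none], intro exI[of _ "real n"] allI impI)
  qed
  then have "\<forall>n. \<exists>p. p \<in> {- R..R} \<times> {- R..R} \<and> \<bar>(deriv ^^ m) (\<lambda>s. H s (snd p)) (fst p)\<bar> > real n"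
    by (intro allI ex)
  then obtain p where "\<forall>n. p n \<in> {- R..R} \<times> {- R..R} \<and>
      \<bar>(deriv ^^ m) (\<lambda>s. H s (snd (p n))) (fst (p n))\<bar> > real n"
    unfolding choice_iff by (elim exE)
  then have p: "p n \<in> {- R..R} \<times> {- R..R}"
    and big: "\<bar>(deriv ^^ m) (\<lambda>s. H s (snd (p n))) (fst (p n))\<bar> > real n" for n
    by (simp_all only:)
  have compact: "seq_compact ({- R..R} \<times> {- R..R})"
    by (intro compact_imp_seq_compact compact_Times compact_Icc)
  obtain l r where r: "strict_mono r" and l: "(p \<circ> r) \<longlonglongrightarrow> l"
  proof (rule seq_compactE[OF compact])
    show "\<forall>n. p n \<in> {- R..R} \<times> {- R..R}" by (intro allI p)
  qed (rule that)
  obtain e B where e: "e > 0" and B: "\<And>x y. \<bar>x - fst l\<bar> \<le> e \<Longrightarrow> \<bar>y - snd l\<bar> \<le> e \<Longrightarrow>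
      \<bar>(deriv ^^ m) (\<lambda>s. H s y) x\<bar> \<le> B"
    using smooth2_deriv_locally_bounded[OF assms, of "fst l" "snd l" m] by auto
  obtain N where N: "\<forall>n\<ge>N. dist ((p \<circ> r) n) l < e"
    using metric_LIMSEQ_D[OF l e] by (rule exE)
  obtain k :: nat where k: "B < real k"
    using reals_Archimedean2 by (rule exE)
  define n where "n = max N k"
  have n: "dist (p (r n)) l < e" "real n > B"
    using N k by (auto simp: n_def)
  have "dist (fst (p (r n))) (fst l) \<le> e" "dist (snd (p (r n))) (snd l) \<le> e"
    using n(1) dist_fst_le[of "p (r n)" l] dist_snd_le[of "p (r n)" l] by linarith+
  then have "\<bar>(deriv ^^ m) (\<lambda>s. H s (snd (p (r n)))) (fst (p (r n)))\<bar> \<le> B"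
    by (intro B) (auto simp: dist_real_def)
  moreover have "real n \<le> real (r n)" using strict_mono_imp_increasing[OF r] by simp
  ultimately show False using big[of "r n"] n(2) by linarith
qed

section \<open>Interpolation of derivatives\<close>

text \<open>All norms on the space of polynomials of degree below \<open>m\<close> are equivalent. The induction
  removes the leading term by passing from \<open>p y\<close> to \<open>2 ^ m * p (y / 2) - p y\<close>, which multiplies
  the lower coefficients by factors of modulus at least \<open>1\<close>.\<close>

lemma poly_coeff_bound:
  "\<exists>C\<ge>0. \<forall>a A. (\<forall>y\<in>{0..1}. \<bar>\<Sum>k<m. a k * y ^ k\<bar> \<le> A) \<longrightarrow> (\<forall>k<m. \<bar>a k\<bar> \<le> C * (A::real))"
proof (induction m)
  case 0 show ?case by (intro exI[of _ 0]) auto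
next
  case (Suc m)
  then obtain C where C: "C \<ge> 0" "\<And>a A. \<forall>y\<in>{0..1}. \<bar>\<Sum>k<m. a k * y ^ k\<bar> \<le> A \<Longrightarrow>
      \<forall>k<m. \<bar>a k\<bar> \<le> C * (A::real)"
    by auto
  define K where "K = C * (2 ^ m + 1)"
  have K: "K \<ge> 0" using C by (simp add: K_def)
  have "\<bar>a k\<bar> \<le> (1 + (real m + 1) * K) * A"
    if a: "\<forall>y\<in>{0..1}. \<bar>\<Sum>k<Suc m. a k * y ^ k\<bar> \<le> A" and "k < Suc m" for a k A
  proof -
    define p where "p y = (\<Sum>k<Suc m. a k * y ^ k)" for y
    have p: "\<bar>p y\<bar> \<le> A" if "y \<in> {0..1}" for y using a that by (auto simp: p_def)
    have A: "A \<ge> 0" using p[of 0] by simp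
    have "\<bar>\<Sum>k<m. ((2 ^ (m - k) - 1) * a k) * y ^ k\<bar> \<le> (2 ^ m + 1) * A" if y: "y \<in> {0..1}" for y
    proof -
      have "(2 ^ (m - k) - 1) * a k * y ^ k = 2 ^ m * (a k * (y / 2) ^ k) - a k * y ^ k" if "k < m" for k
        using that by (simp add: power_divide power_diff field_simps)
      then have "(\<Sum>k<m. ((2 ^ (m - k) - 1) * a k) * y ^ k) =
          (\<Sum>k<m. 2 ^ m * (a k * (y / 2) ^ k) - a k * y ^ k)"
        by (intro sum.cong) auto
      also have "\<dots> = 2 ^ m * p (y / 2) - p y"
        by (simp add: p_def sum_subtractf sum_distrib_left power_divide algebra_simps)
      also have "\<bar>\<dots>\<bar> \<le> 2 ^ m * \<bar>p (y / 2)\<bar> + \<bar>p y\<bar>"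
        by (metis abs_triangle_ineq4 abs_mult abs_numeral power_abs)
      also have "\<dots> \<le> 2 ^ m * A + A" using p[of y] p[of "y / 2"] y by (intro add_mono mult_left_mono) auto
      finally show ?thesis by (simp add: algebra_simps)
    qed
    then have b: "\<bar>(2 ^ (m - k) - 1) * a k\<bar> \<le> K * A" if "k < m" for k
      using C(2)[of "\<lambda>k. (2 ^ (m - k) - 1) * a k" "(2 ^ m + 1) * A"] that by (simp add: K_def mult.assoc)
    have low: "\<bar>a k\<bar> \<le> K * A" if "k < m" for k
    proof -
      have "(2::real) ^ 1 \<le> 2 ^ (m - k)" using that by (intro power_increasing) auto
      then have "1 * \<bar>a k\<bar> \<le> (2 ^ (m - k) - 1) * \<bar>a k\<bar>" by (intro mult_right_mono) auto
      also have "\<dots> = \<bar>(2 ^ (m - k) - 1) * a k\<bar>"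
        using \<open>(2::real) ^ 1 \<le> 2 ^ (m - k)\<close> by (simp add: abs_mult)
      also have "\<dots> \<le> K * A" using b[OF that] .
      finally show ?thesis by simp
    qed
    have KA: "0 \<le> K * A" "0 \<le> real m * (K * A)" using K A by auto
    show ?thesis
    proof (cases "k < m")
      case True
      have "K * A \<le> (1 + (real m + 1) * K) * A" using KA A by (simp add: algebra_simps)
      then show ?thesis using low[OF True] by linarith
    next
      case False
      then have "k = m" using \<open>k < Suc m\<close> by simp
      have "a m = p 1 - (\<Sum>k<m. a k)" by (simp add: p_def)
      then have "\<bar>a m\<bar> \<le> \<bar>p 1\<bar> + (\<Sum>k<m. \<bar>a k\<bar>)"
        using sum_abs[of a "{..<m}"] by linarith
      also have "\<dots> \<le> A + (\<Sum>k<m. K * A)"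
        using p[of 1] low by (intro add_mono sum_mono) auto
      also have "\<dots> \<le> (1 + (real m + 1) * K) * A" using KA by (simp add: algebra_simps)
      finally show ?thesis using \<open>k = m\<close> by simp
    qed
  qed
  moreover have "1 + (real m + 1) * K \<ge> 0" using K by simp
  ultimately show ?case by (intro exI[of _ "1 + (real m + 1) * K"] conjI allI impI)
qed

text \<open>An inequality of Kolmogorov type: up to an error controlled by the \<open>m\<close>-th derivative, the
  Taylor polynomial at \<open>s\<close> is bounded by \<open>A\<close> on an interval of length \<open>h\<close>, so its rescaled
  coefficients are bounded as well.\<close>

lemma derivative_interpolation:
  assumes "k < m"
  shows "\<exists>C. \<forall>f s h A B. smooth_real f \<longrightarrow> h > 0 \<longrightarrow> (\<forall>x\<in>{s..s + h}. \<bar>f x\<bar> \<le> A) \<longrightarrow>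
      (\<forall>x\<in>{s..s + h}. \<bar>(deriv ^^ m) f x\<bar> \<le> B) \<longrightarrow>
      \<bar>(deriv ^^ k) f s\<bar> * h ^ k \<le> C * (A + B * h ^ m)"
proof -
  obtain C where C: "\<And>a A. \<forall>y\<in>{0..1}. \<bar>\<Sum>k<m. a k * y ^ k\<bar> \<le> A \<Longrightarrow>
      \<forall>k<m. \<bar>a k\<bar> \<le> C * (A::real)"
    using poly_coeff_bound[of m] by auto
  have "\<bar>(deriv ^^ k) f s\<bar> * h ^ k \<le> fact k * C * (A + B * h ^ m)"
    if f: "smooth_real f" and h: "h > 0" and A: "\<forall>x\<in>{s..s + h}. \<bar>f x\<bar> \<le> A"
      and B: "\<forall>x\<in>{s..s + h}. \<bar>(deriv ^^ m) f x\<bar> \<le> B" for f s h A B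
  proof -
    define a where "a j = (deriv ^^ j) f s / fact j * h ^ j" for j
    have Bs: "\<bar>(deriv ^^ m) f s\<bar> \<le> B" using B h by auto
    then have B0: "B \<ge> 0" by linarith
    have "\<bar>\<Sum>j<m. a j * y ^ j\<bar> \<le> A + B * h ^ m" if y: "y \<in> {0..1}" for y
    proof (cases "y = 0")
      case True
      have "(\<Sum>j<m. a j * y ^ j) = (\<Sum>j\<in>{0}. a j * y ^ j)"
        using assms True by (intro sum.mono_neutral_right) auto
      then have "(\<Sum>j<m. a j * y ^ j) = f s" by (simp add: a_def)
      moreover have "\<bar>f s\<bar> \<le> A" using A h by auto
      moreover have "B * h ^ m \<ge> 0" using B0 h by simp
      ultimately show ?thesis by linarith
    next
      case False
      have hy: "h * y > 0" "h * y \<le> h" using False y h by (auto simp: mult_le_cancel_left1)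
      have "\<exists>t. (if s + h * y < s then s + h * y < t \<and> t < s else s < t \<and> t < s + h * y) \<and>
          f (s + h * y) = (\<Sum>j<m. ((deriv ^^ j) f s / fact j) * (s + h * y - s) ^ j) +
            ((deriv ^^ m) f t / fact m) * (s + h * y - s) ^ m"
        using assms hy smooth_real_has_derivative_iter[OF f]
        by (intro Taylor[of m "\<lambda>j. (deriv ^^ j) f" f s "s + h * y"]) auto
      then obtain t where t: "s < t" "t < s + h * y"
        and eq: "f (s + h * y) = (\<Sum>j<m. ((deriv ^^ j) f s / fact j) * (h * y) ^ j) +
            ((deriv ^^ m) f t / fact m) * (h * y) ^ m"
        using hy by auto
      have "(\<Sum>j<m. a j * y ^ j) = f (s + h * y) - ((deriv ^^ m) f t / fact m) * (h * y) ^ m"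
        unfolding eq by (simp add: a_def power_mult_distrib mult.assoc)
      moreover have "\<bar>((deriv ^^ m) f t / fact m) * (h * y) ^ m\<bar> \<le> B * h ^ m"
      proof -
        have "\<bar>(deriv ^^ m) f t / fact m\<bar> \<le> \<bar>(deriv ^^ m) f t\<bar> / 1"
          unfolding abs_divide by (intro frac_le) auto
        also have "\<dots> \<le> B" using B t hy by auto
        finally have "\<bar>(deriv ^^ m) f t / fact m\<bar> \<le> B" .
        moreover have "\<bar>(h * y) ^ m\<bar> \<le> h ^ m"
          using hy by (simp add: power_mono abs_mult)
        ultimately show ?thesis unfolding abs_mult using B0 by (intro mult_mono) auto
      qed
      moreover have "\<bar>f (s + h * y)\<bar> \<le> A" using A hy by auto
      ultimately show ?thesis by linarith
    qed
    then have "\<forall>k<m. \<bar>a k\<bar> \<le> C * (A + B * h ^ m)" by (intro C ballI)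
    then have "\<bar>a k\<bar> \<le> C * (A + B * h ^ m)" using assms by simp
    then have "fact k * \<bar>a k\<bar> \<le> fact k * (C * (A + B * h ^ m))" by (intro mult_left_mono) auto
    moreover have "fact k * \<bar>a k\<bar> = \<bar>(deriv ^^ k) f s\<bar> * h ^ k"
      using h by (simp add: a_def abs_mult)
    ultimately show ?thesis by (simp add: mult.assoc)
  qed
  then show ?thesis by (intro exI[of _ "fact k * C"] allI impI)
qed

lemma quadratic_Taylor_bound:
  assumes f: "smooth_real f" and h: "h > 0"
    and B: "\<And>x. 0 \<le> x \<Longrightarrow> x \<le> h \<Longrightarrow> \<bar>(deriv ^^ 2) f x\<bar> \<le> B"
  shows "\<bar>(f h - f 0) / h - deriv f 0\<bar> \<le> B * h"
proof -
  have "\<exists>t. (if h < 0 then h < t \<and> t < 0 else 0 < t \<and> t < h) \<and>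
      f h = (\<Sum>j<2. ((deriv ^^ j) f 0 / fact j) * (h - 0) ^ j) +
        ((deriv ^^ 2) f t / fact 2) * (h - 0) ^ 2"
    using h smooth_real_has_derivative_iter[OF f]
    by (intro Taylor[of 2 "\<lambda>j. (deriv ^^ j) f" f 0 h]) auto
  then obtain t where t: "0 < t" "t < h"
    and eq: "f h = (\<Sum>j<2. ((deriv ^^ j) f 0 / fact j) * (h - 0) ^ j) +
        ((deriv ^^ 2) f t / fact 2) * (h - 0) ^ 2"
    using h by auto
  have "(f h - f 0) / h - deriv f 0 = (deriv ^^ 2) f t * (h / 2)"
    unfolding eq using h by (simp add: numeral_2_eq_2 field_simps power2_eq_square)
  also have "\<bar>\<dots>\<bar> \<le> B * (h / 2)"
    using B[of t] t h by (simp add: abs_mult)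
  also have "\<dots> \<le> B * h"
    using B[of t] t h by (intro mult_left_mono) auto
  finally show ?thesis .
qed

section \<open>Differentiation and Hadamard's lemma\<close>

text \<open>The difference quotients \<open>q n\<close> at heights \<open>u n = 1 / 4 ^ n\<close> converge to the normal derivative
  with error of order \<open>u n\<close>, because the second derivatives in the normal direction are bounded.
  Their derivatives of order \<open>4 * k\<close> along the axis are only known to grow at most like \<open>4 ^ n\<close>.
  Interpolating between these two estimates shows that the \<open>k\<close>-th derivatives of the telescoping
  terms \<open>f n\<close> decay geometrically, so that the series can be differentiated termwise.\<close>

lemma smooth2_normal_derivative:
  assumes G: "smooth2 G"
  shows "smooth_real (\<lambda>s. deriv (G s) 0)"
proof -
  define u :: "nat \<Rightarrow> real" where "u n = 1 / 4 ^ n" for n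
  have u: "u n > 0" "u n \<le> 1" "u (Suc n) = u n / 4" for n by (simp_all add: u_def)
  define q where "q n s = (G s (u n) - G s 0) / u n" for n s
  define f where "f n s = q (Suc n) s - q n s" for n s
  have Gs: "smooth_real (\<lambda>s. G s y)" for y by (rule smooth2_fix(1)[OF G])
  have Gu: "smooth_real (G s)" for s by (rule smooth2_fix(2)[OF G])
  have q_eq: "q n = (\<lambda>s. 4 ^ n * G s (u n) - 4 ^ n * G s 0)" for n
    by (simp add: fun_eq_iff q_def u_def algebra_simps)
  have q: "smooth_real (q n)" for n
    unfolding q_eq by (intro smooth_real_diff smooth_real_cmult Gs)
  have f: "smooth_real (f n)" for n
    unfolding f_def by (intro smooth_real_diff q)
  have near: "\<exists>B. \<forall>n s. \<bar>s\<bar> \<le> R \<longrightarrow> \<bar>q n s - deriv (G s) 0\<bar> \<le> B * u n" for R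
  proof -
    define R' where "R' = max R 1"
    obtain B where B: "\<forall>x y. \<bar>x\<bar> \<le> R' \<longrightarrow> \<bar>y\<bar> \<le> R' \<longrightarrow> \<bar>(deriv ^^ 2) (\<lambda>s. G y s) x\<bar> \<le> B"
      using smooth2_deriv_bounded_on_box[OF smooth2_swap[OF G], of R' 2] by (rule exE)
    have "\<bar>q n s - deriv (G s) 0\<bar> \<le> B * u n" if "\<bar>s\<bar> \<le> R" for n s
      unfolding q_def
    proof (rule quadratic_Taylor_bound[OF Gu u(1)])
      fix x assume "0 \<le> x" "x \<le> u n"
      then have "\<bar>x\<bar> \<le> R'" using u(2)[of n] by (auto simp: R'_def)
      moreover have "\<bar>s\<bar> \<le> R'" using that by (auto simp: R'_def)
      ultimately show "\<bar>(deriv ^^ 2) (G s) x\<bar> \<le> B" by (intro B[rule_format])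
    qed
    then show ?thesis by (intro exI[of _ B] allI impI)
  qed
  have u_lim: "u \<longlonglongrightarrow> 0"
    using LIMSEQ_realpow_zero[of "1 / 4"] by (simp add: u_def[abs_def] power_one_over)
  have lim: "(\<lambda>n. q n s) \<longlonglongrightarrow> deriv (G s) 0" for s
  proof -
    obtain B where B: "\<forall>n x. \<bar>x\<bar> \<le> \<bar>s\<bar> \<longrightarrow> \<bar>q n x - deriv (G x) 0\<bar> \<le> B * u n"
      using near[of "\<bar>s\<bar>"] by (rule exE)
    have "(\<lambda>n. B * u n) \<longlonglongrightarrow> B * 0" by (intro tendsto_mult tendsto_const u_lim)
    then have Bu: "(\<lambda>n. B * u n) \<longlonglongrightarrow> 0" by simp
    have "norm (q n s - deriv (G s) 0) \<le> B * u n" for n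
      using spec[OF spec[OF B, of n], of s] by simp
    then have "(\<lambda>n. q n s - deriv (G s) 0) \<longlonglongrightarrow> 0"
      by (intro Lim_null_comparison[OF always_eventually Bu] allI)
    then show ?thesis by (rule LIM_zero_cancel)
  qed
  have sums: "(\<lambda>n. f n s) sums (deriv (G s) 0 - q 0 s)" for s
    unfolding f_def by (rule telescope_sums[OF lim])
  have "smooth_real (\<lambda>s. \<Sum>n. f n s)"
  proof (rule smooth_real_series[OF f])
    fix k and R :: real
    define R' where "R' = \<bar>R\<bar> + 1"
    obtain B0 where B0: "\<forall>n s. \<bar>s\<bar> \<le> R' \<longrightarrow> \<bar>q n s - deriv (G s) 0\<bar> \<le> B0 * u n"
      using near[of R'] by (rule exE)
    have f0: "\<bar>f n s\<bar> \<le> 2 * B0 * u n" if "\<bar>s\<bar> \<le> R'" for n s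
    proof -
      have "\<bar>q n s - deriv (G s) 0\<bar> \<le> B0 * u n" "\<bar>q (Suc n) s - deriv (G s) 0\<bar> \<le> B0 * u (Suc n)"
        by (intro B0[rule_format] that)+
      moreover from this have "0 \<le> B0 * u n" by linarith
      then have "B0 * u (Suc n) \<le> B0 * u n" by (simp add: u(3))
      ultimately show ?thesis unfolding f_def by linarith
    qed
    show "\<exists>M. summable M \<and> (\<forall>n x. \<bar>x\<bar> \<le> R \<longrightarrow> \<bar>(deriv ^^ k) (f n) x\<bar> \<le> M n)"
    proof (cases "k = 0")
      case True
      have "summable (\<lambda>n. 2 * B0 * u n)"
        unfolding u_def using summable_geometric[of "1 / 4 :: real"]
        by (intro summable_mult) (simp add: power_one_over)
      moreover have "\<bar>(deriv ^^ k) (f n) s\<bar> \<le> 2 * B0 * u n" if "\<bar>s\<bar> \<le> R" for n s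
      proof -
        have "\<bar>s\<bar> \<le> R'" using that by (simp add: R'_def)
        then show ?thesis using f0 True by simp
      qed
      ultimately show ?thesis
        by (intro exI[of _ "\<lambda>n. 2 * B0 * u n"] conjI allI impI)
    next
      case False
      obtain B where B: "\<forall>x y. \<bar>x\<bar> \<le> R' \<longrightarrow> \<bar>y\<bar> \<le> R' \<longrightarrow> \<bar>(deriv ^^ (4 * k)) (\<lambda>s. G s y) x\<bar> \<le> B"
        using smooth2_deriv_bounded_on_box[OF G, of R' "4 * k"] by (rule exE)
      have fm: "\<bar>(deriv ^^ (4 * k)) (f n) s\<bar> \<le> 10 * B * 4 ^ n" if s: "\<bar>s\<bar> \<le> R'" for n s
      proof -
        have bound: "\<bar>(deriv ^^ (4 * k)) (\<lambda>s. G s y) s\<bar> \<le> B" if "0 \<le> y" "y \<le> 1" for y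
        proof -
          have "\<bar>y\<bar> \<le> R'" using that by (simp add: R'_def)
          then show ?thesis by (intro B[rule_format] s)
        qed
        have dq: "(deriv ^^ (4 * k)) (q j) s = 4 ^ j * (deriv ^^ (4 * k)) (\<lambda>s. G s (u j)) s -
            4 ^ j * (deriv ^^ (4 * k)) (\<lambda>s. G s 0) s" for j
          by (simp only: q_eq deriv_iter_diff[OF smooth_real_cmult[OF Gs] smooth_real_cmult[OF Gs]]
              deriv_iter_cmult[OF Gs])
        have q_bound: "\<bar>(deriv ^^ (4 * k)) (q j) s\<bar> \<le> 2 * B * 4 ^ j" for j
        proof -
          have "\<bar>(deriv ^^ (4 * k)) (q j) s\<bar> = 4 ^ j * \<bar>(deriv ^^ (4 * k)) (\<lambda>s. G s (u j)) s -
              (deriv ^^ (4 * k)) (\<lambda>s. G s 0) s\<bar>"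
            by (simp add: dq abs_mult flip: right_diff_distrib)
          also have "\<dots> \<le> 4 ^ j * (2 * B)"
            using bound[of "u j"] bound[of 0] u[of j] by (intro mult_left_mono) auto
          finally show ?thesis by (simp add: mult.commute)
        qed
        have "(deriv ^^ (4 * k)) (f n) s = (deriv ^^ (4 * k)) (q (Suc n)) s - (deriv ^^ (4 * k)) (q n) s"
          by (simp only: f_def[abs_def] deriv_iter_diff[OF q q])
        then show ?thesis using q_bound[of n] q_bound[of "Suc n"] unfolding power_Suc by linarith
      qed
      have "k < 4 * k" using False by simp
      from derivative_interpolation[OF this] obtain C where
        C: "\<forall>f s h A B. smooth_real f \<longrightarrow> h > 0 \<longrightarrow> (\<forall>x\<in>{s..s + h}. \<bar>f x\<bar> \<le> A) \<longrightarrow>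
          (\<forall>x\<in>{s..s + h}. \<bar>(deriv ^^ (4 * k)) f x\<bar> \<le> B) \<longrightarrow>
          \<bar>(deriv ^^ k) f s\<bar> * h ^ k \<le> C * (A + B * h ^ (4 * k))"
        by (rule exE)
      \<comment> \<open>The interpolation step is \<open>h = r ^ n\<close>, with \<open>h ^ k = 1 / 2 ^ n\<close>. The order \<open>4 * k\<close> is
        chosen so that \<open>h ^ (4 * k) = 1 / 16 ^ n\<close> turns the growth \<open>4 ^ n\<close> into \<open>u n\<close>;
        dividing by \<open>h ^ k\<close> leaves a decay of \<open>1 / 2 ^ n\<close>.\<close>
      define r where "r = root k (1 / 2)"
      have r: "r > 0" "r \<le> 1" "r ^ k = 1 / 2"
        using False by (simp_all add: r_def)
      define K where "K = C * (2 * B0 + 10 * B)"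
      have "\<bar>(deriv ^^ k) (f n) s\<bar> \<le> K * (1 / 2) ^ n" if s: "\<bar>s\<bar> \<le> R" for n s
      proof -
        define h where "h = r ^ n"
        have h: "h > 0" "h \<le> 1" using r by (auto simp: h_def power_le_one)
        have hk: "h ^ k = (1 / 2) ^ n"
        proof -
          have "h ^ k = (r ^ k) ^ n" by (simp add: h_def mult.commute flip: power_mult)
          then show ?thesis by (simp only: r(3))
        qed
        have hm: "h ^ (4 * k) = (1 / 16) ^ n"
        proof -
          have "h ^ (4 * k) = (h ^ k) ^ 4" by (simp add: power_mult[symmetric] mult.commute)
          also have "\<dots> = ((1 / 2) ^ 4) ^ n" unfolding hk by (simp only: power_mult[symmetric] mult.commute)
          finally show ?thesis by (simp add: power_one_over)
        qed
        have in_box: "\<bar>x\<bar> \<le> R'" if "x \<in> {s..s + h}" for x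
          using that s h by (auto simp: R'_def abs_le_iff)
        have "\<bar>(deriv ^^ k) (f n) s\<bar> * h ^ k \<le> C * (2 * B0 * u n + (10 * B * 4 ^ n) * h ^ (4 * k))"
          by (rule C[rule_format, OF f h(1)]; intro f0 fm in_box)
        moreover have "(4 ^ n) * h ^ (4 * k) = u n"
        proof -
          have "(4 ^ n) * (1 / 16) ^ n = (4 * (1 / 16) :: real) ^ n" by (rule power_mult_distrib[symmetric])
          then show ?thesis by (simp add: hm u_def power_one_over)
        qed
        then have "C * (2 * B0 * u n + (10 * B * 4 ^ n) * h ^ (4 * k)) = K * u n"
          by (simp add: K_def mult.assoc distrib_right distrib_left)
        ultimately have "\<bar>(deriv ^^ k) (f n) s\<bar> * (1 / 2) ^ n \<le> K * u n" by (simp only: hk)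
        then have "\<bar>(deriv ^^ k) (f n) s\<bar> * (1 / 2) ^ n * 2 ^ n \<le> K * u n * 2 ^ n"
          by (intro mult_right_mono) auto
        moreover have "(1 / 2 :: real) ^ n * 2 ^ n = 1" by (simp add: power_one_over)
        moreover have "u n * 2 ^ n = (1 / 2) ^ n"
        proof -
          have "(1 / 4) ^ n * 2 ^ n = (1 / 4 * 2 :: real) ^ n" by (rule power_mult_distrib[symmetric])
          then show ?thesis by (simp add: u_def power_one_over)
        qed
        ultimately show ?thesis by (simp add: mult.assoc)
      qed
      moreover have "summable (\<lambda>n. K * (1 / 2) ^ n)"
        by (intro summable_mult summable_geometric) simp
      ultimately show ?thesis by (intro exI[of _ "\<lambda>n. K * (1 / 2) ^ n"] conjI allI impI)
    qed
  qed
  then have "smooth_real (\<lambda>s. q 0 s + (\<Sum>n. f n s))" by (intro smooth_real_add q)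
  moreover have "(\<lambda>s. q 0 s + (\<Sum>n. f n s)) = (\<lambda>s. deriv (G s) 0)"
    by (simp flip: sums_unique[OF sums])
  ultimately show ?thesis by simp
qed

text \<open>Along a curve \<open>(a, b)\<close> the partial derivative is the normal derivative of \<open>H (a s + u) (b s)\<close>
  at \<open>u = 0\<close>.\<close>

lemma smooth2_deriv:
  assumes "smooth2 H"
  shows "smooth2 (\<lambda>x y. deriv (\<lambda>s. H s y) x)" "smooth2 (\<lambda>x y. deriv (H x) y)"
proof -
  have *: "smooth_real (\<lambda>t. deriv (\<lambda>s. H s (b t)) (a t))"
    if H: "smooth2 H" and ab: "smooth_real a" "smooth_real b" for H a b
  proof -
    have "smooth2 (\<lambda>s u. H (a s + u) (b s))"
      by (intro smooth2_compose[OF H] smooth2_intros(4) smooth2_real[OF ab(1)]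
          smooth2_real[OF ab(2)] smooth2_intros(1,2))
    then have "smooth_real (\<lambda>t. deriv (\<lambda>u. H (a t + u) (b t)) 0)"
      by (rule smooth2_normal_derivative)
    moreover have "deriv (\<lambda>u. H (a t + u) (b t)) 0 = deriv (\<lambda>s. H s (b t)) (a t)" for t
    proof (rule DERIV_imp_deriv)
      have "((\<lambda>u. H (a t + u) (b t)) has_real_derivative deriv (\<lambda>s. H s (b t)) (a t + 0) * 1) (at 0)"
        by (rule DERIV_chain2[OF smooth_real_has_derivative[OF smooth2_fix(1)[OF H]]])
          (auto intro!: derivative_eq_intros)
      then show "((\<lambda>u. H (a t + u) (b t)) has_real_derivative deriv (\<lambda>s. H s (b t)) (a t)) (at 0)"
        by simp
    qed
    ultimately show ?thesis by simp
  qed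
  show "smooth2 (\<lambda>x y. deriv (\<lambda>s. H s y) x)"
    unfolding smooth2_def using *[OF assms] by (intro allI impI)
  show "smooth2 (\<lambda>x y. deriv (H x) y)"
    unfolding smooth2_def using *[OF smooth2_swap[OF assms]] by (intro allI impI)
qed

text \<open>The bound on the first derivative makes \<open>H\<close> Lipschitz in the first variable, uniformly in the
  second one.\<close>

lemma smooth2_continuous:
  assumes H: "smooth2 H"
  shows "continuous_on S (\<lambda>p. H (fst p) (snd p))"
proof -
  have cont: "isCont (\<lambda>p. H (fst p) (snd p)) (x0, y0)" for x0 y0
  proof -
    define R where "R = max \<bar>x0\<bar> \<bar>y0\<bar> + 1"
    obtain B where B: "\<forall>x y. \<bar>x\<bar> \<le> R \<longrightarrow> \<bar>y\<bar> \<le> R \<longrightarrow> \<bar>(deriv ^^ 1) (\<lambda>s. H s y) x\<bar> \<le> B"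
      using smooth2_deriv_bounded_on_box[OF H, of R 1] by (rule exE)
    have lip: "\<bar>H x y - H x0 y\<bar> \<le> B * \<bar>x - x0\<bar>" if "\<bar>x - x0\<bar> \<le> 1" "\<bar>y - y0\<bar> \<le> 1" for x y
    proof -
      have "norm (H x y - H x0 y) \<le> B * norm (x - x0)"
      proof (rule field_differentiable_bound[of "{x0 - 1..x0 + 1}"])
        fix z assume "z \<in> {x0 - 1..x0 + 1}"
        then have "\<bar>z\<bar> \<le> R" "\<bar>y\<bar> \<le> R" using that by (auto simp: R_def)
        with B[rule_format, of z y] show "norm (deriv (\<lambda>s. H s y) z) \<le> B" by simp
        show "((\<lambda>s. H s y) has_field_derivative deriv (\<lambda>s. H s y) z) (at z within {x0 - 1..x0 + 1})"
          by (rule has_field_derivative_at_within[OF smooth_real_has_derivative[OF smooth2_fix(1)[OF H]]])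
      qed (use that in \<open>auto simp: abs_le_iff\<close>)
      then show ?thesis by simp
    qed
    have "isCont (\<lambda>p. B * \<bar>fst p - x0\<bar>) (x0, y0)" by (intro continuous_intros)
    then have lim: "((\<lambda>p. B * \<bar>fst p - x0\<bar>) \<longlongrightarrow> 0) (at (x0, y0))" by (simp add: isCont_def)
    have near: "\<forall>\<^sub>F p in at (x0, y0). norm (H (fst p) (snd p) - H x0 (snd p)) \<le> B * \<bar>fst p - x0\<bar>"
    proof -
      have "\<forall>\<^sub>F p in at (x0, y0). dist p (x0, y0) < 1"
        unfolding eventually_at by (intro exI[of _ 1]) simp
      then show ?thesis
      proof (rule eventually_mono)
        fix p assume "dist p (x0, y0) < 1"
        then have "\<bar>fst p - x0\<bar> \<le> 1" "\<bar>snd p - y0\<bar> \<le> 1"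
          using dist_fst_le[of p "(x0, y0)"] dist_snd_le[of p "(x0, y0)"] by (simp_all add: dist_real_def)
        then show "norm (H (fst p) (snd p) - H x0 (snd p)) \<le> B * \<bar>fst p - x0\<bar>" using lip by simp
      qed
    qed
    have "((\<lambda>p. H x0 (snd p)) \<longlongrightarrow> H x0 (snd (x0, y0))) (at (x0, y0))"
    proof (rule isCont_tendsto_compose[where g = "H x0"])
      show "isCont (H x0) (snd (x0, y0))"
        by (rule DERIV_isCont[OF smooth_real_has_derivative[OF smooth2_fix(2)[OF H]]])
      show "(snd \<longlongrightarrow> snd (x0, y0)) (at (x0, y0))"
        by (rule tendsto_snd[OF tendsto_ident_at])
    qed
    from tendsto_add[OF Lim_null_comparison[OF near lim] this]
    show ?thesis by (simp add: isCont_def)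
  qed
  have "isCont (\<lambda>p. H (fst p) (snd p)) q" for q
    using cont[of "fst q" "snd q"] by simp
  then show ?thesis by (intro continuous_at_imp_continuous_on ballI)
qed

text \<open>Parameter integrals are closed under differentiation by the Leibniz rule, whose continuity
  hypothesis is available because partial derivatives are again smooth along curves.\<close>

lemma smooth_real_integral:
  assumes "smooth2 H"
  shows "smooth_real (\<lambda>s. integral {0..1} (H s))"
proof (rule smooth_realI_deriv[of "\<lambda>f. \<exists>H. smooth2 H \<and> f = (\<lambda>s. integral {0..1} (H s))"])
  fix g assume "\<exists>H. smooth2 H \<and> g = (\<lambda>s. integral {0..1} (H s))"
  then obtain H where H: "smooth2 H" and g: "g = (\<lambda>s. integral {0..1} (H s))" by auto
  let ?D = "\<lambda>x y. deriv (\<lambda>s. H s y) x"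
  have D: "smooth2 ?D" by (rule smooth2_deriv(1)[OF H])
  have "(g has_real_derivative integral {0..1} (?D x)) (at x)" for x
  proof -
    have "((\<lambda>s. integral (cbox 0 1) (H s)) has_field_derivative integral (cbox 0 1) (?D x)) (at x within UNIV)"
    proof (rule leibniz_rule_field_derivative)
      show "((\<lambda>s. H s t) has_field_derivative ?D x t) (at x within UNIV)" for x t
        by (rule smooth_real_has_derivative[OF smooth2_fix(1)[OF H]])
      show "H x integrable_on cbox 0 1" for x
        by (intro integrable_continuous smooth_real_continuous_on smooth2_fix(2)[OF H])
      show "continuous_on (UNIV \<times> cbox 0 1) (\<lambda>(x, t). ?D x t)"
        using smooth2_continuous[OF D] by (simp add: case_prod_beta')
    qed auto
    then show ?thesis by (simp add: g)
  qed
  then show "\<exists>g'. (\<exists>H. smooth2 H \<and> g' = (\<lambda>s. integral {0..1} (H s))) \<and>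
      (\<forall>x. (g has_real_derivative g' x) (at x))"
    using D by (intro exI[of _ "\<lambda>s. integral {0..1} (?D s)"] exI[of _ ?D] conjI allI refl)
qed (use assms in \<open>intro exI[of _ H] conjI refl\<close>)

text \<open>The quotient is the mean of the partial derivative over the segment from \<open>(0, y)\<close> to \<open>(x, y)\<close>.\<close>

lemma hadamard_quotient:
  assumes H: "smooth2 H"
  obtains A where "smooth2 A" "\<And>x y. H x y = H 0 y + x * A x y"
proof -
  let ?D = "\<lambda>x y. deriv (\<lambda>s. H s y) x"
  have D: "smooth2 ?D" by (rule smooth2_deriv(1)[OF H])
  define A where "A x y = integral {0..1} (\<lambda>t. ?D (t * x) y)" for x y
  have "smooth2 A"
    unfolding smooth2_def A_def
  proof (intro allI impI)
    fix a b assume ab: "smooth_real a" "smooth_real b"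
    have "smooth2 (\<lambda>s t. ?D (t * a s) (b s))"
      by (intro smooth2_compose[OF D] smooth2_intros(2,6) smooth2_real[OF ab(1)] smooth2_real[OF ab(2)] smooth2_intros(1))
    then show "smooth_real (\<lambda>s. integral {0..1} (\<lambda>t. ?D (t * a s) (b s)))"
      by (rule smooth_real_integral)
  qed
  moreover have "H x y = H 0 y + x * A x y" for x y
  proof -
    have "((\<lambda>t. x * ?D (t * x) y) has_integral H (1 * x) y - H (0 * x) y) {0..1}"
    proof (rule fundamental_theorem_of_calculus)
      fix t :: real
      have "((\<lambda>t. H (t * x) y) has_real_derivative ?D (t * x) y * x) (at t)"
        by (rule DERIV_chain2[OF smooth_real_has_derivative[OF smooth2_fix(1)[OF H]]])
          (auto intro!: derivative_eq_intros)
      then show "((\<lambda>t. H (t * x) y) has_vector_derivative x * ?D (t * x) y) (at t within {0..1})"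
        by (simp add: has_real_derivative_iff_has_vector_derivative has_vector_derivative_at_within mult.commute)
    qed simp
    from integral_unique[OF this] have "x * A x y = H x y - H 0 y" by (simp add: A_def)
    then show ?thesis by simp
  qed
  ultimately show thesis by (rule that)
qed

section \<open>The algebra of smooth functions\<close>

lemma points_euclid [simp]: "points (euclid n) = carrier_vec n"
  by (simp add: euclid_def initial_fspace_def Let_def)

lemma points_initial [simp]: "points (initial_fspace A F) = A"
  by (simp add: initial_fspace_def Let_def)

lemma curves_initial:
  "curves (initial_fspace A F) = {c. (\<forall>t. c t \<in> A) \<and> (\<forall>\<phi>\<in>F. smooth_real (\<lambda>t. \<phi> (c t)))}"
  by (auto simp: initial_fspace_def Let_def comp_def)

lemma curves_euclid:
  "curves (euclid n) = {c. (\<forall>t. c t \<in> carrier_vec n) \<and> (\<forall>i<n. smooth_real (\<lambda>t. c t $ i))}"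
  unfolding euclid_def curves_initial by auto

lemma mem_Cinf_iff:
  "h \<in> carrier (Cinf n) \<longleftrightarrow>
     h \<in> extensional (carrier_vec n) \<and> (\<forall>c\<in>curves (euclid n). smooth_real (\<lambda>t. h (c t)))"
  by (auto simp: Cinf_def smooth_maps_def real_line_def PiE_def comp_def)

lemma Cinf_simps:
  "a \<otimes>\<^bsub>Cinf n\<^esub> b = (\<lambda>x\<in>carrier_vec n. a x * b x)"
  "a \<oplus>\<^bsub>Cinf n\<^esub> b = (\<lambda>x\<in>carrier_vec n. a x + b x)"
  "\<one>\<^bsub>Cinf n\<^esub> = (\<lambda>x\<in>carrier_vec n. 1)"
  "\<zero>\<^bsub>Cinf n\<^esub> = (\<lambda>x\<in>carrier_vec n. 0)"
  by (simp_all add: Cinf_def)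

lemma euclid_curve_point: "c \<in> curves (euclid n) \<Longrightarrow> c t \<in> carrier_vec n"
  by (simp add: curves_euclid)

lemma restrict_mem_Cinf:
  assumes "\<And>c. c \<in> curves (euclid n) \<Longrightarrow> smooth_real (\<lambda>t. f (c t))"
  shows "(\<lambda>x\<in>carrier_vec n. f x) \<in> carrier (Cinf n)"
  using assms by (simp add: mem_Cinf_iff euclid_curve_point)

lemma Cinf_smooth: "h \<in> carrier (Cinf n) \<Longrightarrow> c \<in> curves (euclid n) \<Longrightarrow> smooth_real (\<lambda>t. h (c t))"
  by (simp add: mem_Cinf_iff)

lemma Cinf_ext: "h \<in> carrier (Cinf n) \<Longrightarrow> restrict h (carrier_vec n) = h"
  by (simp add: mem_Cinf_iff extensional_restrict)

lemma Cinf_closed: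
  assumes "a \<in> carrier (Cinf n)" "b \<in> carrier (Cinf n)"
  shows "(\<lambda>x\<in>carrier_vec n. a x + b x) \<in> carrier (Cinf n)"
    "(\<lambda>x\<in>carrier_vec n. a x - b x) \<in> carrier (Cinf n)"
    "(\<lambda>x\<in>carrier_vec n. a x * b x) \<in> carrier (Cinf n)"
    "(\<lambda>x\<in>carrier_vec n. r * a x) \<in> carrier (Cinf n)"
  by (rule restrict_mem_Cinf; simp add: smooth_real_add smooth_real_diff smooth_real_mult
      smooth_real_cmult Cinf_smooth[OF assms(1)] Cinf_smooth[OF assms(2)])+

lemma Cinf_const: "(\<lambda>x\<in>carrier_vec n. r) \<in> carrier (Cinf n)"
  by (rule restrict_mem_Cinf) (rule smooth_real_const)

lemma cring_Cinf: "cring (Cinf n)"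
proof (rule cringI)
  show "abelian_group (Cinf n)"
  proof (rule abelian_groupI)
    fix x assume x: "x \<in> carrier (Cinf n)"
    show "\<zero>\<^bsub>Cinf n\<^esub> \<oplus>\<^bsub>Cinf n\<^esub> x = x"
      by (subst (2) Cinf_ext[OF x, symmetric]) (simp add: Cinf_simps cong: restrict_cong)
    show "\<exists>y\<in>carrier (Cinf n). y \<oplus>\<^bsub>Cinf n\<^esub> x = \<zero>\<^bsub>Cinf n\<^esub>"
      by (rule bexI[OF _ Cinf_closed(4)[OF x x, of "- 1"]]) (simp add: Cinf_simps cong: restrict_cong)
  qed (auto simp: Cinf_simps Cinf_closed Cinf_const algebra_simps cong: restrict_cong)
  show "comm_monoid (Cinf n)"
  proof (rule comm_monoidI)
    fix x assume x: "x \<in> carrier (Cinf n)"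
    show "\<one>\<^bsub>Cinf n\<^esub> \<otimes>\<^bsub>Cinf n\<^esub> x = x"
      by (subst (2) Cinf_ext[OF x, symmetric]) (simp add: Cinf_simps cong: restrict_cong)
  qed (auto simp: Cinf_simps Cinf_closed Cinf_const algebra_simps cong: restrict_cong)
qed (auto simp: Cinf_simps algebra_simps cong: restrict_cong)

lemma ring_Cinf: "ring (Cinf n)"
  using cring_Cinf by (rule cring.axioms(1))

lemma Cinf_minus:
  assumes "a \<in> carrier (Cinf n)" "b \<in> carrier (Cinf n)"
  shows "a \<ominus>\<^bsub>Cinf n\<^esub> b = (\<lambda>x\<in>carrier_vec n. a x - b x)"
proof -
  interpret cring "Cinf n" by (rule cring_Cinf)
  have "\<ominus>\<^bsub>Cinf n\<^esub> b = (\<lambda>x\<in>carrier_vec n. - 1 * b x)"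
  proof (rule minus_equality)
    show "(\<lambda>x\<in>carrier_vec n. - 1 * b x) \<oplus>\<^bsub>Cinf n\<^esub> b = \<zero>\<^bsub>Cinf n\<^esub>"
      by (simp add: Cinf_simps cong: restrict_cong)
  qed (rule assms(2), rule Cinf_closed(4)[OF assms(2) assms(2)])
  then show ?thesis by (simp add: a_minus_def Cinf_simps cong: restrict_cong)
qed

section \<open>Weil algebras\<close>

text \<open>The list format matches that of \<open>Span\<close> in the definition of finite dimension.\<close>

definition lincomb :: "nat \<Rightarrow> real list \<Rightarrow> (real vec \<Rightarrow> real) list \<Rightarrow> real vec \<Rightarrow> real" where
  "lincomb n cs bs = (\<lambda>x\<in>carrier_vec n. \<Sum>(c, b)\<leftarrow>zip cs bs. c * b x)"

lemma lincomb_Nil: "lincomb n [] [] = (\<lambda>x\<in>carrier_vec n. 0)"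
  by (rule ext) (simp add: lincomb_def restrict_def)

lemma lincomb_Cons:
  "lincomb n (c # cs) (b # bs) = (\<lambda>x\<in>carrier_vec n. c * b x + lincomb n cs bs x)"
  by (rule ext) (simp add: lincomb_def restrict_def)

text \<open>The reals as a record, the domain of the structure homomorphism of a Weil algebra.\<close>

definition real_ring :: "real ring" where
  "real_ring = \<lparr>carrier = UNIV, mult = (*), one = 1, zero = 0, add = (+)\<rparr>"

lemma field_real_ring: "field real_ring"
proof (rule cring.cring_fieldI2)
  show "cring real_ring"
  proof (rule cringI)
    show "abelian_group real_ring"
    proof (rule abelian_groupI)
      fix x assume "x \<in> carrier real_ring"
      show "\<exists>y\<in>carrier real_ring. y \<oplus>\<^bsub>real_ring\<^esub> x = \<zero>\<^bsub>real_ring\<^esub>"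
        by (intro bexI[of _ "- x"]) (simp_all add: real_ring_def)
    qed (simp_all add: real_ring_def)
    show "comm_monoid real_ring"
      by (rule comm_monoidI) (simp_all add: real_ring_def)
  qed (simp_all add: real_ring_def algebra_simps)
  fix a assume "a \<in> carrier real_ring" "a \<noteq> \<zero>\<^bsub>real_ring\<^esub>"
  then show "\<exists>b\<in>carrier real_ring. a \<otimes>\<^bsub>real_ring\<^esub> b = \<one>\<^bsub>real_ring\<^esub>"
    by (intro bexI[of _ "inverse a"]) (simp_all add: real_ring_def)
qed (simp add: real_ring_def)

lemma const_hom: "ring_hom_ring real_ring (Cinf n) (\<lambda>r. \<lambda>x\<in>carrier_vec n. r)"
proof (rule ring_hom_ringI2)
  show "ring real_ring" using field_real_ring by (simp add: field_def domain_def cring_def)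
  show "(\<lambda>r. \<lambda>x\<in>carrier_vec n. r) \<in> Ring.ring_hom real_ring (Cinf n)"
    by (rule ring_hom_memI) (auto simp: real_ring_def Cinf_simps Cinf_const cong: restrict_cong)
qed (rule ring_Cinf)

context
  fixes W :: presentation
  assumes W: "ideal (wideal W) (Cinf (wdim W))"
begin

lemma walg_hom: "ring_hom_ring (Cinf (wdim W)) (walg W) (wclass W)"
  using ideal.rcos_ring_hom_ring[OF W] by (simp add: walg_def wclass_def[abs_def])

lemma cring_walg: "cring (walg W)"
  unfolding walg_def using ideal.quotient_is_cring[OF W cring_Cinf] .

lemma carrier_walg: "carrier (walg W) = wclass W ` carrier (Cinf (wdim W))"
  by (auto simp: walg_def FactRing_def A_RCOSETS_def' wclass_def)

lemma wclass_closed: "h \<in> carrier (Cinf (wdim W)) \<Longrightarrow> wclass W h \<in> carrier (walg W)"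
  by (simp add: carrier_walg)

lemma wclass_add:
  assumes "h \<in> carrier (Cinf (wdim W))" "k \<in> carrier (Cinf (wdim W))"
  shows "wclass W h \<oplus>\<^bsub>walg W\<^esub> wclass W k = wclass W (\<lambda>x\<in>carrier_vec (wdim W). h x + k x)"
  using ring_hom_add[OF ring_hom_ring.homh[OF walg_hom] assms] by (simp add: Cinf_simps)

lemma wclass_mult:
  assumes "h \<in> carrier (Cinf (wdim W))" "k \<in> carrier (Cinf (wdim W))"
  shows "wclass W h \<otimes>\<^bsub>walg W\<^esub> wclass W k = wclass W (\<lambda>x\<in>carrier_vec (wdim W). h x * k x)"
  using ring_hom_mult[OF ring_hom_ring.homh[OF walg_hom] assms] by (simp add: Cinf_simps)

lemma wclass_one: "\<one>\<^bsub>walg W\<^esub> = wclass W (\<lambda>x\<in>carrier_vec (wdim W). 1)"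
  using ring_hom_one[OF ring_hom_ring.homh[OF walg_hom]] by (simp add: Cinf_simps)

lemma wclass_zero: "\<zero>\<^bsub>walg W\<^esub> = wclass W (\<lambda>x\<in>carrier_vec (wdim W). 0)"
  using ring_hom_zero[OF ring_hom_ring.homh[OF walg_hom] ring_Cinf cring.axioms(1)[OF cring_walg]]
  by (simp add: Cinf_simps)

lemma wclass_eq_iff:
  assumes "h \<in> carrier (Cinf (wdim W))" "k \<in> carrier (Cinf (wdim W))"
  shows "wclass W h = wclass W k \<longleftrightarrow> (\<lambda>x\<in>carrier_vec (wdim W). h x - k x) \<in> wideal W"
  unfolding wclass_def
  using ring.quotient_eq_iff_same_a_r_cos[OF ring_Cinf W assms] by (simp add: Cinf_minus[OF assms])

lemma wideal_diff:
  assumes "h \<in> wideal W" "k \<in> wideal W"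
  shows "(\<lambda>x\<in>carrier_vec (wdim W). h x - k x) \<in> wideal W"
    "(\<lambda>x\<in>carrier_vec (wdim W). h x + k x) \<in> wideal W"
proof -
  interpret ideal "wideal W" "Cinf (wdim W)" by (rule W)
  note additive = ideal.axioms(1)[OF W]
  have hk: "h \<in> carrier (Cinf (wdim W))" "k \<in> carrier (Cinf (wdim W))"
    using assms by (auto intro: Icarr)
  show "(\<lambda>x\<in>carrier_vec (wdim W). h x + k x) \<in> wideal W"
    using additive_subgroup.a_closed[OF additive assms] by (simp add: Cinf_simps)
  show "(\<lambda>x\<in>carrier_vec (wdim W). h x - k x) \<in> wideal W"
    using additive_subgroup.a_closed[OF additive assms(1) additive_subgroup.a_inv_closed[OF additive assms(2)]] Cinf_minus[OF hk] by (simp add: a_minus_def)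
qed

lemma wideal_zero: "(\<lambda>x\<in>carrier_vec (wdim W). 0) \<in> wideal W"
  using additive_subgroup.zero_closed[OF ideal.axioms(1)[OF W]] by (simp add: Cinf_simps)

text \<open>The image in the quotient of the ideal of functions vanishing at the origin.\<close>

lemma ideal_wmax: "ideal (wmax W) (walg W)"
proof -
  interpret R: cring "Cinf (wdim W)" by (rule cring_Cinf)
  have 0: "0\<^sub>v (wdim W) \<in> carrier_vec (wdim W)" by simp
  have "ideal {h \<in> carrier (Cinf (wdim W)). h (0\<^sub>v (wdim W)) = 0} (Cinf (wdim W))"
  proof (rule idealI)
    show "subgroup {h \<in> carrier (Cinf (wdim W)). h (0\<^sub>v (wdim W)) = 0} (add_monoid (Cinf (wdim W)))"
    proof (rule R.add.subgroupI)
      fix a assume a: "a \<in> {h \<in> carrier (Cinf (wdim W)). h (0\<^sub>v (wdim W)) = 0}"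
      then have "\<zero>\<^bsub>Cinf (wdim W)\<^esub> \<ominus>\<^bsub>Cinf (wdim W)\<^esub> a = \<ominus>\<^bsub>Cinf (wdim W)\<^esub> a"
        by (simp add: R.minus_eq)
      then show "\<ominus>\<^bsub>Cinf (wdim W)\<^esub> a \<in> {h \<in> carrier (Cinf (wdim W)). h (0\<^sub>v (wdim W)) = 0}"
        using a Cinf_minus[OF R.zero_closed, of a] R.a_inv_closed[of a]
        by (simp add: Cinf_simps)
    qed (use Cinf_const in \<open>auto simp: Cinf_simps Cinf_closed\<close>)
  qed (auto simp: Cinf_simps Cinf_closed ring_Cinf)
  from ring.ring_ideal_imp_quot_ideal[OF ring_Cinf W this]
  show ?thesis by (simp add: wmax_def walg_def wclass_def[abs_def])
qed

lemma wconst_closed: "wconst W r \<in> carrier (walg W)"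
  unfolding wconst_def by (rule wclass_closed[OF Cinf_const])

lemma wconst_hom: "ring_hom_ring real_ring (walg W) (wconst W)"
proof (rule ring_hom_ringI2)
  have "wclass W \<circ> (\<lambda>r. \<lambda>x\<in>carrier_vec (wdim W). r) \<in> Ring.ring_hom real_ring (walg W)"
    by (rule ring_hom_trans[OF ring_hom_ring.homh[OF const_hom] ring_hom_ring.homh[OF walg_hom]])
  then show "wconst W \<in> Ring.ring_hom real_ring (walg W)"
    by (simp add: wconst_def[abs_def] comp_def)
qed (use cring_walg field_real_ring in \<open>simp_all add: field_def domain_def cring_def\<close>)

context
  assumes vanish: "\<forall>h\<in>wideal W. h (0\<^sub>v (wdim W)) = 0"
begin

lemma wclass_mem_wmax_iff:
  assumes h: "h \<in> carrier (Cinf (wdim W))"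
  shows "wclass W h \<in> wmax W \<longleftrightarrow> h (0\<^sub>v (wdim W)) = 0"
proof
  assume "wclass W h \<in> wmax W"
  then obtain k where k: "k \<in> carrier (Cinf (wdim W))" "k (0\<^sub>v (wdim W)) = 0" "wclass W h = wclass W k"
    unfolding wmax_def by auto
  then have "(\<lambda>x\<in>carrier_vec (wdim W). h x - k x) \<in> wideal W"
    using wclass_eq_iff[OF h k(1)] by simp
  from bspec[OF vanish this] k(2) show "h (0\<^sub>v (wdim W)) = 0" by simp
next
  assume "h (0\<^sub>v (wdim W)) = 0"
  then show "wclass W h \<in> wmax W" using h by (auto simp: wmax_def)
qed

text \<open>A function with value \<open>r \<noteq> 0\<close> at the origin differs from the unit \<open>r\<close> by an element of the
  ideal.\<close>

lemma maximalideal_wmax: "maximalideal (wmax W) (walg W)"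
proof (rule maximalidealI[OF ideal_wmax])
  interpret cring "walg W" by (rule cring_walg)
  show "carrier (walg W) \<noteq> wmax W"
    using wclass_mem_wmax_iff[OF Cinf_const, of 1] one_closed by (auto simp: wclass_one)
  fix J assume J: "ideal J (walg W)" "wmax W \<subseteq> J" "J \<subseteq> carrier (walg W)"
  interpret J: ideal J "walg W" by (rule J(1))
  show "J = wmax W \<or> J = carrier (walg W)"
  proof (cases "J \<subseteq> wmax W")
    case False
    then obtain j where "j \<in> J" "j \<notin> wmax W" by blast
    then obtain h where h: "h \<in> carrier (Cinf (wdim W))" "wclass W h \<in> J" "wclass W h \<notin> wmax W"
      using J(3) by (auto simp: carrier_walg)
    define r where "r = h (0\<^sub>v (wdim W))"
    have r: "r \<noteq> 0" using h wclass_mem_wmax_iff[OF h(1)] by (simp add: r_def)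
    define k where "k = (\<lambda>x\<in>carrier_vec (wdim W). r - h x)"
    have k: "k \<in> carrier (Cinf (wdim W))"
      using Cinf_closed(2)[OF Cinf_const h(1), of r] by (simp add: k_def cong: restrict_cong)
    have "wclass W k \<in> J"
      using J(2) wclass_mem_wmax_iff[OF k] by (auto simp: k_def r_def)
    then have "wclass W h \<oplus>\<^bsub>walg W\<^esub> wclass W k \<in> J" using h(2) by (rule J.a_closed[rotated])
    moreover have "wclass W h \<oplus>\<^bsub>walg W\<^esub> wclass W k = wconst W r"
      unfolding wclass_add[OF h(1) k] wconst_def by (simp add: k_def cong: restrict_cong)
    ultimately have "wconst W r \<in> J" by simp
    then have "wconst W (1 / r) \<otimes>\<^bsub>walg W\<^esub> wconst W r \<in> J"
      by (rule J.I_l_closed[OF _ wconst_closed])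
    moreover have "wconst W (1 / r) \<otimes>\<^bsub>walg W\<^esub> wconst W r = \<one>\<^bsub>walg W\<^esub>"
      using r by (simp add: wconst_def wclass_mult[OF Cinf_const Cinf_const] wclass_one cong: restrict_cong)
    ultimately show ?thesis using J.one_imp_carrier by simp
  qed (use J(2) in blast)
qed

lemma subfield_wconst: "subfield (range (wconst W)) (walg W)"
proof -
  have "\<one>\<^bsub>walg W\<^esub> \<noteq> \<zero>\<^bsub>walg W\<^esub>"
  proof
    assume "\<one>\<^bsub>walg W\<^esub> = \<zero>\<^bsub>walg W\<^esub>"
    then have "(\<lambda>x\<in>carrier_vec (wdim W). (\<lambda>x\<in>carrier_vec (wdim W). 1) x - (\<lambda>x\<in>carrier_vec (wdim W). 0) x) \<in> wideal W"
      unfolding wclass_one wclass_zero wclass_eq_iff[OF Cinf_const Cinf_const] .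
    from bspec[OF vanish this] show False by simp
  qed
  from ring_hom_ring.img_is_subfield(2)[OF wconst_hom field.carrier_is_subfield[OF field_real_ring] this]
  show ?thesis by (simp add: real_ring_def)
qed

lemma wclass_combination_in_Span:
  assumes "length cs = length bs" "set bs \<subseteq> carrier (Cinf (wdim W))"
  shows "lincomb (wdim W) cs bs \<in> carrier (Cinf (wdim W)) \<and>
    wclass W (lincomb (wdim W) cs bs)
      \<in> ring.Span (walg W) (range (wconst W)) (map (wclass W) bs)"
  using assms
proof (induction cs bs rule: list_induct2)
  case Nil
  interpret cring "walg W" by (rule cring_walg)
  have "wclass W (\<lambda>x\<in>carrier_vec (wdim W). 0) \<in> Span (range (wconst W)) (map (wclass W) [])"
    by (simp add: wclass_zero)
  then show ?case unfolding lincomb_Nil by (intro conjI Cinf_const)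
next
  case (Cons c cs b bs)
  interpret cring "walg W" by (rule cring_walg)
  let ?s = "lincomb (wdim W) cs bs"
  have s: "?s \<in> carrier (Cinf (wdim W))"
    "wclass W ?s \<in> Span (range (wconst W)) (map (wclass W) bs)"
    using Cons by (simp_all del: Span.simps)
  have b: "b \<in> carrier (Cinf (wdim W))" using Cons.prems by simp
  have eq: "lincomb (wdim W) (c # cs) (b # bs) =
      (\<lambda>x\<in>carrier_vec (wdim W). (\<lambda>x\<in>carrier_vec (wdim W). c * b x) x + ?s x)"
    by (simp add: lincomb_Cons cong: restrict_cong)
  have "wclass W (lincomb (wdim W) (c # cs) (b # bs)) =
      wconst W c \<otimes>\<^bsub>walg W\<^esub> wclass W b \<oplus>\<^bsub>walg W\<^esub> wclass W ?s"
    unfolding eq wclass_add[OF Cinf_closed(4)[OF b b] s(1), symmetric]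
    by (simp add: wconst_def wclass_mult[OF Cinf_const b] cong: restrict_cong)
  then show ?case
    using s Cinf_closed(1)[OF Cinf_closed(4)[OF b b] s(1)] unfolding eq
    by (auto simp: line_extension_mem_iff simp del: restrict_apply)
qed

end

text \<open>A criterion in terms of representing functions, for algebras in which products of three
  elements of the maximal ideal vanish. Nilpotency also yields uniqueness of the maximal ideal:
  a maximal ideal is prime, so it contains every nilpotent element.\<close>

lemma weil_algebraI:
  assumes vanish: "\<forall>h\<in>wideal W. h (0\<^sub>v (wdim W)) = 0"
    and nilpotent: "\<And>a b c. a \<in> carrier (Cinf (wdim W)) \<Longrightarrow> b \<in> carrier (Cinf (wdim W)) \<Longrightarrow>
      c \<in> carrier (Cinf (wdim W)) \<Longrightarrow> a (0\<^sub>v (wdim W)) = 0 \<Longrightarrow> b (0\<^sub>v (wdim W)) = 0 \<Longrightarrow>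
      c (0\<^sub>v (wdim W)) = 0 \<Longrightarrow> (\<lambda>x\<in>carrier_vec (wdim W). a x * (b x * c x)) \<in> wideal W"
    and bs: "set bs \<subseteq> carrier (Cinf (wdim W))"
    and span: "\<And>h. h \<in> carrier (Cinf (wdim W)) \<Longrightarrow> \<exists>cs. length cs = length bs \<and>
      (\<lambda>x\<in>carrier_vec (wdim W). h x - lincomb (wdim W) cs bs x) \<in> wideal W"
  shows "weil_algebra W"
proof -
  interpret cring "walg W" by (rule cring_walg)
  have max_carr: "wmax W \<subseteq> carrier (walg W)" by (auto simp: wmax_def wclass_closed)
  have triple: "u \<otimes>\<^bsub>walg W\<^esub> (v \<otimes>\<^bsub>walg W\<^esub> w) = \<zero>\<^bsub>walg W\<^esub>"
    if uvw: "u \<in> wmax W" "v \<in> wmax W" "w \<in> wmax W" for u v w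
  proof -
    obtain a where a: "a \<in> carrier (Cinf (wdim W))" "a (0\<^sub>v (wdim W)) = 0" "u = wclass W a"
      using uvw(1) by (auto simp: wmax_def)
    obtain b where b: "b \<in> carrier (Cinf (wdim W))" "b (0\<^sub>v (wdim W)) = 0" "v = wclass W b"
      using uvw(2) by (auto simp: wmax_def)
    obtain c where c: "c \<in> carrier (Cinf (wdim W))" "c (0\<^sub>v (wdim W)) = 0" "w = wclass W c"
      using uvw(3) by (auto simp: wmax_def)
    note abc = a(1) b(1) c(1) a(2) b(2) c(2) and eq = a(3) b(3) c(3)
    have "u \<otimes>\<^bsub>walg W\<^esub> (v \<otimes>\<^bsub>walg W\<^esub> w) = wclass W (\<lambda>x\<in>carrier_vec (wdim W). a x * (b x * c x))"
      using wclass_mult[OF abc(1) Cinf_closed(3)[OF abc(2,3)]]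
      by (simp add: eq wclass_mult[OF abc(2,3)] cong: restrict_cong)
    moreover have "(\<lambda>x\<in>carrier_vec (wdim W). a x * (b x * c x)) \<in> carrier (Cinf (wdim W))"
      using Cinf_closed(3)[OF abc(1) Cinf_closed(3)[OF abc(2,3)]] by (simp cong: restrict_cong)
    ultimately show ?thesis
      using nilpotent[OF abc] wclass_eq_iff[OF _ Cinf_const, of "\<lambda>x\<in>carrier_vec (wdim W). a x * (b x * c x)" 0]
      by (simp add: wclass_zero cong: restrict_cong)
  qed
  have "ring.finite_dimension (walg W) (range (wconst W)) (carrier (walg W))"
  proof -
    have sub: "set (map (wclass W) bs) \<subseteq> carrier (walg W)" using bs by (auto intro!: wclass_closed)
    have "carrier (walg W) = Span (range (wconst W)) (map (wclass W) bs)"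
    proof
      show "Span (range (wconst W)) (map (wclass W) bs) \<subseteq> carrier (walg W)"
        by (rule Span_in_carrier[OF _ sub]) (auto simp: wconst_closed)
      show "carrier (walg W) \<subseteq> Span (range (wconst W)) (map (wclass W) bs)"
      proof
        fix u assume "u \<in> carrier (walg W)"
        then obtain h where h: "h \<in> carrier (Cinf (wdim W))" "u = wclass W h" by (auto simp: carrier_walg)
        obtain cs where cs: "length cs = length bs"
          "(\<lambda>x\<in>carrier_vec (wdim W). h x - lincomb (wdim W) cs bs x) \<in> wideal W"
          using span[OF h(1)] by blast
        note comb = wclass_combination_in_Span[OF vanish cs(1) bs]
        have "u = wclass W (lincomb (wdim W) cs bs)"
          unfolding h(2) using cs(2) by (subst wclass_eq_iff[OF h(1) comb[THEN conjunct1]]) (simp_all cong: restrict_cong)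
        then show "u \<in> Span (range (wconst W)) (map (wclass W) bs)" using comb by (simp del: Span.simps)
      qed
    qed
    then show ?thesis using Span_finite_dimension[OF subfield_wconst[OF vanish] sub] by (simp del: Span.simps)
  qed
  moreover have "N = wmax W" if N: "maximalideal N (walg W)" for N
  proof -
    interpret N: primeideal N "walg W" by (rule maximalideal_prime[OF N])
    have "wmax W \<subseteq> N"
    proof
      fix u assume u: "u \<in> wmax W"
      have "u \<otimes>\<^bsub>walg W\<^esub> (u \<otimes>\<^bsub>walg W\<^esub> u) \<in> N" unfolding triple[OF u u u] by (rule N.zero_closed)
      then show "u \<in> N" using N.I_prime u max_carr by (meson m_closed subsetD)
    qed
    then show ?thesis
      using maximalideal.I_maximal[OF maximalideal_wmax[OF vanish] N.is_ideal _ N.a_subset]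
        maximalideal.I_notcarr[OF N] by blast
  qed
  moreover have "ideal_prod (walg W) (wmax W) (ideal_prod (walg W) (wmax W) (wmax W)) = {\<zero>\<^bsub>walg W\<^esub>}"
  proof
    have zero: "\<zero>\<^bsub>walg W\<^esub> \<in> wmax W"
      using additive_subgroup.zero_closed[OF ideal.axioms(1)[OF ideal_wmax]] .
    have "\<zero>\<^bsub>walg W\<^esub> \<otimes>\<^bsub>walg W\<^esub> (\<zero>\<^bsub>walg W\<^esub> \<otimes>\<^bsub>walg W\<^esub> \<zero>\<^bsub>walg W\<^esub>)
        \<in> ideal_prod (walg W) (wmax W) (ideal_prod (walg W) (wmax W) (wmax W))"
      by (intro ideal_prod.prod zero)
    then show "{\<zero>\<^bsub>walg W\<^esub>} \<subseteq> ideal_prod (walg W) (wmax W) (ideal_prod (walg W) (wmax W) (wmax W))" by simp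
    have inner: "j \<in> carrier (walg W) \<and> (\<forall>u\<in>wmax W. u \<otimes>\<^bsub>walg W\<^esub> j = \<zero>\<^bsub>walg W\<^esub>)"
      if "j \<in> ideal_prod (walg W) (wmax W) (wmax W)" for j
      using that
    proof (induction rule: ideal_prod.induct)
      case (prod i j)
      then show ?case using triple max_carr by (auto intro: m_closed)
    next
      case (sum s1 s2)
      then show ?case using max_carr by (auto simp: r_distr)
    qed
    have "u = \<zero>\<^bsub>walg W\<^esub>" if "u \<in> ideal_prod (walg W) (wmax W) (ideal_prod (walg W) (wmax W) (wmax W))" for u
      using that by (induction rule: ideal_prod.induct) (use inner in auto)
    then show "ideal_prod (walg W) (wmax W) (ideal_prod (walg W) (wmax W) (wmax W)) \<subseteq> {\<zero>\<^bsub>walg W\<^esub>}" by blast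
  qed
  then have "(ideal_prod (walg W) (wmax W) ^^ 2) (wmax W) = {\<zero>\<^bsub>walg W\<^esub>}"
    by (simp add: numeral_2_eq_2)
  ultimately show ?thesis
    unfolding weil_algebra_def using W maximalideal_wmax[OF vanish] by blast
qed

end

text \<open>The numeral \<open>1\<close> occurs as a dimension and is kept in this form, which is the one used in \<^const>\<open>W_D\<close>.\<close>

declare One_nat_def [simp del]

section \<open>Morphisms and limits of Weil algebras\<close>

lemma smooth_maps_euclid_point:
  "g \<in> smooth_maps (euclid m) X \<Longrightarrow> x \<in> carrier_vec m \<Longrightarrow> g x \<in> points X"
  by (auto simp: smooth_maps_def)

lemma smooth_map_curve:
  "g \<in> smooth_maps X Y \<Longrightarrow> c \<in> curves X \<Longrightarrow> (\<lambda>t. g (c t)) \<in> curves Y"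
  by (auto simp: smooth_maps_def comp_def)

lemma pullback_closed:
  assumes "h \<in> carrier (Cinf n)" "g \<in> smooth_maps (euclid m) (euclid n)"
  shows "compose (carrier_vec m) h g \<in> carrier (Cinf m)"
  unfolding compose_def
  by (rule restrict_mem_Cinf) (rule Cinf_smooth[OF assms(1) smooth_map_curve[OF assms(2)]])

lemma pullback_hom:
  assumes "g \<in> smooth_maps (euclid m) (euclid n)"
  shows "ring_hom_ring (Cinf n) (Cinf m) (\<lambda>h. compose (carrier_vec m) h g)"
proof (rule ring_hom_ringI2[OF ring_Cinf ring_Cinf], rule ring_hom_memI)
  have g: "g x \<in> carrier_vec n" if "x \<in> carrier_vec m" for x
    using smooth_maps_euclid_point[OF assms that] by simp
  fix h k assume hk: "h \<in> carrier (Cinf n)" "k \<in> carrier (Cinf n)"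
  show "compose (carrier_vec m) h g \<in> carrier (Cinf m)" by (rule pullback_closed[OF hk(1) assms])
  show "compose (carrier_vec m) (h \<otimes>\<^bsub>Cinf n\<^esub> k) g =
      compose (carrier_vec m) h g \<otimes>\<^bsub>Cinf m\<^esub> compose (carrier_vec m) k g"
    using g by (simp add: Cinf_simps compose_def cong: restrict_cong)
  show "compose (carrier_vec m) (h \<oplus>\<^bsub>Cinf n\<^esub> k) g =
      compose (carrier_vec m) h g \<oplus>\<^bsub>Cinf m\<^esub> compose (carrier_vec m) k g"
    using g by (simp add: Cinf_simps compose_def cong: restrict_cong)
next
  have g: "g x \<in> carrier_vec n" if "x \<in> carrier_vec m" for x
    using smooth_maps_euclid_point[OF assms that] by simp
  show "compose (carrier_vec m) \<one>\<^bsub>Cinf n\<^esub> g = \<one>\<^bsub>Cinf m\<^esub>"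
    using g by (simp add: Cinf_simps compose_def cong: restrict_cong)
qed

lemma weil_algebra_ideal: "weil_algebra W \<Longrightarrow> ideal (wideal W) (Cinf (wdim W))"
  by (simp add: weil_algebra_def)

text \<open>Composition with \<open>g\<close> descends to the quotients as soon as it maps the one ideal into the
  other.\<close>

lemma weil_induced_exists:
  assumes W: "ideal (wideal W) (Cinf (wdim W))" and W': "ideal (wideal W') (Cinf (wdim W'))"
    and g: "g \<in> smooth_maps (euclid (wdim W')) (euclid (wdim W))" "g (0\<^sub>v (wdim W')) = 0\<^sub>v (wdim W)"
    and pull: "\<And>h. h \<in> wideal W \<Longrightarrow> compose (carrier_vec (wdim W')) h g \<in> wideal W'"
  shows "\<exists>\<phi>. weil_induced W W' \<phi> g"
proof -
  let ?p = "\<lambda>h. compose (carrier_vec (wdim W')) h g"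
  have gx: "g x \<in> carrier_vec (wdim W)" if "x \<in> carrier_vec (wdim W')" for x
    using smooth_maps_euclid_point[OF g(1) that] by simp
  define \<phi> where "\<phi> = (\<lambda>u\<in>carrier (walg W).
      wclass W' (?p (SOME h. h \<in> carrier (Cinf (wdim W)) \<and> u = wclass W h)))"
  have \<phi>: "\<phi> (wclass W h) = wclass W' (?p h)" if h: "h \<in> carrier (Cinf (wdim W))" for h
  proof -
    define k where "k = (SOME k. k \<in> carrier (Cinf (wdim W)) \<and> wclass W h = wclass W k)"
    have k: "k \<in> carrier (Cinf (wdim W))" "wclass W h = wclass W k"
      using someI[of "\<lambda>k. k \<in> carrier (Cinf (wdim W)) \<and> wclass W h = wclass W k" h] h
      by (simp_all add: k_def)
    have "?p (\<lambda>x\<in>carrier_vec (wdim W). k x - h x) \<in> wideal W'"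
      using k wclass_eq_iff[OF W k(1) h] by (intro pull) simp
    also have "?p (\<lambda>x\<in>carrier_vec (wdim W). k x - h x) =
        (\<lambda>x\<in>carrier_vec (wdim W'). ?p k x - ?p h x)"
      using gx by (simp add: compose_def cong: restrict_cong)
    finally have "wclass W' (?p k) = wclass W' (?p h)"
      by (rule iffD2[OF wclass_eq_iff[OF W' pullback_closed[OF k(1) g(1)] pullback_closed[OF h g(1)]]])
    then show ?thesis using wclass_closed[OF W h] by (simp add: \<phi>_def k_def)
  qed
  have p_hom: "?p \<in> Ring.ring_hom (Cinf (wdim W)) (Cinf (wdim W'))"
    by (rule ring_hom_ring.homh[OF pullback_hom[OF g(1)]])
  have W_hom: "wclass W \<in> Ring.ring_hom (Cinf (wdim W)) (walg W)"
    by (rule ring_hom_ring.homh[OF walg_hom[OF W]])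
  have W'_hom: "wclass W' \<in> Ring.ring_hom (Cinf (wdim W')) (walg W')"
    by (rule ring_hom_ring.homh[OF walg_hom[OF W']])
  interpret R: cring "Cinf (wdim W)" by (rule cring_Cinf)
  have "\<phi> \<in> Ring.ring_hom (walg W) (walg W')"
  proof (rule ring_hom_memI)
    fix u v assume "u \<in> carrier (walg W)" "v \<in> carrier (walg W)"
    then obtain h k where hk: "h \<in> carrier (Cinf (wdim W))" "k \<in> carrier (Cinf (wdim W))"
      "u = wclass W h" "v = wclass W k"
      by (auto simp: carrier_walg[OF W])
    note p = pullback_closed[OF hk(1) g(1)] pullback_closed[OF hk(2) g(1)]
    show "\<phi> u \<in> carrier (walg W')"
      by (simp add: hk \<phi> wclass_closed[OF W'] p)
    show "\<phi> (u \<otimes>\<^bsub>walg W\<^esub> v) = \<phi> u \<otimes>\<^bsub>walg W'\<^esub> \<phi> v"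
      using hk p by (simp add: \<phi> R.m_closed ring_hom_mult[OF p_hom]
          flip: ring_hom_mult[OF W_hom] ring_hom_mult[OF W'_hom])
    show "\<phi> (u \<oplus>\<^bsub>walg W\<^esub> v) = \<phi> u \<oplus>\<^bsub>walg W'\<^esub> \<phi> v"
      using hk p by (simp add: \<phi> R.a_closed ring_hom_add[OF p_hom]
          flip: ring_hom_add[OF W_hom] ring_hom_add[OF W'_hom])
  next
    show "\<phi> \<one>\<^bsub>walg W\<^esub> = \<one>\<^bsub>walg W'\<^esub>"
      by (simp add: \<phi> ring_hom_one[OF p_hom] flip: ring_hom_one[OF W_hom] ring_hom_one[OF W'_hom])
  qed
  moreover have "\<phi> \<in> extensional (carrier (walg W))" by (simp add: \<phi>_def)
  moreover have "\<phi> (wconst W r) = wconst W' r" for r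
    using gx by (simp add: wconst_def \<phi>[OF Cinf_const] compose_def cong: restrict_cong)
  moreover have "\<phi> ` wmax W \<subseteq> wmax W'"
  proof
    fix u assume "u \<in> \<phi> ` wmax W"
    then obtain h where h: "h \<in> carrier (Cinf (wdim W))" "h (0\<^sub>v (wdim W)) = 0" "u = \<phi> (wclass W h)"
      by (auto simp: wmax_def)
    then show "u \<in> wmax W'"
      using pullback_closed[OF h(1) g(1)] g(2) by (auto simp: wmax_def \<phi> compose_def)
  qed
  ultimately show ?thesis
    using g \<phi> unfolding weil_induced_def weil_hom_def
    by (intro exI[of _ \<phi>]) (auto simp: PiE_def Pi_def dest: ring_hom_closed)
qed

lemma weil_hom_closed: "\<phi> \<in> weil_hom W W' \<Longrightarrow> u \<in> carrier (walg W) \<Longrightarrow> \<phi> u \<in> carrier (walg W')"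
  by (auto simp: weil_hom_def)

text \<open>Limits of Weil algebras may be tested on elements: if every compatible family of elements
  comes from a unique element of \<open>L\<close>, then the pointwise lifts form an algebra homomorphism by
  uniqueness. That it respects the maximal ideals uses one vertex, where the residue in the
  reals can be read off; hence the hypothesis that there is a vertex.\<close>

lemma weil_limitI:
  assumes cone: "weil_cone S D \<delta> L p" and S: "finite_shape S" "verts S \<noteq> {}"
    and lift: "\<And>e. (\<And>v. v \<in> verts S \<Longrightarrow> e v \<in> carrier (walg (D v))) \<Longrightarrow>
      (\<And>a. a \<in> arrs S \<Longrightarrow> \<delta> a (e (src S a)) = e (tgt S a)) \<Longrightarrow>
      \<exists>!l. l \<in> carrier (walg L) \<and> (\<forall>v\<in>verts S. p v l = e v)"
    and D: "\<And>v. v \<in> verts S \<Longrightarrow> weil_algebra (D v)"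
    and D_vanish: "\<And>v. v \<in> verts S \<Longrightarrow> \<forall>h\<in>wideal (D v). h (0\<^sub>v (wdim (D v))) = 0"
  shows "weil_limit S D \<delta> L p"
proof -
  have L: "weil_algebra L" and p: "\<And>v. v \<in> verts S \<Longrightarrow> p v \<in> weil_hom L (D v)"
    using cone by (auto simp: weil_cone_def)
  interpret L: cring "walg L" by (rule cring_walg[OF weil_algebra_ideal[OF L]])
  have "\<exists>!u. u \<in> weil_hom W L \<and> (\<forall>v \<in> verts S. compose (carrier (walg W)) (p v) u = q v)"
    if q: "weil_cone S D \<delta> W q" for W q
  proof -
    have W: "weil_algebra W" and qh: "\<And>v. v \<in> verts S \<Longrightarrow> q v \<in> weil_hom W (D v)"
      using q by (auto simp: weil_cone_def)
    interpret W: cring "walg W" by (rule cring_walg[OF weil_algebra_ideal[OF W]])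
    have comm: "\<delta> a (q (src S a) w) = q (tgt S a) w"
      if "a \<in> arrs S" "w \<in> carrier (walg W)" for a w
      using q that unfolding weil_cone_def by (metis compose_eq)
    have ex1: "\<exists>!l. l \<in> carrier (walg L) \<and> (\<forall>v\<in>verts S. p v l = q v w)" if w: "w \<in> carrier (walg W)" for w
      by (rule lift) (use w comm weil_hom_closed[OF qh] in auto)
    define u where "u = (\<lambda>w\<in>carrier (walg W). THE l. l \<in> carrier (walg L) \<and> (\<forall>v\<in>verts S. p v l = q v w))"
    have u: "u w \<in> carrier (walg L)" "\<And>v. v \<in> verts S \<Longrightarrow> p v (u w) = q v w"
      if "w \<in> carrier (walg W)" for w
      using theI'[OF ex1[OF that]] that by (simp_all add: u_def)
    have u_eq: "u w = l" if "w \<in> carrier (walg W)" "l \<in> carrier (walg L)"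
      "\<And>v. v \<in> verts S \<Longrightarrow> p v l = q v w" for w l
      using ex1[OF that(1)] u[OF that(1)] that by blast
    have ph: "p v \<in> Ring.ring_hom (walg L) (walg (D v))" "\<And>r. p v (wconst L r) = wconst (D v) r"
      "p v ` wmax L \<subseteq> wmax (D v)" if "v \<in> verts S" for v
      using p[OF that] by (auto simp: weil_hom_def)
    have qh': "q v \<in> Ring.ring_hom (walg W) (walg (D v))" "\<And>r. q v (wconst W r) = wconst (D v) r"
      "q v ` wmax W \<subseteq> wmax (D v)" if "v \<in> verts S" for v
      using qh[OF that] by (auto simp: weil_hom_def)
    have "u \<in> Ring.ring_hom (walg W) (walg L)"
    proof (rule ring_hom_memI)
      fix a b assume ab: "a \<in> carrier (walg W)" "b \<in> carrier (walg W)"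
      show "u a \<in> carrier (walg L)" by (rule u(1)[OF ab(1)])
      show "u (a \<otimes>\<^bsub>walg W\<^esub> b) = u a \<otimes>\<^bsub>walg L\<^esub> u b"
        using ab u by (intro u_eq) (simp_all add: ring_hom_mult[OF ph(1)] ring_hom_mult[OF qh'(1)])
      show "u (a \<oplus>\<^bsub>walg W\<^esub> b) = u a \<oplus>\<^bsub>walg L\<^esub> u b"
        using ab u by (intro u_eq) (simp_all add: ring_hom_add[OF ph(1)] ring_hom_add[OF qh'(1)])
    next
      show "u \<one>\<^bsub>walg W\<^esub> = \<one>\<^bsub>walg L\<^esub>"
        by (intro u_eq) (simp_all add: ring_hom_one[OF ph(1)] ring_hom_one[OF qh'(1)])
    qed
    moreover have "u (wconst W r) = wconst L r" for r
      by (intro u_eq) (simp_all add: wconst_closed[OF weil_algebra_ideal] W L ph(2) qh'(2))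
    moreover have "u ` wmax W \<subseteq> wmax L"
    proof
      fix l assume "l \<in> u ` wmax W"
      then obtain w where w: "w \<in> wmax W" "l = u w" by blast
      have wc: "w \<in> carrier (walg W)"
        using w(1) by (auto simp: wmax_def intro: wclass_closed[OF weil_algebra_ideal[OF W]])
      obtain h where h: "h \<in> carrier (Cinf (wdim L))" "l = wclass L h"
        using u(1)[OF wc] w(2) by (auto simp: carrier_walg[OF weil_algebra_ideal[OF L]])
      define r where "r = h (0\<^sub>v (wdim L))"
      define k where "k = (\<lambda>x\<in>carrier_vec (wdim L). h x - r)"
      have k: "k \<in> carrier (Cinf (wdim L))"
        using Cinf_closed(2)[OF h(1) Cinf_const, of r] by (simp add: k_def cong: restrict_cong)
      have km: "wclass L k \<in> wmax L" using k by (auto simp: wmax_def k_def r_def)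
      have l: "l = wconst L r \<oplus>\<^bsub>walg L\<^esub> wclass L k"
        unfolding wconst_def wclass_add[OF weil_algebra_ideal[OF L] Cinf_const k] h(2)
        using Cinf_ext[OF h(1)] by (simp add: k_def cong: restrict_cong)
      obtain v where v: "v \<in> verts S" using S(2) by blast
      note Dv = weil_algebra_ideal[OF D[OF v]]
      have "p v (wclass L k) \<in> wmax (D v)" using ph(3)[OF v] km by blast
      then obtain m where m: "m \<in> carrier (Cinf (wdim (D v)))" "m (0\<^sub>v (wdim (D v))) = 0" "p v (wclass L k) = wclass (D v) m"
        by (auto simp: wmax_def)
      have "p v l = wconst (D v) r \<oplus>\<^bsub>walg (D v)\<^esub> wclass (D v) m"
        unfolding l using ring_hom_add[OF ph(1)[OF v] wconst_closed[OF weil_algebra_ideal[OF L]]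
            wclass_closed[OF weil_algebra_ideal[OF L] k], of r] by (simp add: m(3) ph(2)[OF v])
      also have "\<dots> = wclass (D v) (\<lambda>x\<in>carrier_vec (wdim (D v)). r + m x)"
        unfolding wconst_def wclass_add[OF Dv Cinf_const m(1)] by (simp cong: restrict_cong)
      finally have in_max: "wclass (D v) (\<lambda>x\<in>carrier_vec (wdim (D v)). r + m x) \<in> wmax (D v)"
        using u(2)[OF wc v] w qh'(3)[OF v] by auto
      have "(\<lambda>x\<in>carrier_vec (wdim (D v)). r + m x) \<in> carrier (Cinf (wdim (D v)))"
        using Cinf_closed(1)[OF Cinf_const m(1), of r] by (simp cong: restrict_cong)
      from iffD1[OF wclass_mem_wmax_iff[OF Dv D_vanish[OF v] this] in_max]
      have "r + m (0\<^sub>v (wdim (D v))) = 0" by simp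
      then show "l \<in> wmax L" using h m(2) by (auto simp: wmax_def r_def)
    qed
    ultimately have u_hom: "u \<in> weil_hom W L"
      using u(1) by (auto simp: weil_hom_def u_def)
    show ?thesis
    proof (rule ex1I[of _ u])
      show "u \<in> weil_hom W L \<and> (\<forall>v \<in> verts S. compose (carrier (walg W)) (p v) u = q v)"
      proof (intro conjI ballI u_hom)
        fix v assume v: "v \<in> verts S"
        have "q v \<in> extensional (carrier (walg W))" using qh[OF v] by (auto simp: weil_hom_def PiE_def)
        then show "compose (carrier (walg W)) (p v) u = q v"
          using u(2)[OF _ v] by (intro extensionalityI[of _ "carrier (walg W)"]) (auto simp: compose_eq)
      qed
      fix u' assume u': "u' \<in> weil_hom W L \<and> (\<forall>v \<in> verts S. compose (carrier (walg W)) (p v) u' = q v)"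
      show "u' = u"
      proof (rule extensionalityI[of _ "carrier (walg W)"])
        fix w assume w: "w \<in> carrier (walg W)"
        have "p v (u' w) = q v w" if "v \<in> verts S" for v
          using u' that w by (metis compose_eq)
        then show "u' w = u w" using u_eq[OF w weil_hom_closed[OF conjunct1[OF u'] w]] by simp
      qed (use u' in \<open>auto simp: weil_hom_def PiE_def u_def\<close>)
    qed
  qed
  then show ?thesis using cone unfolding weil_limit_def by blast
qed

section \<open>Functions on the line and on the plane\<close>

definition vec1 :: "real \<Rightarrow> real vec" where "vec1 t = vec_of_list [t]"
definition vec2 :: "real \<Rightarrow> real \<Rightarrow> real vec" where "vec2 s t = vec_of_list [s, t]"

lemma vec1_simps [simp]: "dim_vec (vec1 t) = 1" "vec1 t \<in> carrier_vec 1" "vec1 t $ 0 = t"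
  unfolding vec1_def One_nat_def by (auto intro: carrier_vecI)

lemma vec2_simps [simp]: "dim_vec (vec2 s t) = 2" "vec2 s t \<in> carrier_vec 2"
  "vec2 s t $ 0 = s" "vec2 s t $ 1 = t" "vec2 s t $ Suc 0 = t"
  unfolding vec2_def One_nat_def by (auto intro: carrier_vecI)

lemma carrier_vec_1: "x \<in> carrier_vec 1 \<Longrightarrow> x = vec1 (x $ 0)"
  by (rule eq_vecI) (simp_all add: less_one)

lemma carrier_vec_2: "x \<in> carrier_vec 2 \<Longrightarrow> x = vec2 (x $ 0) (x $ 1)"
  by (rule eq_vecI) (auto simp: less_2_cases_iff One_nat_def)

lemma zero_vec_eq [simp]: "0\<^sub>v 1 = vec1 0" "0\<^sub>v 2 = vec2 0 0"
  using carrier_vec_1[of "0\<^sub>v 1"] carrier_vec_2[of "0\<^sub>v 2"] by simp_all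

lemma curves_euclid_1: "c \<in> curves (euclid 1) \<longleftrightarrow> (\<exists>a. smooth_real a \<and> c = (\<lambda>t. vec1 (a t)))"
proof
  assume "c \<in> curves (euclid 1)"
  then have "smooth_real (\<lambda>t. c t $ 0)" "c = (\<lambda>t. vec1 (c t $ 0))"
    using carrier_vec_1 by (auto simp: curves_euclid)
  then show "\<exists>a. smooth_real a \<and> c = (\<lambda>t. vec1 (a t))" by blast
qed (auto simp: curves_euclid)

lemma curves_euclid_2:
  "c \<in> curves (euclid 2) \<longleftrightarrow> (\<exists>a b. smooth_real a \<and> smooth_real b \<and> c = (\<lambda>t. vec2 (a t) (b t)))"
proof
  assume "c \<in> curves (euclid 2)"
  then have "smooth_real (\<lambda>t. c t $ 0)" "smooth_real (\<lambda>t. c t $ 1)" "c = (\<lambda>t. vec2 (c t $ 0) (c t $ 1))"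
    using carrier_vec_2 by (auto simp: curves_euclid)
  then show "\<exists>a b. smooth_real a \<and> smooth_real b \<and> c = (\<lambda>t. vec2 (a t) (b t))" by blast
qed (auto simp: curves_euclid less_2_cases_iff)

text \<open>Functions of real arguments as functions on vectors; this translates between the curve
  calculus above and the function algebras in one and two variables.\<close>

definition fn1 :: "(real \<Rightarrow> 'b) \<Rightarrow> real vec \<Rightarrow> 'b" where
  "fn1 F = (\<lambda>x\<in>carrier_vec 1. F (x $ 0))"

definition fn2 :: "(real \<Rightarrow> real \<Rightarrow> 'b) \<Rightarrow> real vec \<Rightarrow> 'b" where
  "fn2 F = (\<lambda>x\<in>carrier_vec 2. F (x $ 0) (x $ 1))"

lemma fn1_vec1 [simp]: "fn1 F (vec1 t) = F t"
  by (simp add: fn1_def)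

lemma fn2_vec2 [simp]: "fn2 F (vec2 s t) = F s t"
  by (simp add: fn2_def)

lemma fn1_smooth_iff: "fn1 F \<in> smooth_maps (euclid 1) X \<longleftrightarrow>
    (\<forall>t. F t \<in> points X) \<and> (\<forall>a. smooth_real a \<longrightarrow> (\<lambda>t. F (a t)) \<in> curves X)"
proof -
  have "(\<forall>x\<in>carrier_vec 1. F (x $ 0) \<in> points X) \<longleftrightarrow> (\<forall>t. F t \<in> points X)"
    using vec1_simps(2,3) by metis
  moreover have "fn1 F \<in> extensional (carrier_vec 1)" by (simp add: fn1_def)
  moreover have "fn1 F x = F (x $ 0)" if "x \<in> carrier_vec 1" for x using that by (simp add: fn1_def)
  moreover have "(\<forall>c\<in>curves (euclid 1). fn1 F \<circ> c \<in> curves X) \<longleftrightarrow>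
      (\<forall>a. smooth_real a \<longrightarrow> (\<lambda>t. F (a t)) \<in> curves X)"
  proof
    assume *: "\<forall>c\<in>curves (euclid 1). fn1 F \<circ> c \<in> curves X"
    show "\<forall>a. smooth_real a \<longrightarrow> (\<lambda>t. F (a t)) \<in> curves X"
    proof (intro allI impI)
      fix a assume "smooth_real a"
      then have "(\<lambda>t. vec1 (a t)) \<in> curves (euclid 1)" by (auto simp: curves_euclid_1)
      from bspec[OF * this] show "(\<lambda>t. F (a t)) \<in> curves X" by (simp add: comp_def)
    qed
  qed (auto simp: curves_euclid_1 comp_def)
  ultimately show ?thesis
    unfolding smooth_maps_def PiE_def Pi_def by (simp add: Ball_def)
qed

lemma fn2_smooth_iff: "fn2 F \<in> smooth_maps (euclid 2) X \<longleftrightarrow>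
    (\<forall>s t. F s t \<in> points X) \<and>
    (\<forall>a b. smooth_real a \<longrightarrow> smooth_real b \<longrightarrow> (\<lambda>t. F (a t) (b t)) \<in> curves X)"
proof -
  have "(\<forall>x\<in>carrier_vec 2. F (x $ 0) (x $ 1) \<in> points X) \<longleftrightarrow> (\<forall>s t. F s t \<in> points X)"
    using vec2_simps(2,3,4) by metis
  moreover have "fn2 F \<in> extensional (carrier_vec 2)" by (simp add: fn2_def)
  moreover have "fn2 F x = F (x $ 0) (x $ 1)" if "x \<in> carrier_vec 2" for x using that by (simp add: fn2_def)
  moreover have "(\<forall>c\<in>curves (euclid 2). fn2 F \<circ> c \<in> curves X) \<longleftrightarrow>
      (\<forall>a b. smooth_real a \<longrightarrow> smooth_real b \<longrightarrow> (\<lambda>t. F (a t) (b t)) \<in> curves X)"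
  proof
    assume *: "\<forall>c\<in>curves (euclid 2). fn2 F \<circ> c \<in> curves X"
    show "\<forall>a b. smooth_real a \<longrightarrow> smooth_real b \<longrightarrow> (\<lambda>t. F (a t) (b t)) \<in> curves X"
    proof (intro allI impI)
      fix a b assume "smooth_real a" "smooth_real b"
      then have "(\<lambda>t. vec2 (a t) (b t)) \<in> curves (euclid 2)" by (auto simp: curves_euclid_2)
      from bspec[OF * this] show "(\<lambda>t. F (a t) (b t)) \<in> curves X" by (simp add: comp_def)
    qed
  qed (auto simp: curves_euclid_2 comp_def)
  ultimately show ?thesis
    unfolding smooth_maps_def PiE_def Pi_def by (simp add: Ball_def)
qed

lemma fn1_surj: "f \<in> extensional (carrier_vec 1) \<Longrightarrow> f = fn1 (\<lambda>t. f (vec1 t))"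
  by (rule extensionalityI[of _ "carrier_vec 1"]) (auto simp: fn1_def simp flip: carrier_vec_1)

lemma fn2_surj: "f \<in> extensional (carrier_vec 2) \<Longrightarrow> f = fn2 (\<lambda>s t. f (vec2 s t))"
  by (rule extensionalityI[of _ "carrier_vec 2"]) (auto simp: fn2_def simp flip: carrier_vec_2)

lemma fn1_Cinf: "fn1 H \<in> carrier (Cinf 1) \<longleftrightarrow> smooth_real H"
proof -
  have "fn1 H \<in> carrier (Cinf 1) \<longleftrightarrow> (\<forall>a. smooth_real a \<longrightarrow> smooth_real (\<lambda>t. H (a t)))"
    using fn1_smooth_iff[of H real_line] by (simp add: Cinf_def real_line_def)
  moreover have "(\<forall>a. smooth_real a \<longrightarrow> smooth_real (\<lambda>t. H (a t))) \<longleftrightarrow> smooth_real H"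
  proof
    assume "\<forall>a. smooth_real a \<longrightarrow> smooth_real (\<lambda>t. H (a t))"
    from this[rule_format, OF smooth_real_ident] show "smooth_real H" by simp
  qed (simp add: smooth_real_compose)
  ultimately show ?thesis by (rule trans)
qed

lemma fn2_Cinf: "fn2 H \<in> carrier (Cinf 2) \<longleftrightarrow> smooth2 H"
  using fn2_smooth_iff[of H real_line] by (simp add: Cinf_def real_line_def smooth2_def)

lemma Cinf_1E:
  assumes "h \<in> carrier (Cinf 1)"
  obtains H where "h = fn1 H" "smooth_real H"
proof (rule that)
  show eq: "h = fn1 (\<lambda>t. h (vec1 t))" using assms by (intro fn1_surj) (simp add: mem_Cinf_iff)
  show "smooth_real (\<lambda>t. h (vec1 t))" using assms by (simp flip: fn1_Cinf eq)
qed

lemma Cinf_2E: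
  assumes "h \<in> carrier (Cinf 2)"
  obtains H where "h = fn2 H" "smooth2 H"
proof (rule that)
  show eq: "h = fn2 (\<lambda>s t. h (vec2 s t))" using assms by (intro fn2_surj) (simp add: mem_Cinf_iff)
  show "smooth2 (\<lambda>s t. h (vec2 s t))" using assms by (simp flip: fn2_Cinf eq)
qed

lemma fn1_ops:
  "(\<lambda>x\<in>carrier_vec 1. fn1 F x - fn1 G x) = fn1 (\<lambda>t. F t - G t)"
  "(\<lambda>x\<in>carrier_vec 1. fn1 F x + fn1 G x) = fn1 (\<lambda>t. F t + G t)"
  "(\<lambda>x\<in>carrier_vec 1. fn1 F x * fn1 G x) = fn1 (\<lambda>t. F t * G t)"
  "(\<lambda>x\<in>carrier_vec 1. r) = fn1 (\<lambda>t. r)"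
  for F G :: "real \<Rightarrow> real"
  by (auto simp: fn1_def fun_eq_iff)

lemma fn2_ops:
  "(\<lambda>x\<in>carrier_vec 2. fn2 F x - fn2 G x) = fn2 (\<lambda>s t. F s t - G s t)"
  "(\<lambda>x\<in>carrier_vec 2. fn2 F x + fn2 G x) = fn2 (\<lambda>s t. F s t + G s t)"
  "(\<lambda>x\<in>carrier_vec 2. fn2 F x * fn2 G x) = fn2 (\<lambda>s t. F s t * G s t)"
  "(\<lambda>x\<in>carrier_vec 2. r) = fn2 (\<lambda>s t. r)"
  for F G :: "real \<Rightarrow> real \<Rightarrow> real"
  by (auto simp: fn2_def fun_eq_iff)

lemma compose_fn:
  "compose (carrier_vec 1) h (fn1 F) = fn1 (\<lambda>t. h (F t))"
  "compose (carrier_vec 2) h (fn2 G) = fn2 (\<lambda>s t. h (G s t))"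
  by (auto simp: fn1_def fn2_def compose_def fun_eq_iff)

lemma smooth_to_line:
  "smooth_real a \<Longrightarrow> fn1 (\<lambda>t. vec1 (a t)) \<in> smooth_maps (euclid 1) (euclid 1)"
  "smooth2 A \<Longrightarrow> fn2 (\<lambda>s t. vec1 (A s t)) \<in> smooth_maps (euclid 2) (euclid 1)"
  by (simp_all add: fn1_smooth_iff fn2_smooth_iff curves_euclid smooth_real_compose smooth2D less_one)

lemma smooth_to_plane:
  "smooth_real a \<Longrightarrow> smooth_real b \<Longrightarrow> fn1 (\<lambda>t. vec2 (a t) (b t)) \<in> smooth_maps (euclid 1) (euclid 2)"
  "smooth2 A \<Longrightarrow> smooth2 B \<Longrightarrow> fn2 (\<lambda>s t. vec2 (A s t) (B s t)) \<in> smooth_maps (euclid 2) (euclid 2)"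
  by (auto simp: fn1_smooth_iff fn2_smooth_iff curves_euclid smooth_real_compose smooth2D less_2_cases_iff)

section \<open>Taylor normal forms\<close>

text \<open>Hadamard's lemma applied twice, to functions of the first variable only.\<close>

lemma smooth_real_Taylor:
  assumes H: "smooth_real H"
  obtains K where "smooth_real K" "\<And>t. H t = H 0 + t * deriv H 0 + t\<^sup>2 * K t"
proof -
  have lin: "\<exists>A. smooth_real A \<and> (\<forall>t. F t = F 0 + t * A t)" if F: "smooth_real F" for F
  proof -
    obtain A where A: "smooth2 A" "\<And>x y. F x = F 0 + x * A x y"
      by (rule hadamard_quotient[OF smooth2_real[OF F smooth2_intros(1)]], rule that)
    then show ?thesis by (intro exI[of _ "\<lambda>t. A t 0"] conjI allI smooth2_fix(1)[OF A(1)])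
  qed
  obtain A where A: "smooth_real A" "\<forall>t. H t = H 0 + t * A t" using lin[OF H] by (elim exE conjE)
  obtain K where K: "smooth_real K" "\<forall>t. A t = A 0 + t * K t" using lin[OF A(1)] by (elim exE conjE)
  have "((\<lambda>t. H 0 + t * A t) has_real_derivative 0 + (1 * A 0 + deriv A 0 * 0)) (at 0)"
    by (intro DERIV_add DERIV_const DERIV_mult DERIV_ident smooth_real_has_derivative A(1))
  then have "((\<lambda>t. H 0 + t * A t) has_real_derivative A 0) (at 0)" by simp
  moreover have "H = (\<lambda>t. H 0 + t * A t)" by (rule ext) (rule spec[OF A(2)])
  ultimately have "(H has_real_derivative A 0) (at 0)" by (simp only:)
  then have d: "deriv H 0 = A 0" by (rule DERIV_imp_deriv)
  have "H t = H 0 + t * A 0 + t\<^sup>2 * K t" for t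
  proof -
    have "H t = H 0 + t * (A 0 + t * K t)" by (simp only: spec[OF A(2), of t] spec[OF K(2), of t])
    then show ?thesis by (simp add: power2_eq_square algebra_simps)
  qed
  then show thesis unfolding d[symmetric] by (rule that[OF K(1)])
qed

lemma smooth2_Taylor1:
  assumes H: "smooth2 H"
  obtains A B where "smooth2 A" "smooth2 B" "\<And>x y. H x y = H 0 0 + x * A x y + y * B x y"
proof -
  obtain A where A: "smooth2 A" "\<And>x y. H x y = H 0 y + x * A x y"
    by (rule hadamard_quotient[OF H], rule that)
  obtain B where B: "smooth2 B" "\<And>y x. H 0 y = H 0 0 + y * B y x"
    by (rule hadamard_quotient[OF smooth2_real[OF smooth2_fix(2)[OF H] smooth2_intros(1)], of 0], rule that)
  show thesis
  proof (rule that[OF A(1) smooth2_swap[OF B(1)]])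
    show "H x y = H 0 0 + x * A x y + y * B y x" for x y
      using A(2)[of x y] B(2)[of y x] by linarith
  qed
qed

text \<open>Hadamard's lemma applied to \<open>H\<close>, to its two quotients and to the coefficient of \<open>x * y\<close>:
  modulo the squares of the coordinates only the monomials \<open>1\<close>, \<open>x\<close>, \<open>y\<close> and \<open>x * y\<close> remain.\<close>

lemma smooth2_Taylor2:
  assumes H: "smooth2 H"
  obtains b c d A B where "smooth2 A" "smooth2 B"
    "\<And>x y. H x y = H 0 0 + b * x + c * y + d * (x * y) + x\<^sup>2 * A x y + y\<^sup>2 * B x y"
proof -
  obtain P Q where PQ: "smooth2 P" "smooth2 Q" "\<And>x y. H x y = H 0 0 + x * P x y + y * Q x y"
    by (rule smooth2_Taylor1[OF H], rule that)
  obtain P1 P2 where P: "smooth2 P1" "smooth2 P2" "\<And>x y. P x y = P 0 0 + x * P1 x y + y * P2 x y"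
    by (rule smooth2_Taylor1[OF PQ(1)], rule that)
  obtain Q1 Q2 where Q: "smooth2 Q1" "smooth2 Q2" "\<And>x y. Q x y = Q 0 0 + x * Q1 x y + y * Q2 x y"
    by (rule smooth2_Taylor1[OF PQ(2)], rule that)
  define R where "R x y = P2 x y + Q1 x y" for x y
  have "smooth2 R" unfolding R_def by (intro smooth2_intros(4) P Q)
  obtain R1 R2 where R: "smooth2 R1" "smooth2 R2" "\<And>x y. R x y = R 0 0 + x * R1 x y + y * R2 x y"
    by (rule smooth2_Taylor1[OF \<open>smooth2 R\<close>], rule that)
  show thesis
  proof (rule that)
    show "smooth2 (\<lambda>x y. P1 x y + y * R1 x y)" "smooth2 (\<lambda>x y. Q2 x y + x * R2 x y)"
      by (intro smooth2_intros(4,6) smooth2_intros(1,2) P Q R)+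
    fix x y
    have "H x y = H 0 0 + x * (P 0 0 + x * P1 x y + y * P2 x y) + y * (Q 0 0 + x * Q1 x y + y * Q2 x y)"
      using PQ(3)[of x y] P(3)[of x y] Q(3)[of x y] by simp
    also have "\<dots> = H 0 0 + P 0 0 * x + Q 0 0 * y + (x * y) * R x y + x\<^sup>2 * P1 x y + y\<^sup>2 * Q2 x y"
      by (simp add: R_def power2_eq_square algebra_simps)
    also have "(x * y) * R x y = R 0 0 * (x * y) + x\<^sup>2 * (y * R1 x y) + y\<^sup>2 * (x * R2 x y)"
      by (subst R(3)) (simp add: power2_eq_square algebra_simps)
    finally show "H x y = H 0 0 + P 0 0 * x + Q 0 0 * y + R 0 0 * (x * y) +
        x\<^sup>2 * (P1 x y + y * R1 x y) + y\<^sup>2 * (Q2 x y + x * R2 x y)"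
      by (simp add: algebra_simps)
  qed
qed

section \<open>The algebras of dual numbers\<close>

abbreviation W_DD :: presentation where "W_DD \<equiv> weil_tensor W_D W_D"

lemma wdim_simps [simp]: "wdim W_D = 1" "wdim W_D2 = 2" "wdim W_DD = 2"
  by (simp_all add: W_D_def W_D2_def weil_tensor_def Let_def)

text \<open>The normal form of the elements of the ideal generated by three functions. Both \<open>W_D2\<close> and
  \<open>W_DD\<close> are quotients by such an ideal, with third generator \<open>x * y\<close> and \<open>0\<close>.\<close>

definition genideal3 :: "(real \<Rightarrow> real \<Rightarrow> real) \<Rightarrow> (real \<Rightarrow> real \<Rightarrow> real) \<Rightarrow> (real \<Rightarrow> real \<Rightarrow> real) \<Rightarrow>
    (real vec \<Rightarrow> real) set" where
  "genideal3 p q r = {fn2 (\<lambda>x y. p x y * A x y + q x y * B x y + r x y * C x y) |A B C.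
     smooth2 A \<and> smooth2 B \<and> smooth2 C}"

lemma genideal3I:
  assumes "smooth2 A" "smooth2 B" "smooth2 C" "\<And>x y. H x y = p x y * A x y + q x y * B x y + r x y * C x y"
  shows "fn2 H \<in> genideal3 p q r"
proof -
  have "H = (\<lambda>x y. p x y * A x y + q x y * B x y + r x y * C x y)" using assms(4) by (intro ext)
  then show ?thesis using assms(1-3) by (auto simp: genideal3_def)
qed

lemma genideal3E:
  assumes "fn2 H \<in> genideal3 p q r"
  obtains A B C where "smooth2 A" "smooth2 B" "smooth2 C"
    "\<And>x y. H x y = p x y * A x y + q x y * B x y + r x y * C x y"
proof -
  obtain A B C where ABC: "smooth2 A" "smooth2 B" "smooth2 C"
    and eq: "fn2 H = fn2 (\<lambda>x y. p x y * A x y + q x y * B x y + r x y * C x y)"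
    using assms by (auto simp: genideal3_def)
  have "H x y = p x y * A x y + q x y * B x y + r x y * C x y" for x y
    using arg_cong[OF eq, of "\<lambda>f. f (vec2 x y)"] by simp
  then show thesis by (rule that[OF ABC])
qed

lemma genideal3_subset: "smooth2 p \<Longrightarrow> smooth2 q \<Longrightarrow> smooth2 r \<Longrightarrow> genideal3 p q r \<subseteq> carrier (Cinf 2)"
  by (auto simp: genideal3_def fn2_Cinf intro!: smooth2_intros(4,6))

lemma ideal_genideal3:
  assumes pqr: "smooth2 p" "smooth2 q" "smooth2 r"
  shows "ideal (genideal3 p q r) (Cinf 2)"
proof -
  interpret R: cring "Cinf 2" by (rule cring_Cinf)
  note sub = genideal3_subset[OF pqr]
  have mult: "x \<otimes>\<^bsub>Cinf 2\<^esub> a \<in> genideal3 p q r" if a: "a \<in> genideal3 p q r" and x: "x \<in> carrier (Cinf 2)" for a x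
  proof -
    obtain H where H: "a = fn2 H" by (rule Cinf_2E[OF subsetD[OF sub a]], rule that)
    obtain K where K: "x = fn2 K" "smooth2 K" by (rule Cinf_2E[OF x], rule that)
    obtain A B C where ABC: "smooth2 A" "smooth2 B" "smooth2 C"
      "\<And>x y. H x y = p x y * A x y + q x y * B x y + r x y * C x y"
      by (rule genideal3E[OF a[unfolded H]], rule that)
    have "fn2 (\<lambda>x y. K x y * H x y) \<in> genideal3 p q r"
      by (rule genideal3I[OF smooth2_intros(6)[OF K(2) ABC(1)] smooth2_intros(6)[OF K(2) ABC(2)]
            smooth2_intros(6)[OF K(2) ABC(3)]]) (simp add: ABC(4) algebra_simps)
    then show ?thesis by (simp add: H K Cinf_simps fn2_ops)
  qed
  show ?thesis
  proof (rule idealI)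
    show "subgroup (genideal3 p q r) (add_monoid (Cinf 2))"
    proof (rule R.add.subgroupI)
      show "genideal3 p q r \<noteq> {}"
        using genideal3I[OF smooth2_intros(3)[of 0] smooth2_intros(3)[of 0] smooth2_intros(3)[of 0] refl, of p q r] by blast
      fix a assume a: "a \<in> genideal3 p q r"
      have "\<ominus>\<^bsub>Cinf 2\<^esub> a = (\<ominus>\<^bsub>Cinf 2\<^esub> \<one>\<^bsub>Cinf 2\<^esub>) \<otimes>\<^bsub>Cinf 2\<^esub> a"
        using a sub by (simp add: R.l_minus subsetD)
      then show "\<ominus>\<^bsub>Cinf 2\<^esub> a \<in> genideal3 p q r" using mult[OF a] by simp
      fix b assume b: "b \<in> genideal3 p q r"
      obtain H where H: "a = fn2 H" by (rule Cinf_2E[OF subsetD[OF sub a]], rule that)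
      obtain K where K: "b = fn2 K" by (rule Cinf_2E[OF subsetD[OF sub b]], rule that)
      obtain A B C where ABC: "smooth2 A" "smooth2 B" "smooth2 C"
        "\<And>x y. H x y = p x y * A x y + q x y * B x y + r x y * C x y"
        by (rule genideal3E[OF a[unfolded H]], rule that)
      obtain A' B' C' where ABC': "smooth2 A'" "smooth2 B'" "smooth2 C'"
        "\<And>x y. K x y = p x y * A' x y + q x y * B' x y + r x y * C' x y"
        by (rule genideal3E[OF b[unfolded K]], rule that)
      have "fn2 (\<lambda>x y. H x y + K x y) \<in> genideal3 p q r"
        by (rule genideal3I[OF smooth2_intros(4)[OF ABC(1) ABC'(1)] smooth2_intros(4)[OF ABC(2) ABC'(2)]
              smooth2_intros(4)[OF ABC(3) ABC'(3)]]) (simp add: ABC(4) ABC'(4) algebra_simps)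
      then show "a \<oplus>\<^bsub>Cinf 2\<^esub> b \<in> genideal3 p q r" by (simp add: H K Cinf_simps fn2_ops)
    qed (use sub in simp)
  next
    fix a x assume ax: "a \<in> genideal3 p q r" "x \<in> carrier (Cinf 2)"
    show "x \<otimes>\<^bsub>Cinf 2\<^esub> a \<in> genideal3 p q r" by (rule mult[OF ax])
    then show "a \<otimes>\<^bsub>Cinf 2\<^esub> x \<in> genideal3 p q r" using ax sub by (simp add: R.m_comm subsetD)
  qed (rule ring_Cinf)
qed

lemma genideal3_generators:
  "fn2 p \<in> genideal3 p q r" "fn2 q \<in> genideal3 p q r" "fn2 r \<in> genideal3 p q r"
  by (rule genideal3I[OF smooth2_intros(3)[of 1] smooth2_intros(3)[of 0] smooth2_intros(3)[of 0]], simp)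
    (rule genideal3I[OF smooth2_intros(3)[of 0] smooth2_intros(3)[of 1] smooth2_intros(3)[of 0]], simp,
     rule genideal3I[OF smooth2_intros(3)[of 0] smooth2_intros(3)[of 0] smooth2_intros(3)[of 1]], simp)

lemma genideal3_minimal:
  assumes I: "ideal I (Cinf 2)" and "fn2 p \<in> I" "fn2 q \<in> I" "fn2 r \<in> I"
  shows "genideal3 p q r \<subseteq> I"
proof
  fix h assume "h \<in> genideal3 p q r"
  then obtain A B C where ABC: "smooth2 A" "smooth2 B" "smooth2 C"
    and h: "h = fn2 (\<lambda>x y. p x y * A x y + q x y * B x y + r x y * C x y)"
    by (auto simp: genideal3_def)
  have mult: "fn2 (\<lambda>x y. s x y * S x y) \<in> I" if "fn2 s \<in> I" "smooth2 S" for s S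
    using ideal.I_r_closed[OF I that(1), of "fn2 S"] that(2) by (simp add: fn2_Cinf Cinf_simps fn2_ops)
  have add: "fn2 (\<lambda>x y. s x y + S x y) \<in> I" if "fn2 s \<in> I" "fn2 S \<in> I" for s S
    using additive_subgroup.a_closed[OF ideal.axioms(1)[OF I] that] by (simp add: Cinf_simps fn2_ops)
  show "h \<in> I" unfolding h by (intro add mult assms ABC)
qed

lemma wideal_W_D: "wideal W_D = {fn1 (\<lambda>t. t\<^sup>2 * K t) |K. smooth_real K}"
proof -
  interpret R: cring "Cinf 1" by (rule cring_Cinf)
  have sq: "fn1 (\<lambda>t. t\<^sup>2) \<in> carrier (Cinf 1)"
    by (simp add: fn1_Cinf power2_eq_square smooth_real_mult smooth_real_ident)
  have "wideal W_D = Idl\<^bsub>Cinf 1\<^esub> {fn1 (\<lambda>t. t\<^sup>2)}" by (simp add: W_D_def fn1_def)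
  also have "\<dots> = PIdl\<^bsub>Cinf 1\<^esub> (fn1 (\<lambda>t. t\<^sup>2))" by (simp only: R.cgenideal_eq_genideal[OF sq])
  also have "\<dots> = {fn1 (\<lambda>t. t\<^sup>2 * K t) |K. smooth_real K}" (is "_ = ?E")
  proof
    show "PIdl\<^bsub>Cinf 1\<^esub> (fn1 (\<lambda>t. t\<^sup>2)) \<subseteq> ?E"
    proof
      fix h assume "h \<in> PIdl\<^bsub>Cinf 1\<^esub> (fn1 (\<lambda>t. t\<^sup>2))"
      then obtain k where k: "k \<in> carrier (Cinf 1)" "h = k \<otimes>\<^bsub>Cinf 1\<^esub> fn1 (\<lambda>t. t\<^sup>2)"
        by (auto simp: cgenideal_def)
      obtain K where "k = fn1 K" "smooth_real K" by (rule Cinf_1E[OF k(1)], rule that)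
      then show "h \<in> ?E" using k(2) by (auto simp: Cinf_simps fn1_ops mult.commute)
    qed
    show "?E \<subseteq> PIdl\<^bsub>Cinf 1\<^esub> (fn1 (\<lambda>t. t\<^sup>2))"
    proof
      fix h assume "h \<in> ?E"
      then obtain K where K: "smooth_real K" "h = fn1 (\<lambda>t. t\<^sup>2 * K t)" by auto
      then have "h = fn1 K \<otimes>\<^bsub>Cinf 1\<^esub> fn1 (\<lambda>t. t\<^sup>2)" by (simp add: Cinf_simps fn1_ops mult.commute)
      then show "h \<in> PIdl\<^bsub>Cinf 1\<^esub> (fn1 (\<lambda>t. t\<^sup>2))" using K(1) by (auto simp: cgenideal_def fn1_Cinf)
    qed
  qed
  finally show ?thesis .
qed

lemma ideal_W_D: "ideal (wideal W_D) (Cinf (wdim W_D))"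
proof -
  have "fn1 (\<lambda>t. t\<^sup>2) \<in> carrier (Cinf 1)"
    by (simp add: fn1_Cinf power2_eq_square smooth_real_mult smooth_real_ident)
  then show ?thesis
    using ring.genideal_ideal[OF ring_Cinf, of "{fn1 (\<lambda>t. t\<^sup>2)}" 1] by (simp add: W_D_def fn1_def)
qed

lemma W_D_memI: "smooth_real K \<Longrightarrow> (\<And>t. H t = t\<^sup>2 * K t) \<Longrightarrow> fn1 H \<in> wideal W_D"
  unfolding wideal_W_D by (auto intro!: exI[of _ K] arg_cong[of _ _ fn1])

lemma deriv_square_times:
  assumes "smooth_real K"
  shows "((\<lambda>t. t\<^sup>2 * K t) has_real_derivative 0) (at 0)"
proof -
  have "((\<lambda>t::real. t\<^sup>2) has_real_derivative 0) (at 0)" by (auto intro!: derivative_eq_intros)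
  from DERIV_mult[OF this smooth_real_has_derivative[OF assms]] show ?thesis by simp
qed

text \<open>Elements of \<open>W_D\<close> are first-order jets.\<close>

lemma W_D_mem_iff:
  assumes H: "smooth_real H"
  shows "fn1 H \<in> wideal W_D \<longleftrightarrow> H 0 = 0 \<and> deriv H 0 = 0"
proof
  assume "fn1 H \<in> wideal W_D"
  then obtain K where K: "smooth_real K" "fn1 H = fn1 (\<lambda>t. t\<^sup>2 * K t)" by (auto simp: wideal_W_D)
  have "H t = t\<^sup>2 * K t" for t using arg_cong[OF K(2), of "\<lambda>f. f (vec1 t)"] by simp
  then have eq: "H = (\<lambda>t. t\<^sup>2 * K t)" by (intro ext)
  show "H 0 = 0 \<and> deriv H 0 = 0"
    unfolding eq using DERIV_imp_deriv[OF deriv_square_times[OF K(1)]] by simp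
next
  assume 0: "H 0 = 0 \<and> deriv H 0 = 0"
  obtain K where K: "smooth_real K" "\<And>t. H t = H 0 + t * deriv H 0 + t\<^sup>2 * K t"
    by (rule smooth_real_Taylor[OF H], rule that)
  have "H t = t\<^sup>2 * K t" for t using K(2)[of t] 0 by simp
  then show "fn1 H \<in> wideal W_D" by (rule W_D_memI[OF K(1)])
qed

lemma wideal_W_D2:
  "wideal W_D2 = genideal3 (\<lambda>x y. x\<^sup>2) (\<lambda>x y. y\<^sup>2) (\<lambda>x y. x * y)" (is "_ = genideal3 ?p ?q ?r")
proof -
  have pqr: "smooth2 ?p" "smooth2 ?q" "smooth2 ?r"
    unfolding power2_eq_square by (intro smooth2_intros(6) smooth2_intros(1,2))+
  have eq: "wideal W_D2 = Idl\<^bsub>Cinf 2\<^esub> {fn2 ?p, fn2 ?q, fn2 ?r}" by (simp add: W_D2_def fn2_def)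
  have sub: "{fn2 ?p, fn2 ?q, fn2 ?r} \<subseteq> carrier (Cinf 2)" using pqr by (simp add: fn2_Cinf)
  show ?thesis
  proof
    show "wideal W_D2 \<subseteq> genideal3 ?p ?q ?r"
      unfolding eq using genideal3_generators by (intro ring.genideal_minimal[OF ring_Cinf ideal_genideal3[OF pqr]]) auto
    show "genideal3 ?p ?q ?r \<subseteq> wideal W_D2"
      unfolding eq using ring.genideal_self[OF ring_Cinf sub]
      by (intro genideal3_minimal ring.genideal_ideal[OF ring_Cinf sub]) auto
  qed
qed

text \<open>The pullbacks of the elements \<open>t\<^sup>2 * K t\<close> of the ideal of \<open>W_D\<close> along the two coordinates are
  multiples of \<open>x\<^sup>2\<close> and of \<open>y\<^sup>2\<close>.\<close>

lemma wideal_W_DD: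
  "wideal W_DD = genideal3 (\<lambda>x y. x\<^sup>2) (\<lambda>x y. y\<^sup>2) (\<lambda>x y. 0)" (is "_ = genideal3 ?p ?q ?r")
proof -
  have pqr: "smooth2 ?p" "smooth2 ?q" "smooth2 ?r"
    unfolding power2_eq_square by (intro smooth2_intros(6,3) smooth2_intros(1,2))+
  have first: "(\<lambda>z\<in>carrier_vec 2. fn1 F (vec_first z 1)) = fn2 (\<lambda>x y. F x)" for F :: "real \<Rightarrow> real"
  proof -
    have "vec_first z 1 = vec1 (z $ 0)" if "z \<in> carrier_vec 2" for z :: "real vec"
      using that by (intro eq_vecI) (auto simp: vec_first_def less_one)
    then show ?thesis by (auto simp: fn2_def fun_eq_iff)
  qed
  have last: "(\<lambda>z\<in>carrier_vec 2. fn1 F (vec_last z 1)) = fn2 (\<lambda>x y. F y)" for F :: "real \<Rightarrow> real"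
  proof -
    have "vec_last z 1 = vec1 (z $ 1)" if "z \<in> carrier_vec 2" for z :: "real vec"
      using that by (intro eq_vecI) (auto simp: vec_last_def less_one One_nat_def)
    then show ?thesis by (auto simp: fn2_def fun_eq_iff)
  qed
  define S where "S = {\<lambda>z\<in>carrier_vec 2. h (vec_first z 1) |h. h \<in> wideal W_D} \<union>
      {\<lambda>z\<in>carrier_vec 2. h (vec_last z 1) |h. h \<in> wideal W_D}"
  have eq: "wideal W_DD = Idl\<^bsub>Cinf 2\<^esub> S"
    by (simp add: weil_tensor_def Let_def S_def)
  have S_sub: "S \<subseteq> genideal3 ?p ?q ?r"
  proof
    fix s assume "s \<in> S"
    then obtain h where h: "h \<in> wideal W_D" "s = (\<lambda>z\<in>carrier_vec 2. h (vec_first z 1)) \<or> s = (\<lambda>z\<in>carrier_vec 2. h (vec_last z 1))"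
      unfolding S_def by blast
    obtain K where K: "smooth_real K" "h = fn1 (\<lambda>t. t\<^sup>2 * K t)" using h(1) unfolding wideal_W_D by blast
    have "fn2 (\<lambda>x y. x\<^sup>2 * K x) \<in> genideal3 ?p ?q ?r"
      by (rule genideal3I[OF smooth2_real[OF K(1) smooth2_intros(1)] smooth2_intros(3)[of 0] smooth2_intros(3)[of 0]]) simp
    moreover have "fn2 (\<lambda>x y. y\<^sup>2 * K y) \<in> genideal3 ?p ?q ?r"
      by (rule genideal3I[OF smooth2_intros(3)[of 0] smooth2_real[OF K(1) smooth2_intros(2)] smooth2_intros(3)[of 0]]) simp
    ultimately show "s \<in> genideal3 ?p ?q ?r" using h(2) unfolding K(2) first last by (elim disjE) (simp_all only:)
  qed
  have sq: "fn1 (\<lambda>t. t\<^sup>2) \<in> wideal W_D" by (rule W_D_memI[OF smooth_real_const[of 1]]) simp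
  have "(\<lambda>z\<in>carrier_vec 2. fn1 (\<lambda>t. t\<^sup>2) (vec_first z 1)) \<in> S"
    "(\<lambda>z\<in>carrier_vec 2. fn1 (\<lambda>t. t\<^sup>2) (vec_last z 1)) \<in> S"
    unfolding S_def using sq by blast+
  then have gens: "fn2 ?p \<in> S" "fn2 ?q \<in> S" unfolding first last by blast+
  have sub: "S \<subseteq> carrier (Cinf 2)" using S_sub genideal3_subset[OF pqr] by blast
  have I: "ideal (Idl\<^bsub>Cinf 2\<^esub> S) (Cinf 2)" by (rule ring.genideal_ideal[OF ring_Cinf sub])
  have "fn2 ?r \<in> Idl\<^bsub>Cinf 2\<^esub> S"
    using additive_subgroup.zero_closed[OF ideal.axioms(1)[OF I]] by (simp add: Cinf_simps fn2_ops)
  then have "genideal3 ?p ?q ?r \<subseteq> Idl\<^bsub>Cinf 2\<^esub> S"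
    using gens ring.genideal_self[OF ring_Cinf sub] by (intro genideal3_minimal[OF I]) auto
  moreover have "Idl\<^bsub>Cinf 2\<^esub> S \<subseteq> genideal3 ?p ?q ?r"
    by (rule ring.genideal_minimal[OF ring_Cinf ideal_genideal3[OF pqr] S_sub])
  ultimately show ?thesis unfolding eq by (intro equalityI)
qed

lemma smooth2_monomials:
  "smooth2 (\<lambda>x y. x\<^sup>2)" "smooth2 (\<lambda>x y. y\<^sup>2)" "smooth2 (\<lambda>x y. x * y)" "smooth2 (\<lambda>x y. 0)"
  unfolding power2_eq_square by (intro smooth2_intros(6,3) smooth2_intros(1,2))+

lemma ideal_W_D2: "ideal (wideal W_D2) (Cinf (wdim W_D2))"
  unfolding wideal_W_D2 by (simp add: ideal_genideal3 smooth2_monomials)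

lemma ideal_W_DD: "ideal (wideal W_DD) (Cinf (wdim W_DD))"
  unfolding wideal_W_DD by (simp add: ideal_genideal3 smooth2_monomials)

lemma vanish_W_D: "\<forall>h\<in>wideal W_D. h (0\<^sub>v (wdim W_D)) = 0"
  by (auto simp: wideal_W_D)

lemma vanish_W_D2: "\<forall>h\<in>wideal W_D2. h (0\<^sub>v (wdim W_D2)) = 0"
  by (auto simp: wideal_W_D2 genideal3_def)

lemma vanish_W_DD: "\<forall>h\<in>wideal W_DD. h (0\<^sub>v (wdim W_DD)) = 0"
  by (auto simp: wideal_W_DD genideal3_def)

lemma weil_algebra_W_D: "weil_algebra W_D"
proof (rule weil_algebraI[OF ideal_W_D vanish_W_D, where bs = "[fn1 (\<lambda>_. 1), fn1 (\<lambda>t. t)]"])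
  fix a b c assume "a \<in> carrier (Cinf (wdim W_D))" "b \<in> carrier (Cinf (wdim W_D))" "c \<in> carrier (Cinf (wdim W_D))"
  then have abc: "a \<in> carrier (Cinf 1)" "b \<in> carrier (Cinf 1)" "c \<in> carrier (Cinf 1)" by simp_all
  obtain A where A: "a = fn1 A" "smooth_real A" by (rule Cinf_1E[OF abc(1)], rule that)
  obtain B where B: "b = fn1 B" "smooth_real B" by (rule Cinf_1E[OF abc(2)], rule that)
  obtain C where C: "c = fn1 C" "smooth_real C" by (rule Cinf_1E[OF abc(3)], rule that)
  note ABC = A(1) B(1) C(1) A(2) B(2) C(2)
  assume "a (0\<^sub>v (wdim W_D)) = 0" "b (0\<^sub>v (wdim W_D)) = 0" "c (0\<^sub>v (wdim W_D)) = 0"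
  then have 0: "A 0 = 0" "B 0 = 0" "C 0 = 0" by (simp_all add: ABC)
  have "((\<lambda>t. A t * (B t * C t)) has_real_derivative 0) (at 0)"
    using 0 by (auto intro!: derivative_eq_intros smooth_real_has_derivative ABC)
  then have "fn1 (\<lambda>t. A t * (B t * C t)) \<in> wideal W_D"
    using 0 ABC by (subst W_D_mem_iff) (auto intro!: smooth_real_mult DERIV_imp_deriv)
  then show "(\<lambda>x\<in>carrier_vec (wdim W_D). a x * (b x * c x)) \<in> wideal W_D"
    by (simp add: ABC fn1_def cong: restrict_cong)
next
  fix h assume "h \<in> carrier (Cinf (wdim W_D))"
  then have h: "h \<in> carrier (Cinf 1)" by simp
  obtain H where H: "h = fn1 H" "smooth_real H" by (rule Cinf_1E[OF h], rule that)
  obtain K where K: "smooth_real K" "\<And>t. H t = H 0 + t * deriv H 0 + t\<^sup>2 * K t"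
    by (rule smooth_real_Taylor[OF H(2)], rule that)
  have "fn1 (\<lambda>t. H t - (H 0 * 1 + (deriv H 0 * t + 0))) \<in> wideal W_D"
    by (rule W_D_memI[OF K(1)]) (subst K(2), simp)
  moreover have "(\<lambda>x\<in>carrier_vec (wdim W_D). h x - lincomb (wdim W_D) [H 0, deriv H 0] [fn1 (\<lambda>_. 1), fn1 (\<lambda>t. t)] x) =
      fn1 (\<lambda>t. H t - (H 0 * 1 + (deriv H 0 * t + 0)))"
    by (auto simp: H(1) fn1_def lincomb_def fun_eq_iff)
  ultimately show "\<exists>cs. length cs = length [fn1 (\<lambda>_. 1), fn1 (\<lambda>t. t)] \<and>
      (\<lambda>x\<in>carrier_vec (wdim W_D). h x - lincomb (wdim W_D) cs [fn1 (\<lambda>_. 1), fn1 (\<lambda>t. t)] x) \<in> wideal W_D"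
    by (intro exI[of _ "[H 0, deriv H 0]"]) simp
qed (simp add: fn1_Cinf smooth_real_ident smooth_real_const)

text \<open>Each of the functions is a combination of \<open>x\<close> and \<open>y\<close>, and each cubic monomial in two
  variables is divisible by one of the squares.\<close>

lemma cubic_in_squares:
  assumes "smooth2 A" "smooth2 B" "smooth2 C" "A 0 0 = 0" "B 0 0 = 0" "C 0 0 = 0"
  obtains P Q where "smooth2 P" "smooth2 Q" "\<And>x y. A x y * (B x y * C x y) = x\<^sup>2 * P x y + y\<^sup>2 * Q x y"
proof -
  obtain A1 A2 where A: "smooth2 A1" "smooth2 A2" "\<And>x y. A x y = A 0 0 + x * A1 x y + y * A2 x y"
    by (rule smooth2_Taylor1[OF assms(1)], rule that)
  obtain B1 B2 where B: "smooth2 B1" "smooth2 B2" "\<And>x y. B x y = B 0 0 + x * B1 x y + y * B2 x y"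
    by (rule smooth2_Taylor1[OF assms(2)], rule that)
  obtain C1 C2 where C: "smooth2 C1" "smooth2 C2" "\<And>x y. C x y = C 0 0 + x * C1 x y + y * C2 x y"
    by (rule smooth2_Taylor1[OF assms(3)], rule that)
  show thesis
  proof (rule that)
    show "smooth2 (\<lambda>x y. A1 x y * B1 x y * C x y + y * ((A1 x y * B2 x y + A2 x y * B1 x y) * C1 x y))"
      "smooth2 (\<lambda>x y. A2 x y * B2 x y * C x y + x * ((A1 x y * B2 x y + A2 x y * B1 x y) * C2 x y))"
      by (intro smooth2_intros(4,6) smooth2_intros(1,2) A(1,2) B(1,2) C(1,2) assms(3))+
    fix x y
    have "A x y = x * A1 x y + y * A2 x y" "B x y = x * B1 x y + y * B2 x y" "C x y = x * C1 x y + y * C2 x y"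
      using A(3)[of x y] B(3)[of x y] C(3)[of x y] assms(4-6) by simp_all
    then show "A x y * (B x y * C x y) =
        x\<^sup>2 * (A1 x y * B1 x y * C x y + y * ((A1 x y * B2 x y + A2 x y * B1 x y) * C1 x y)) +
        y\<^sup>2 * (A2 x y * B2 x y * C x y + x * ((A1 x y * B2 x y + A2 x y * B1 x y) * C2 x y))"
      by (simp only:) (simp add: power2_eq_square algebra_simps)
  qed
qed

lemma weil_algebra_planeI:
  assumes W: "ideal (wideal W) (Cinf (wdim W))" and dim: "wdim W = 2"
    and gen: "wideal W = genideal3 (\<lambda>x y. x\<^sup>2) (\<lambda>x y. y\<^sup>2) r" and vanish: "\<forall>h\<in>wideal W. h (0\<^sub>v (wdim W)) = 0"
  shows "weil_algebra W"
proof (rule weil_algebraI[OF W vanish, where bs = "[fn2 (\<lambda>_ _. 1), fn2 (\<lambda>x _. x), fn2 (\<lambda>_ y. y), fn2 (\<lambda>x y. x * y)]"])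
  note z = smooth2_intros(3)[of 0]
  have r: "fn2 H \<in> wideal W" if "smooth2 P" "smooth2 Q" "\<And>x y. H x y = x\<^sup>2 * P x y + y\<^sup>2 * Q x y" for H P Q
    unfolding gen by (rule genideal3I[OF that(1,2) z]) (simp add: that(3))
  fix a b c assume "a \<in> carrier (Cinf (wdim W))" "b \<in> carrier (Cinf (wdim W))" "c \<in> carrier (Cinf (wdim W))"
  then have abc: "a \<in> carrier (Cinf 2)" "b \<in> carrier (Cinf 2)" "c \<in> carrier (Cinf 2)" unfolding dim .
  obtain A where A: "a = fn2 A" "smooth2 A" by (rule Cinf_2E[OF abc(1)], rule that)
  obtain B where B: "b = fn2 B" "smooth2 B" by (rule Cinf_2E[OF abc(2)], rule that)
  obtain C where C: "c = fn2 C" "smooth2 C" by (rule Cinf_2E[OF abc(3)], rule that)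
  note ABC = A(1) B(1) C(1) A(2) B(2) C(2)
  assume "a (0\<^sub>v (wdim W)) = 0" "b (0\<^sub>v (wdim W)) = 0" "c (0\<^sub>v (wdim W)) = 0"
  then have 0: "A 0 0 = 0" "B 0 0 = 0" "C 0 0 = 0" by (simp_all add: ABC dim)
  obtain P Q where PQ: "smooth2 P" "smooth2 Q" "\<And>x y. A x y * (B x y * C x y) = x\<^sup>2 * P x y + y\<^sup>2 * Q x y"
    by (rule cubic_in_squares[OF ABC(4-6) 0], rule that)
  then have "fn2 (\<lambda>x y. A x y * (B x y * C x y)) \<in> wideal W" by (rule r)
  then show "(\<lambda>x\<in>carrier_vec (wdim W). a x * (b x * c x)) \<in> wideal W"
    by (simp add: ABC fn2_def dim cong: restrict_cong)
next
  let ?bs = "[fn2 (\<lambda>_ _. 1), fn2 (\<lambda>x _. x), fn2 (\<lambda>_ y. y), fn2 (\<lambda>x y. x * y)] :: (real vec \<Rightarrow> real) list"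
  note z = smooth2_intros(3)[of 0]
  fix h assume "h \<in> carrier (Cinf (wdim W))"
  then have h: "h \<in> carrier (Cinf 2)" unfolding dim .
  obtain H where H: "h = fn2 H" "smooth2 H" by (rule Cinf_2E[OF h], rule that)
  obtain b c d A B where AB: "smooth2 A" "smooth2 B"
    "\<And>x y. H x y = H 0 0 + b * x + c * y + d * (x * y) + x\<^sup>2 * A x y + y\<^sup>2 * B x y"
    by (rule smooth2_Taylor2[OF H(2)], rule that)
  have "fn2 (\<lambda>x y. H x y - (H 0 0 * 1 + (b * x + (c * y + (d * (x * y) + 0))))) \<in> wideal W"
    unfolding gen by (rule genideal3I[OF AB(1,2) z]) (subst AB(3), simp)
  moreover have "(\<lambda>x\<in>carrier_vec (wdim W). h x - lincomb (wdim W) [H 0 0, b, c, d] ?bs x) =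
      fn2 (\<lambda>x y. H x y - (H 0 0 * 1 + (b * x + (c * y + (d * (x * y) + 0)))))"
    by (auto simp: H(1) fn2_def lincomb_def fun_eq_iff dim)
  ultimately show "\<exists>cs. length cs = length ?bs \<and>
      (\<lambda>x\<in>carrier_vec (wdim W). h x - lincomb (wdim W) cs ?bs x) \<in> wideal W"
    by (intro exI[of _ "[H 0 0, b, c, d]"]) simp
qed (simp add: dim fn2_Cinf smooth2_intros smooth2_monomials)

lemma weil_algebra_W_D2: "weil_algebra W_D2"
  by (rule weil_algebra_planeI[OF ideal_W_D2 wdim_simps(2) wideal_W_D2 vanish_W_D2])

lemma weil_algebra_W_DD: "weil_algebra W_DD"
  by (rule weil_algebra_planeI[OF ideal_W_DD wdim_simps(3) wideal_W_DD vanish_W_DD])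

section \<open>Maps between the algebras of dual numbers\<close>

text \<open>The geometric side of \<open>weil_induced\<close>: smooth maps that preserve the base point and pull the
  one ideal back into the other.\<close>

definition weil_map :: "presentation \<Rightarrow> presentation \<Rightarrow> (real vec \<Rightarrow> real vec) \<Rightarrow> bool" where
  "weil_map W W' g \<longleftrightarrow>
     g \<in> smooth_maps (euclid (wdim W')) (euclid (wdim W)) \<and>
     g (0\<^sub>v (wdim W')) = 0\<^sub>v (wdim W) \<and>
     (\<forall>h \<in> wideal W. compose (carrier_vec (wdim W')) h g \<in> wideal W')"

text \<open>The line through the origin with direction \<open>(\<alpha>, \<beta>)\<close>. The directions \<open>(1, 0)\<close> and \<open>(0, 1)\<close> give
  the two restrictions to the axes, \<open>(1, 1)\<close> the diagonal that defines the addition of tangent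
  vectors, and \<open>(0, 0)\<close> the augmentation followed by the inclusion of the reals.\<close>

definition line :: "real \<Rightarrow> real \<Rightarrow> real vec \<Rightarrow> real vec" where
  "line \<alpha> \<beta> = fn1 (\<lambda>t. vec2 (\<alpha> * t) (\<beta> * t))"

definition scaling :: "real \<Rightarrow> real vec \<Rightarrow> real vec" where
  "scaling r = fn1 (\<lambda>t. vec1 (r * t))"

text \<open>A chart of the blow-up of the origin in the plane. It contracts the axis \<open>x = 0\<close> to a point
  and maps the horizontal line at height \<open>y\<close> to the line with slope \<open>y\<close>.\<close>

definition blowdown :: "real vec \<Rightarrow> real vec" where
  "blowdown = fn2 (\<lambda>x y. vec2 x (x * y))"

lemma compose_line [simp]: "compose (carrier_vec 1) (fn2 H) (line \<alpha> \<beta>) = fn1 (\<lambda>t. H (\<alpha> * t) (\<beta> * t))"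
  by (simp add: line_def compose_fn)

lemma compose_scaling [simp]: "compose (carrier_vec 1) (fn1 H) (scaling r) = fn1 (\<lambda>t. H (r * t))"
  by (simp add: scaling_def compose_fn)

lemma compose_blowdown [simp]: "compose (carrier_vec 2) (fn2 H) blowdown = fn2 (\<lambda>x y. H x (x * y))"
  by (simp add: blowdown_def compose_fn)

lemma smooth_real_linear: "smooth_real (\<lambda>t. \<alpha> * t)"
  by (intro smooth_real_cmult smooth_real_ident)

lemma smooth2_line: "smooth2 A \<Longrightarrow> smooth_real (\<lambda>t. A (\<alpha> * t) (\<beta> * t))"
  by (rule smooth2D[OF _ smooth_real_linear smooth_real_linear])

lemma weil_map_scaling: "weil_map W_D W_D (scaling r)"
proof -
  have "compose (carrier_vec 1) h (scaling r) \<in> wideal W_D" if "h \<in> wideal W_D" for h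
  proof -
    obtain K where K: "smooth_real K" "h = fn1 (\<lambda>t. t\<^sup>2 * K t)" using \<open>h \<in> wideal W_D\<close> unfolding wideal_W_D by blast
    have "fn1 (\<lambda>t. (r * t)\<^sup>2 * K (r * t)) \<in> wideal W_D"
      by (rule W_D_memI[OF smooth_real_cmult[OF smooth_real_compose[OF K(1) smooth_real_linear]], of _ "r\<^sup>2" r])
        (simp add: power_mult_distrib)
    then show ?thesis by (simp add: K(2))
  qed
  moreover have "scaling r \<in> smooth_maps (euclid 1) (euclid 1)"
    unfolding scaling_def by (rule smooth_to_line(1)[OF smooth_real_linear])
  ultimately show ?thesis by (simp add: weil_map_def) (simp add: scaling_def)
qed

lemma weil_map_line_genideal3:
  assumes "wdim W = 2" and W: "wideal W = genideal3 (\<lambda>x y. x\<^sup>2) (\<lambda>x y. y\<^sup>2) (\<lambda>x y. \<gamma> * (x * y))"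
  shows "weil_map W W_D (line \<alpha> \<beta>)"
proof -
  have "compose (carrier_vec 1) h (line \<alpha> \<beta>) \<in> wideal W_D" if h: "h \<in> wideal W" for h
  proof -
    obtain A B C where ABC: "smooth2 A" "smooth2 B" "smooth2 C"
      and eq: "h = fn2 (\<lambda>x y. x\<^sup>2 * A x y + y\<^sup>2 * B x y + \<gamma> * (x * y) * C x y)"
      using h unfolding W genideal3_def by blast
    let ?K = "\<lambda>t. \<alpha>\<^sup>2 * A (\<alpha> * t) (\<beta> * t) + \<beta>\<^sup>2 * B (\<alpha> * t) (\<beta> * t) + (\<gamma> * (\<alpha> * \<beta>)) * C (\<alpha> * t) (\<beta> * t)"
    have "smooth_real ?K"
      by (intro smooth_real_add smooth_real_cmult smooth2_line ABC)
    then show ?thesis unfolding eq compose_line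
      by (rule W_D_memI) (simp add: power2_eq_square algebra_simps)
  qed
  moreover have "line \<alpha> \<beta> \<in> smooth_maps (euclid 1) (euclid 2)"
    unfolding line_def by (rule smooth_to_plane(1)[OF smooth_real_linear smooth_real_linear])
  ultimately show ?thesis using assms(1) by (simp add: weil_map_def) (simp add: line_def)
qed

lemma weil_map_line: "weil_map W_D2 W_D (line \<alpha> \<beta>)"
  by (rule weil_map_line_genideal3[where \<gamma> = 1]) (simp_all add: wideal_W_D2)

lemma weil_map_line_DD: "weil_map W_DD W_D (line \<alpha> \<beta>)"
  by (rule weil_map_line_genideal3[where \<gamma> = 0]) (simp_all add: wideal_W_DD)

text \<open>The relations of \<open>W_D2\<close> pull back to \<open>x\<^sup>2\<close>, \<open>x\<^sup>2 * y\<^sup>2\<close> and \<open>x\<^sup>2 * y\<close>, all multiples of \<open>x\<^sup>2\<close>.\<close>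

lemma weil_map_blowdown: "weil_map W_D2 W_DD blowdown"
proof -
  have "compose (carrier_vec 2) h blowdown \<in> wideal W_DD" if h: "h \<in> wideal W_D2" for h
  proof -
    obtain A B C where ABC: "smooth2 A" "smooth2 B" "smooth2 C"
      and eq: "h = fn2 (\<lambda>x y. x\<^sup>2 * A x y + y\<^sup>2 * B x y + (x * y) * C x y)"
      using h unfolding wideal_W_D2 genideal3_def by blast
    have pull: "smooth2 (\<lambda>x y. S x (x * y))" if "smooth2 S" for S
      by (rule smooth2_compose[OF that smooth2_intros(1) smooth2_monomials(3)])
    have K: "smooth2 (\<lambda>x y. A x (x * y) + (y * y) * B x (x * y) + y * C x (x * y))"
      by (intro smooth2_intros(4,6) smooth2_intros(2) pull ABC)
    have "fn2 (\<lambda>x y. x\<^sup>2 * A x (x * y) + (x * y)\<^sup>2 * B x (x * y) + (x * (x * y)) * C x (x * y)) \<in> wideal W_DD"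
      unfolding wideal_W_DD
      by (rule genideal3I[OF K smooth2_intros(3)[of 0] smooth2_intros(3)[of 0]])
        (simp add: power2_eq_square algebra_simps)
    then show ?thesis by (simp only: eq compose_blowdown)
  qed
  moreover have "blowdown \<in> smooth_maps (euclid 2) (euclid 2)"
    unfolding blowdown_def by (rule smooth_to_plane(2)[OF smooth2_intros(1) smooth2_monomials(3)])
  ultimately show ?thesis by (simp add: weil_map_def) (simp add: blowdown_def)
qed

lemma weil_map_induces:
  assumes "weil_algebra W" "weil_algebra W'" "weil_map W W' g"
  shows "\<exists>\<phi>. weil_induced W W' \<phi> g"
  using assms by (intro weil_induced_exists weil_algebra_ideal) (auto simp: weil_map_def)

lemma weil_inducedD:
  assumes "weil_induced W W' \<phi> g"
  shows "\<phi> \<in> weil_hom W W'"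
    "h \<in> carrier (Cinf (wdim W)) \<Longrightarrow> \<phi> (wclass W h) = wclass W' (compose (carrier_vec (wdim W')) h g)"
  using assms by (auto simp: weil_induced_def)

lemma wclass_W_D_eq_iff:
  assumes "smooth_real H" "smooth_real K"
  shows "wclass W_D (fn1 H) = wclass W_D (fn1 K) \<longleftrightarrow> H 0 = K 0 \<and> deriv H 0 = deriv K 0"
proof -
  have "fn1 H \<in> carrier (Cinf (wdim W_D))" "fn1 K \<in> carrier (Cinf (wdim W_D))"
    using assms by (simp_all add: fn1_Cinf)
  from wclass_eq_iff[OF ideal_W_D this]
  have "wclass W_D (fn1 H) = wclass W_D (fn1 K) \<longleftrightarrow> fn1 (\<lambda>t. H t - K t) \<in> wideal W_D"
    by (simp only: wdim_simps fn1_ops)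
  moreover have "deriv (\<lambda>t. H t - K t) 0 = deriv H 0 - deriv K 0"
    by (intro DERIV_imp_deriv DERIV_diff smooth_real_has_derivative assms)
  ultimately show ?thesis
    by (simp add: W_D_mem_iff[OF smooth_real_diff[OF assms]])
qed

lemma carrier_walg_W_D:
  assumes "u \<in> carrier (walg W_D)"
  obtains H where "smooth_real H" "u = wclass W_D (fn1 H)"
proof -
  obtain h where h: "h \<in> carrier (Cinf 1)" "u = wclass W_D h" using assms by (auto simp: carrier_walg[OF ideal_W_D])
  obtain H where H: "h = fn1 H" "smooth_real H" by (rule Cinf_1E[OF h(1)], rule that)
  show thesis by (rule that[OF H(2)]) (simp add: h(2) H(1))
qed

lemma carrier_walg_plane:
  assumes "ideal (wideal W) (Cinf (wdim W))" "wdim W = 2" "u \<in> carrier (walg W)"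
  obtains H where "smooth2 H" "u = wclass W (fn2 H)"
proof -
  obtain h where h: "h \<in> carrier (Cinf 2)" "u = wclass W h"
    using assms by (auto simp: carrier_walg[OF assms(1)])
  obtain H where H: "h = fn2 H" "smooth2 H" by (rule Cinf_2E[OF h(1)], rule that)
  show thesis by (rule that[OF H(2)]) (simp add: h(2) H(1))
qed

lemma wclass_plane_eq_iff:
  assumes "ideal (wideal W) (Cinf (wdim W))" "wdim W = 2" "smooth2 H" "smooth2 K"
  shows "wclass W (fn2 H) = wclass W (fn2 K) \<longleftrightarrow> fn2 (\<lambda>x y. H x y - K x y) \<in> wideal W"
proof -
  have "fn2 H \<in> carrier (Cinf (wdim W))" "fn2 K \<in> carrier (Cinf (wdim W))"
    using assms by (simp_all add: fn2_Cinf)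
  from wclass_eq_iff[OF assms(1) this] show ?thesis by (simp only: assms(2) fn2_ops)
qed

lemma deriv_of_Taylor:
  assumes "smooth_real K" "\<And>t. F t = a + b * t + t\<^sup>2 * K t"
  shows "deriv F 0 = (b::real)"
proof -
  have "((\<lambda>t. a + b * t + t\<^sup>2 * K t) has_real_derivative 0 + b + 0) (at 0)"
    by (intro DERIV_add DERIV_const deriv_square_times assms(1) DERIV_cmult_Id)
  moreover have "F = (\<lambda>t. a + b * t + t\<^sup>2 * K t)" using assms(2) by (intro ext)
  ultimately have "(F has_real_derivative b) (at 0)" by simp
  then show ?thesis by (rule DERIV_imp_deriv)
qed

lemma smooth2_Taylor2_coefficients:
  assumes H: "smooth2 H"
  obtains d A B where "smooth2 A" "smooth2 B"
    "\<And>x y. H x y = H 0 0 + deriv (\<lambda>t. H t 0) 0 * x + deriv (H 0) 0 * y + d * (x * y) +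
      x\<^sup>2 * A x y + y\<^sup>2 * B x y"
proof -
  obtain b c d A B where AB: "smooth2 A" "smooth2 B"
    "\<And>x y. H x y = H 0 0 + b * x + c * y + d * (x * y) + x\<^sup>2 * A x y + y\<^sup>2 * B x y"
    by (rule smooth2_Taylor2[OF H], rule that)
  have b: "deriv (\<lambda>t. H t 0) 0 = b"
  proof (rule deriv_of_Taylor[OF smooth2_fix(1)[OF AB(1)]])
    show "H t 0 = H 0 0 + b * t + t\<^sup>2 * A t 0" for t using AB(3)[of t 0] by simp
  qed
  have c: "deriv (H 0) 0 = c"
  proof (rule deriv_of_Taylor[OF smooth2_fix(2)[OF AB(2)]])
    show "H 0 t = H 0 0 + c * t + t\<^sup>2 * B 0 t" for t using AB(3)[of 0 t] by simp
  qed
  show thesis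
  proof (rule that[OF AB(1,2)])
    show "H x y = H 0 0 + deriv (\<lambda>t. H t 0) 0 * x + deriv (H 0) 0 * y + d * (x * y) +
        x\<^sup>2 * A x y + y\<^sup>2 * B x y" for x y
      unfolding b c by (rule AB(3))
  qed
qed

lemma W_D2_mem_iff:
  assumes H: "smooth2 H"
  shows "fn2 H \<in> wideal W_D2 \<longleftrightarrow> H 0 0 = 0 \<and> deriv (\<lambda>t. H t 0) 0 = 0 \<and> deriv (H 0) 0 = 0"
proof
  assume mem: "fn2 H \<in> wideal W_D2"
  have line: "fn1 (\<lambda>t. H (\<alpha> * t) (\<beta> * t)) \<in> wideal W_D" for \<alpha> \<beta>
    using weil_map_line[of \<alpha> \<beta>] mem unfolding weil_map_def by (metis compose_line wdim_simps(1))
  show "H 0 0 = 0 \<and> deriv (\<lambda>t. H t 0) 0 = 0 \<and> deriv (H 0) 0 = 0"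
    using line[of 1 0] line[of 0 1] smooth2_fix[OF H] by (simp add: W_D_mem_iff)
next
  assume 0: "H 0 0 = 0 \<and> deriv (\<lambda>t. H t 0) 0 = 0 \<and> deriv (H 0) 0 = 0"
  obtain d A B where AB: "smooth2 A" "smooth2 B" "\<And>x y. H x y = H 0 0 + deriv (\<lambda>t. H t 0) 0 * x +
      deriv (H 0) 0 * y + d * (x * y) + x\<^sup>2 * A x y + y\<^sup>2 * B x y"
    by (rule smooth2_Taylor2_coefficients[OF H], rule that)
  show "fn2 H \<in> wideal W_D2" unfolding wideal_W_D2
  proof (rule genideal3I[OF AB(1,2) smooth2_intros(3)[of d]])
    show "H x y = x\<^sup>2 * A x y + y\<^sup>2 * B x y + x * y * d" for x y
      using AB(3)[of x y] 0 by (simp add: mult.commute)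
  qed
qed

text \<open>Along the two diagonals \<open>y = x\<close> and \<open>y = - x\<close> a combination \<open>x\<^sup>2 * A + y\<^sup>2 * B\<close> has the same
  quadratic coefficient, whereas that of \<open>d * (x * y)\<close> changes its sign.\<close>

lemma W_DD_mixed_coefficient:
  assumes "fn2 (\<lambda>x y. d * (x * y)) \<in> wideal W_DD"
  shows "d = 0"
proof -
  obtain A B C where AB: "smooth2 A" "smooth2 B" "smooth2 C"
    "\<And>x y. d * (x * y) = x\<^sup>2 * A x y + y\<^sup>2 * B x y + 0 * C x y"
    by (rule genideal3E[OF assms[unfolded wideal_W_DD]], rule that)
  have eq: "\<sigma> * d = A 0 0 + B 0 0" if "\<sigma>\<^sup>2 = 1" for \<sigma>
  proof -
    define F where "F t = A (1 * t) (\<sigma> * t) + B (1 * t) (\<sigma> * t)" for t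
    have "smooth_real F" unfolding F_def by (intro smooth_real_add smooth2_line AB)
    then have "isCont F 0" by (rule DERIV_isCont[OF smooth_real_has_derivative])
    then have "F \<midarrow>0\<rightarrow> F 0" by (simp add: isCont_def)
    moreover have "F \<midarrow>0\<rightarrow> \<sigma> * d"
    proof (rule Lim_transform_eventually[OF tendsto_const])
      have "\<sigma> * d = F t" if "t \<noteq> 0" for t
      proof -
        have "t\<^sup>2 * (\<sigma> * d) = t\<^sup>2 * F t"
          using AB(4)[of t "\<sigma> * t"] \<open>\<sigma>\<^sup>2 = 1\<close>
          by (simp add: F_def power_mult_distrib distrib_left) (simp add: power2_eq_square algebra_simps)
        then show ?thesis using that by simp
      qed
      then show "\<forall>\<^sub>F t in at 0. \<sigma> * d = F t" by (simp add: eventually_at_filter)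
    qed
    ultimately have "F 0 = \<sigma> * d" by (rule LIM_unique)
    then show ?thesis by (simp add: F_def)
  qed
  from eq[of 1] eq[of "- 1"] show ?thesis by simp
qed

section \<open>Two limit diagrams of Weil algebras\<close>

text \<open>Two arrows into a common vertex, for fibre products.\<close>

definition pair_shape :: shape where
  "pair_shape = \<lparr>verts = {0, 1, 2}, arrs = {0, 1}, src = (\<lambda>a. a), tgt = (\<lambda>_. 2)\<rparr>"

definition equalizer_shape :: shape where
  "equalizer_shape = \<lparr>verts = {0, 1}, arrs = {0, 1}, src = (\<lambda>_. 0), tgt = (\<lambda>_. 1)\<rparr>"

lemma pair_shape_simps [simp]:
  "verts pair_shape = {0, 1, 2}" "arrs pair_shape = {0, 1}" "src pair_shape a = a" "tgt pair_shape a = 2"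
  by (simp_all add: pair_shape_def)

lemma equalizer_shape_simps [simp]:
  "verts equalizer_shape = {0, 1}" "arrs equalizer_shape = {0, 1}" "src equalizer_shape a = 0"
  "tgt equalizer_shape a = 1"
  by (simp_all add: equalizer_shape_def)

lemma finite_pair_shape: "finite_shape pair_shape" and finite_equalizer_shape: "finite_shape equalizer_shape"
  by (simp_all add: finite_shape_def)

lemma connected_pair_shape: "connected_shape pair_shape"
proof -
  let ?r = "(\<Union>a \<in> arrs pair_shape. {(src pair_shape a, tgt pair_shape a), (tgt pair_shape a, src pair_shape a)})"
  have r: "(v, 2) \<in> ?r\<^sup>*" "(2, v) \<in> ?r\<^sup>*" if "v \<in> verts pair_shape" for v
    using that by (auto intro: r_into_rtrancl)
  show ?thesis unfolding connected_shape_def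
    using rtrancl_trans[OF r(1) r(2)] by (intro conjI ballI) simp_all
qed

lemma connected_equalizer_shape: "connected_shape equalizer_shape"
  by (auto simp: connected_shape_def intro: r_into_rtrancl)

text \<open>\<open>W_D2\<close> is the fibre product of two copies of \<open>W_D\<close> over the reals. The base is represented by
  \<open>W_D\<close> with the map induced by \<open>t \<mapsto> 0\<close>, whose image is the reals. Two jets \<open>F0\<close> and \<open>F1\<close> with
  the same value are glued to \<open>F0 x + F1 y - F1 0\<close>.\<close>

lemma weil_limit_pair:
  assumes z: "weil_induced W_D W_D z (scaling 0)"
    and p: "weil_induced W_D2 W_D p0 (line 1 0)" "weil_induced W_D2 W_D p1 (line 0 1)"
      "weil_induced W_D2 W_D p2 (line 0 0)"
  shows "weil_limit pair_shape (\<lambda>_. W_D) (\<lambda>_. z) W_D2 (\<lambda>v. if v = 0 then p0 else if v = 1 then p1 else p2)"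
    (is "weil_limit _ _ _ _ ?p")
proof (rule weil_limitI[OF _ finite_pair_shape])
  have z_eq: "z (wclass W_D (fn1 F)) = wclass W_D (fn1 (\<lambda>t. F (0 * t)))" if "smooth_real F" for F
    using weil_inducedD(2)[OF z, of "fn1 F"] that by (simp only: wdim_simps fn1_Cinf compose_scaling)
  have p_eq: "p0 (wclass W_D2 (fn2 H)) = wclass W_D (fn1 (\<lambda>t. H (1 * t) (0 * t)))"
    "p1 (wclass W_D2 (fn2 H)) = wclass W_D (fn1 (\<lambda>t. H (0 * t) (1 * t)))"
    "p2 (wclass W_D2 (fn2 H)) = wclass W_D (fn1 (\<lambda>t. H (0 * t) (0 * t)))" if "smooth2 H" for H
    using weil_inducedD(2)[OF p(1), of "fn2 H"] weil_inducedD(2)[OF p(2), of "fn2 H"]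
      weil_inducedD(2)[OF p(3), of "fn2 H"] that
    by (simp_all only: wdim_simps fn2_Cinf compose_line)
  show "weil_cone pair_shape (\<lambda>_. W_D) (\<lambda>_. z) W_D2 ?p"
  proof -
    have "compose (carrier (walg W_D2)) z q = p2"
      if q: "q = p0 \<or> q = p1" for q
    proof (rule extensionalityI[of _ "carrier (walg W_D2)"])
      show "p2 \<in> extensional (carrier (walg W_D2))"
        using weil_inducedD(1)[OF p(3)] by (auto simp: weil_hom_def PiE_def)
      fix u assume u: "u \<in> carrier (walg W_D2)"
      obtain H where H: "smooth2 H" "u = wclass W_D2 (fn2 H)"
        by (rule carrier_walg_plane[OF ideal_W_D2 wdim_simps(2) u], rule that)
      show "compose (carrier (walg W_D2)) z q u = p2 u"
        using q u smooth2_fix[OF H(1)] by (auto simp: compose_eq H(2) p_eq[OF H(1)] z_eq)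
    qed simp
    then show ?thesis
      using weil_algebra_W_D2 weil_inducedD(1)[OF p(1)] weil_inducedD(1)[OF p(2)] weil_inducedD(1)[OF p(3)]
      by (simp add: weil_cone_def)
  qed
  fix e assume e: "\<And>v. v \<in> verts pair_shape \<Longrightarrow> e v \<in> carrier (walg W_D)"
    and comm: "\<And>a. a \<in> arrs pair_shape \<Longrightarrow> z (e (src pair_shape a)) = e (tgt pair_shape a)"
  have e': "e 0 \<in> carrier (walg W_D)" "e 1 \<in> carrier (walg W_D)" using e by simp_all
  have comm': "z (e 0) = e 2" "z (e 1) = e 2" using comm[of 0] comm[of 1] by simp_all
  obtain F0 where F0: "smooth_real F0" "e 0 = wclass W_D (fn1 F0)"
    by (rule carrier_walg_W_D[OF e'(1)], rule that)
  obtain F1 where F1: "smooth_real F1" "e 1 = wclass W_D (fn1 F1)"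
    by (rule carrier_walg_W_D[OF e'(2)], rule that)
  have "z (e 0) = z (e 1)" using comm' by simp
  then have base: "F0 0 = F1 0"
    by (simp add: F0(2) F1(2) z_eq[OF F0(1)] z_eq[OF F1(1)] wclass_W_D_eq_iff smooth_real_const)
  define H where "H x y = F0 x + F1 y - F1 0" for x y
  have H: "smooth2 H" unfolding H_def
    by (intro smooth2_intros(3,4,5) smooth2_real[OF F0(1)] smooth2_real[OF F1(1)] smooth2_intros(1,2))
  show "\<exists>!l. l \<in> carrier (walg W_D2) \<and> (\<forall>v\<in>verts pair_shape. ?p v l = e v)"
  proof (rule ex1I[of _ "wclass W_D2 (fn2 H)"])
    have "p0 (wclass W_D2 (fn2 H)) = e 0" by (simp add: p_eq[OF H] F0(2) H_def)
    moreover have "p1 (wclass W_D2 (fn2 H)) = e 1" by (simp add: p_eq[OF H] F1(2) H_def base)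
    moreover have "p2 (wclass W_D2 (fn2 H)) = e 2"
      using comm'(1) by (simp add: p_eq[OF H] H_def F0(2) z_eq[OF F0(1)])
    moreover have "fn2 H \<in> carrier (Cinf (wdim W_D2))" using H by (simp add: fn2_Cinf)
    ultimately show "wclass W_D2 (fn2 H) \<in> carrier (walg W_D2) \<and>
        (\<forall>v\<in>verts pair_shape. ?p v (wclass W_D2 (fn2 H)) = e v)"
      by (simp add: wclass_closed[OF ideal_W_D2])
    fix l assume l: "l \<in> carrier (walg W_D2) \<and> (\<forall>v\<in>verts pair_shape. ?p v l = e v)"
    obtain G where G: "smooth2 G" "l = wclass W_D2 (fn2 G)"
      by (rule carrier_walg_plane[OF ideal_W_D2 wdim_simps(2) conjunct1[OF l]], rule that)
    have l01: "p0 l = e 0" "p1 l = e 1" using l by simp_all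
    note sm = smooth2_fix[OF G(1)] smooth2_fix[OF H]
    have "p0 (wclass W_D2 (fn2 G)) = p0 (wclass W_D2 (fn2 H))"
      using l01(1) \<open>p0 (wclass W_D2 (fn2 H)) = e 0\<close> G(2) by simp
    then have d0: "G 0 0 = H 0 0" "deriv (\<lambda>t. G t 0) 0 = deriv (\<lambda>t. H t 0) 0"
      using sm by (simp_all add: p_eq[OF H] p_eq[OF G(1)] wclass_W_D_eq_iff)
    have "p1 (wclass W_D2 (fn2 G)) = p1 (wclass W_D2 (fn2 H))"
      using l01(2) \<open>p1 (wclass W_D2 (fn2 H)) = e 1\<close> G(2) by simp
    then have d1: "deriv (G 0) 0 = deriv (H 0) 0"
      using sm by (simp add: p_eq[OF H] p_eq[OF G(1)] wclass_W_D_eq_iff)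
    have "deriv (\<lambda>t. G t 0 - H t 0) 0 = deriv (\<lambda>t. G t 0) 0 - deriv (\<lambda>t. H t 0) 0"
      by (intro DERIV_imp_deriv DERIV_diff smooth_real_has_derivative sm)
    moreover have "deriv (\<lambda>t. G 0 t - H 0 t) 0 = deriv (G 0) 0 - deriv (H 0) 0"
      by (intro DERIV_imp_deriv DERIV_diff smooth_real_has_derivative sm)
    ultimately have "fn2 (\<lambda>x y. G x y - H x y) \<in> wideal W_D2"
      unfolding W_D2_mem_iff[OF smooth2_intros(5)[OF G(1) H]] using d0 d1 by simp
    then show "l = wclass W_D2 (fn2 H)"
      unfolding G(2) wclass_plane_eq_iff[OF ideal_W_D2 wdim_simps(2) G(1) H] .
  qed
qed (auto simp: weil_algebra_W_D vanish_W_D[simplified])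

text \<open>The subalgebra of \<open>W_D \<otimes> W_D\<close>, with basis \<open>1\<close>, \<open>x\<close>, \<open>y\<close>, \<open>x * y\<close>, on which restriction to the
  axis \<open>x = 0\<close> is constant is spanned by \<open>1\<close>, \<open>x\<close> and \<open>x * y\<close>. The blow-down identifies it with
  \<open>W_D2\<close>, with generators \<open>x\<close> and \<open>z = x * y\<close>.\<close>

lemma weil_limit_equalizer:
  assumes d: "weil_induced W_DD W_D d0 (line 0 1)" "weil_induced W_DD W_D d1 (line 0 0)"
    and p: "weil_induced W_D2 W_DD p0 blowdown" "weil_induced W_D2 W_D p1 (line 0 0)"
  shows "weil_limit equalizer_shape (\<lambda>v. if v = 0 then W_DD else W_D) (\<lambda>a. if a = 0 then d0 else d1) W_D2
    (\<lambda>v. if v = 0 then p0 else p1)" (is "weil_limit _ ?D ?d _ ?p")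
proof (rule weil_limitI[OF _ finite_equalizer_shape])
  have d_eq: "d0 (wclass W_DD (fn2 H)) = wclass W_D (fn1 (\<lambda>t. H (0 * t) (1 * t)))"
    "d1 (wclass W_DD (fn2 H)) = wclass W_D (fn1 (\<lambda>t. H (0 * t) (0 * t)))" if "smooth2 H" for H
    using weil_inducedD(2)[OF d(1), of "fn2 H"] weil_inducedD(2)[OF d(2), of "fn2 H"] that
    by (simp_all only: wdim_simps fn2_Cinf compose_line)
  have p_eq: "p0 (wclass W_D2 (fn2 H)) = wclass W_DD (fn2 (\<lambda>x y. H x (x * y)))"
    "p1 (wclass W_D2 (fn2 H)) = wclass W_D (fn1 (\<lambda>t. H (0 * t) (0 * t)))" if "smooth2 H" for H
    using weil_inducedD(2)[OF p(1), of "fn2 H"] weil_inducedD(2)[OF p(2), of "fn2 H"] that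
    by (simp_all only: wdim_simps fn2_Cinf compose_line compose_blowdown)
  have pull: "smooth2 (\<lambda>x y. S x (x * y))" if "smooth2 S" for S
    by (rule smooth2_compose[OF that smooth2_intros(1) smooth2_monomials(3)])
  show "weil_cone equalizer_shape ?D ?d W_D2 ?p"
  proof -
    have "compose (carrier (walg W_D2)) q p0 = p1" if q: "q = d0 \<or> q = d1" for q
    proof (rule extensionalityI[of _ "carrier (walg W_D2)"])
      show "p1 \<in> extensional (carrier (walg W_D2))"
        using weil_inducedD(1)[OF p(2)] by (auto simp: weil_hom_def PiE_def)
      fix u assume u: "u \<in> carrier (walg W_D2)"
      obtain H where H: "smooth2 H" "u = wclass W_D2 (fn2 H)"
        by (rule carrier_walg_plane[OF ideal_W_D2 wdim_simps(2) u], rule that)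
      show "compose (carrier (walg W_D2)) q p0 u = p1 u"
        using q u by (auto simp: compose_eq H(2) p_eq[OF H(1)] d_eq[OF pull[OF H(1)]])
    qed simp
    then show ?thesis
      using weil_algebra_W_D2 weil_inducedD(1)[OF p(1)] weil_inducedD(1)[OF p(2)]
      by (simp add: weil_cone_def)
  qed
  fix e assume e: "\<And>v. v \<in> verts equalizer_shape \<Longrightarrow> e v \<in> carrier (walg (?D v))"
    and comm: "\<And>a. a \<in> arrs equalizer_shape \<Longrightarrow> ?d a (e (src equalizer_shape a)) = e (tgt equalizer_shape a)"
  have e0: "e 0 \<in> carrier (walg W_DD)" using e[of 0] by simp
  have comm': "d0 (e 0) = e 1" "d1 (e 0) = e 1" using comm[of 0] comm[of 1] by simp_all
  obtain K where K: "smooth2 K" "e 0 = wclass W_DD (fn2 K)"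
    by (rule carrier_walg_plane[OF ideal_W_DD wdim_simps(3) e0], rule that)
  have "d0 (e 0) = d1 (e 0)" using comm' by simp
  then have K2: "deriv (K 0) 0 = 0"
    using smooth2_fix[OF K(1)]
    by (simp add: K(2) d_eq[OF K(1)] wclass_W_D_eq_iff smooth_real_const)
  obtain d A B where AB: "smooth2 A" "smooth2 B" "\<And>x y. K x y = K 0 0 + deriv (\<lambda>t. K t 0) 0 * x +
      deriv (K 0) 0 * y + d * (x * y) + x\<^sup>2 * A x y + y\<^sup>2 * B x y"
    by (rule smooth2_Taylor2_coefficients[OF K(1)], rule that)
  define b where "b = deriv (\<lambda>t. K t 0) 0"
  \<comment> \<open>The preimage of \<open>K\<close>: its coefficient of \<open>x * y\<close> becomes the coefficient of the second
    coordinate.\<close>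
  define H where "H x y = K 0 0 + b * x + d * y" for x y
  have H: "smooth2 H" unfolding H_def
    by (intro smooth2_intros(4) smooth2_intros(6)[OF smooth2_intros(3)] smooth2_intros(1,2) smooth2_intros(3)[of "K 0 0"])
  have p0H: "p0 (wclass W_D2 (fn2 H)) = e 0"
    unfolding p_eq(1)[OF H] K(2) wclass_plane_eq_iff[OF ideal_W_DD wdim_simps(3) pull[OF H] K(1)] wideal_W_DD
  proof (rule genideal3I)
    show "smooth2 (\<lambda>x y. 0 - A x y)" "smooth2 (\<lambda>x y. 0 - B x y)" "smooth2 (\<lambda>x y. 0)"
      by (intro smooth2_intros(5) smooth2_intros(3)[of 0] AB)+
    show "H x (x * y) - K x y = x\<^sup>2 * (0 - A x y) + y\<^sup>2 * (0 - B x y) + 0 * 0" for x y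
      using AB(3)[of x y] K2 by (simp add: H_def b_def algebra_simps)
  qed
  show "\<exists>!l. l \<in> carrier (walg W_D2) \<and> (\<forall>v\<in>verts equalizer_shape. ?p v l = e v)"
  proof (rule ex1I[of _ "wclass W_D2 (fn2 H)"])
    have "p1 (wclass W_D2 (fn2 H)) = e 1"
      using comm'(2) by (simp add: p_eq[OF H] K(2) d_eq[OF K(1)] H_def)
    moreover have "fn2 H \<in> carrier (Cinf (wdim W_D2))" using H by (simp add: fn2_Cinf)
    ultimately show "wclass W_D2 (fn2 H) \<in> carrier (walg W_D2) \<and>
        (\<forall>v\<in>verts equalizer_shape. ?p v (wclass W_D2 (fn2 H)) = e v)"
      using p0H by (simp add: wclass_closed[OF ideal_W_D2])
    fix l assume l: "l \<in> carrier (walg W_D2) \<and> (\<forall>v\<in>verts equalizer_shape. ?p v l = e v)"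
    obtain G where G: "smooth2 G" "l = wclass W_D2 (fn2 G)"
      by (rule carrier_walg_plane[OF ideal_W_D2 wdim_simps(2) conjunct1[OF l]], rule that)
    have "p0 l = e 0" using l by simp
    then have "p0 (wclass W_D2 (fn2 G)) = p0 (wclass W_D2 (fn2 H))" using G(2) p0H by simp
    then have DD: "fn2 (\<lambda>x y. G x (x * y) - H x (x * y)) \<in> wideal W_DD"
      unfolding p_eq(1)[OF H] p_eq(1)[OF G(1)] wclass_plane_eq_iff[OF ideal_W_DD wdim_simps(3) pull[OF G(1)] pull[OF H]] .
    define S where "S x y = G x y - H x y" for x y
    have S: "smooth2 S" unfolding S_def by (intro smooth2_intros(5) G(1) H)
    have S_DD: "fn2 (\<lambda>x y. S x (x * y)) \<in> wideal W_DD" using DD by (simp add: S_def)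
    have "compose (carrier_vec 1) (fn2 (\<lambda>x y. S x (x * y))) (line 1 0) \<in> wideal W_D"
      using weil_map_line_DD[of 1 0] S_DD unfolding weil_map_def wdim_simps by blast
    then have "fn1 (\<lambda>t. S (1 * t) (1 * t * (0 * t))) \<in> wideal W_D" by (simp only: compose_line)
    then have S1: "S 0 0 = 0" "deriv (\<lambda>t. S t 0) 0 = 0"
      using W_D_mem_iff[OF smooth2_fix(1)[OF S]] by simp_all
    obtain s P Q where PQ: "smooth2 P" "smooth2 Q" "\<And>x y. S x y = S 0 0 + deriv (\<lambda>t. S t 0) 0 * x +
        deriv (S 0) 0 * y + s * (x * y) + x\<^sup>2 * P x y + y\<^sup>2 * Q x y"
      by (rule smooth2_Taylor2_coefficients[OF S], rule that)
    define r where "r = deriv (S 0) 0"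
    obtain A1 B1 C1 where ABC1: "smooth2 A1" "smooth2 B1" "smooth2 C1"
      "\<And>x y. S x (x * y) = x\<^sup>2 * A1 x y + y\<^sup>2 * B1 x y + 0 * C1 x y"
      by (rule genideal3E[OF S_DD[unfolded wideal_W_DD]], rule that)
    have "fn2 (\<lambda>x y. r * (x * y)) \<in> wideal W_DD"
      unfolding wideal_W_DD
    proof (rule genideal3I)
      show "smooth2 (\<lambda>x y. A1 x y - (s * y + P x (x * y) + y * y * Q x (x * y)))" "smooth2 B1" "smooth2 (\<lambda>x y. 0)"
        by (intro smooth2_intros(4,5,6) smooth2_intros(2) smooth2_intros(3)[of s] smooth2_intros(3)[of 0] pull ABC1 PQ)+
      fix x y
      have "S x (x * y) = r * (x * y) + s * (x * (x * y)) + x\<^sup>2 * P x (x * y) + (x * y)\<^sup>2 * Q x (x * y)"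
        using PQ(3)[of x "x * y"] S1 by (simp add: r_def)
      then show "r * (x * y) = x\<^sup>2 * (A1 x y - (s * y + P x (x * y) + y * y * Q x (x * y))) +
          y\<^sup>2 * B1 x y + 0 * 0"
        using ABC1(4)[of x y] by (simp add: power2_eq_square algebra_simps)
    qed
    then have "r = 0" by (rule W_DD_mixed_coefficient)
    then have "fn2 S \<in> wideal W_D2"
      unfolding W_D2_mem_iff[OF S] using S1 by (simp add: r_def)
    then show "l = wclass W_D2 (fn2 H)"
      unfolding G(2) wclass_plane_eq_iff[OF ideal_W_D2 wdim_simps(2) G(1) H] S_def[abs_def] .
  qed
qed (auto simp: weil_algebra_W_D weil_algebra_W_DD vanish_W_D[simplified] vanish_W_DD[simplified])

section \<open>Prolongations\<close>

lemma is_fspace_euclid: "is_fspace (euclid n)"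
  unfolding euclid_def by (rule is_fspace_initial)

lemma is_fspace_prolong: "is_fspace (prolong E \<pi> W)"
  unfolding prolong_def by (rule is_fspace_initial)

lemma points_prolong: "points (prolong E \<pi> W) = prolong_maps E \<pi> (wdim W) // prolong_rel E \<pi> W"
  by (simp add: prolong_def)

lemma function_along_curve:
  assumes "\<theta> \<in> smooth_maps E real_line" "c \<in> curves E"
  shows "smooth_real (\<lambda>t. \<theta> (c t))"
  using smooth_map_curve[OF assms] by (simp add: real_line_def)

lemma funcs_smooth_maps:
  assumes "is_fspace E" "\<theta> \<in> funcs E"
  shows "\<theta> \<in> smooth_maps E real_line"
proof -
  have "\<theta> \<in> {\<theta> \<in> points E \<rightarrow>\<^sub>E UNIV. \<forall>c \<in> curves E. smooth_real (\<theta> \<circ> c)}"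
    using assms unfolding is_fspace_def by blast
  then show ?thesis by (simp add: smooth_maps_def real_line_def)
qed

lemma curveI_smooth_maps:
  assumes "is_fspace E" "\<And>t. c t \<in> points E"
    "\<And>\<theta>. \<theta> \<in> smooth_maps E real_line \<Longrightarrow> smooth_real (\<lambda>t. \<theta> (c t))"
  shows "c \<in> curves E"
  using assms funcs_smooth_maps[OF assms(1)] by (intro is_fspace_curveI) (auto simp: comp_def)

lemma smooth_maps_real_lineI:
  assumes "\<And>c. c \<in> curves E \<Longrightarrow> smooth_real (\<lambda>t. f (c t))" "is_fspace E"
  shows "(\<lambda>x\<in>points E. f x) \<in> smooth_maps E real_line"
proof -
  have "(\<lambda>x\<in>points E. f x) \<circ> c = (\<lambda>t. f (c t))" if "c \<in> curves E" for c
    using is_fspaceD(1)[OF assms(2) that] by (auto simp: fun_eq_iff)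
  then show ?thesis using assms(1) by (auto simp: smooth_maps_def real_line_def)
qed

context
  fixes E :: "'e fspace" and \<pi> :: "'e \<Rightarrow> 'm" and W :: presentation
  assumes W: "ideal (wideal W) (Cinf (wdim W))"
begin

lemma prolong_maps_function:
  assumes "f \<in> prolong_maps E \<pi> (wdim W)" "\<theta> \<in> smooth_maps E real_line"
  shows "compose (carrier_vec (wdim W)) \<theta> f \<in> carrier (Cinf (wdim W))"
  unfolding compose_def
proof (rule restrict_mem_Cinf)
  fix c assume "c \<in> curves (euclid (wdim W))"
  then have "(\<lambda>t. f (c t)) \<in> curves E"
    using assms(1) by (intro smooth_map_curve[of f "euclid (wdim W)"]) (auto simp: prolong_maps_def)
  with assms(2) show "smooth_real (\<lambda>t. \<theta> (f (c t)))" by (rule function_along_curve)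
qed

lemma prolong_rel_iff:
  "(f, g) \<in> prolong_rel E \<pi> W \<longleftrightarrow>
     f \<in> prolong_maps E \<pi> (wdim W) \<and> g \<in> prolong_maps E \<pi> (wdim W) \<and>
     f (0\<^sub>v (wdim W)) = g (0\<^sub>v (wdim W)) \<and>
     (\<forall>\<theta> \<in> smooth_maps E real_line. (\<lambda>x \<in> carrier_vec (wdim W). \<theta> (f x) - \<theta> (g x)) \<in> wideal W)"
  by (simp add: prolong_rel_def)

lemma equiv_prolong_rel: "equiv (prolong_maps E \<pi> (wdim W)) (prolong_rel E \<pi> W)"
proof (rule equivI)
  show "prolong_rel E \<pi> W \<subseteq> prolong_maps E \<pi> (wdim W) \<times> prolong_maps E \<pi> (wdim W)"
    by (auto simp: prolong_rel_def)
  show "refl_on (prolong_maps E \<pi> (wdim W)) (prolong_rel E \<pi> W)"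
    using wideal_zero[OF W] by (auto simp: refl_on_def prolong_rel_iff)
  show "sym (prolong_rel E \<pi> W)"
  proof (rule symI)
    fix f g assume fg: "(f, g) \<in> prolong_rel E \<pi> W"
    have "(\<lambda>x \<in> carrier_vec (wdim W). \<theta> (g x) - \<theta> (f x)) \<in> wideal W"
      if "\<theta> \<in> smooth_maps E real_line" for \<theta>
    proof -
      have "(\<lambda>x \<in> carrier_vec (wdim W). \<theta> (f x) - \<theta> (g x)) \<in> wideal W"
        using fg that by (simp add: prolong_rel_iff)
      from wideal_diff(1)[OF W wideal_zero[OF W] this] show ?thesis by (simp cong: restrict_cong)
    qed
    then show "(g, f) \<in> prolong_rel E \<pi> W" using fg by (simp add: prolong_rel_iff)
  qed
  show "trans (prolong_rel E \<pi> W)"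
  proof (rule transI)
    fix f g h assume fg: "(f, g) \<in> prolong_rel E \<pi> W" and gh: "(g, h) \<in> prolong_rel E \<pi> W"
    have "(\<lambda>x \<in> carrier_vec (wdim W). \<theta> (f x) - \<theta> (h x)) \<in> wideal W"
      if "\<theta> \<in> smooth_maps E real_line" for \<theta>
    proof -
      have "(\<lambda>x \<in> carrier_vec (wdim W). \<theta> (f x) - \<theta> (g x)) \<in> wideal W"
        "(\<lambda>x \<in> carrier_vec (wdim W). \<theta> (g x) - \<theta> (h x)) \<in> wideal W"
        using fg gh that by (simp_all add: prolong_rel_iff)
      from wideal_diff(2)[OF W this] show ?thesis by (simp cong: restrict_cong)
    qed
    then show "(f, h) \<in> prolong_rel E \<pi> W" using fg gh by (simp add: prolong_rel_iff)
  qed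
qed

lemma prolong_class_eq_iff:
  assumes "f \<in> prolong_maps E \<pi> (wdim W)" "g \<in> prolong_maps E \<pi> (wdim W)"
  shows "prolong_class E \<pi> W f = prolong_class E \<pi> W g \<longleftrightarrow> (f, g) \<in> prolong_rel E \<pi> W"
  unfolding prolong_class_def by (rule eq_equiv_class_iff[OF equiv_prolong_rel assms])

lemma prolong_class_self: "f \<in> prolong_maps E \<pi> (wdim W) \<Longrightarrow> f \<in> prolong_class E \<pi> W f"
  unfolding prolong_class_def by (rule equiv_class_self[OF equiv_prolong_rel])

lemma mem_prolong_class: "g \<in> prolong_class E \<pi> W f \<longleftrightarrow> (f, g) \<in> prolong_rel E \<pi> W"
  by (simp add: prolong_class_def)

lemma prolong_class_point: "f \<in> prolong_maps E \<pi> (wdim W) \<Longrightarrow> prolong_class E \<pi> W f \<in> points (prolong E \<pi> W)"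
  unfolding points_prolong prolong_class_def by (rule quotientI)

lemma prolong_pointE:
  assumes "u \<in> points (prolong E \<pi> W)"
  obtains f where "f \<in> prolong_maps E \<pi> (wdim W)" "u = prolong_class E \<pi> W f"
  using assms unfolding points_prolong prolong_class_def by (rule quotientE)

lemma prolong_eval_class:
  assumes f: "f \<in> prolong_maps E \<pi> (wdim W)" and \<theta>: "\<theta> \<in> smooth_maps E real_line"
  shows "prolong_eval W \<theta> (prolong_class E \<pi> W f) = wclass W (compose (carrier_vec (wdim W)) \<theta> f)"
  unfolding prolong_eval_def
proof (rule the_equality)
  show "\<exists>g \<in> prolong_class E \<pi> W f. wclass W (compose (carrier_vec (wdim W)) \<theta> f) =
      wclass W (compose (carrier_vec (wdim W)) \<theta> g)"
    by (rule bexI[OF refl prolong_class_self[OF f]])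
  fix w assume "\<exists>g \<in> prolong_class E \<pi> W f. w = wclass W (compose (carrier_vec (wdim W)) \<theta> g)"
  then obtain g where g: "(f, g) \<in> prolong_rel E \<pi> W" "w = wclass W (compose (carrier_vec (wdim W)) \<theta> g)"
    by (auto simp: mem_prolong_class)
  then have gm: "g \<in> prolong_maps E \<pi> (wdim W)"
    and mem: "(\<lambda>x \<in> carrier_vec (wdim W). \<theta> (f x) - \<theta> (g x)) \<in> wideal W"
    using \<theta> by (auto simp: prolong_rel_iff)
  have "(\<lambda>x \<in> carrier_vec (wdim W). compose (carrier_vec (wdim W)) \<theta> f x - compose (carrier_vec (wdim W)) \<theta> g x) =
      (\<lambda>x \<in> carrier_vec (wdim W). \<theta> (f x) - \<theta> (g x))"
    by (simp add: compose_def cong: restrict_cong)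
  with mem have "wclass W (compose (carrier_vec (wdim W)) \<theta> f) = wclass W (compose (carrier_vec (wdim W)) \<theta> g)"
    unfolding wclass_eq_iff[OF W prolong_maps_function[OF f \<theta>] prolong_maps_function[OF gm \<theta>]] by (simp only:)
  then show "w = wclass W (compose (carrier_vec (wdim W)) \<theta> f)" using g(2) by simp
qed

lemma prolong_eval_closed:
  assumes "u \<in> points (prolong E \<pi> W)" "\<theta> \<in> smooth_maps E real_line"
  shows "prolong_eval W \<theta> u \<in> carrier (walg W)"
proof -
  obtain f where f: "f \<in> prolong_maps E \<pi> (wdim W)" "u = prolong_class E \<pi> W f"
    by (rule prolong_pointE[OF assms(1)], rule that)
  show ?thesis unfolding f(2) prolong_eval_class[OF f(1) assms(2)]
    by (rule wclass_closed[OF W prolong_maps_function[OF f(1) assms(2)]])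
qed

text \<open>The curves of the prolongation may be tested with linear functionals on the algebra, since
  these define its standard structure.\<close>

lemma curves_prolong:
  "c \<in> curves (prolong E \<pi> W) \<longleftrightarrow> (\<forall>s. c s \<in> points (prolong E \<pi> W)) \<and>
     (\<forall>\<theta>\<in>smooth_maps E real_line. \<forall>l\<in>weil_dual W. smooth_real (\<lambda>s. l (prolong_eval W \<theta> (c s))))"
proof -
  have curves: "c \<in> curves (prolong E \<pi> W) \<longleftrightarrow> (\<forall>s. c s \<in> points (prolong E \<pi> W)) \<and>
     (\<forall>\<theta>\<in>smooth_maps E real_line. \<forall>l\<in>funcs (weil_fspace W). smooth_real (\<lambda>s. l (prolong_eval W \<theta> (c s))))"
  proof -
    have "(\<forall>\<phi>\<in>{\<psi> \<circ> prolong_eval W \<theta> |\<psi> \<theta>. \<psi> \<in> A \<and> \<theta> \<in> B}. smooth_real (\<lambda>s. \<phi> (c s))) \<longleftrightarrow>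
        (\<forall>\<theta>\<in>B. \<forall>l\<in>A. smooth_real (\<lambda>s. l (prolong_eval W \<theta> (c s))))" for A and B :: "('e \<Rightarrow> real) set"
    proof
      assume *: "\<forall>\<phi>\<in>{\<psi> \<circ> prolong_eval W \<theta> |\<psi> \<theta>. \<psi> \<in> A \<and> \<theta> \<in> B}. smooth_real (\<lambda>s. \<phi> (c s))"
      show "\<forall>\<theta>\<in>B. \<forall>l\<in>A. smooth_real (\<lambda>s. l (prolong_eval W \<theta> (c s)))"
      proof (intro ballI)
        fix \<theta> l assume "\<theta> \<in> B" "l \<in> A"
        then have "l \<circ> prolong_eval W \<theta> \<in> {\<psi> \<circ> prolong_eval W \<theta> |\<psi> \<theta>. \<psi> \<in> A \<and> \<theta> \<in> B}" by blast
        from bspec[OF * this] show "smooth_real (\<lambda>s. l (prolong_eval W \<theta> (c s)))" by simp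
      qed
    qed auto
    then show ?thesis unfolding prolong_def curves_initial points_initial by simp
  qed
  have dual: "l \<in> funcs (weil_fspace W)" if "l \<in> weil_dual W" for l
    using that by (auto simp: weil_fspace_def initial_fspace_def Let_def weil_dual_def comp_def)
  show ?thesis
  proof
    assume "c \<in> curves (prolong E \<pi> W)"
    then show "(\<forall>s. c s \<in> points (prolong E \<pi> W)) \<and>
     (\<forall>\<theta>\<in>smooth_maps E real_line. \<forall>l\<in>weil_dual W. smooth_real (\<lambda>s. l (prolong_eval W \<theta> (c s))))"
      unfolding curves using dual by blast
  next
    assume c: "(\<forall>s. c s \<in> points (prolong E \<pi> W)) \<and>
     (\<forall>\<theta>\<in>smooth_maps E real_line. \<forall>l\<in>weil_dual W. smooth_real (\<lambda>s. l (prolong_eval W \<theta> (c s))))"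
    have "smooth_real (\<lambda>s. l (prolong_eval W \<theta> (c s)))"
      if "\<theta> \<in> smooth_maps E real_line" "l \<in> funcs (weil_fspace W)" for \<theta> l
    proof -
      have "(\<lambda>s. prolong_eval W \<theta> (c s)) \<in> curves (weil_fspace W)"
        unfolding weil_fspace_def curves_initial using c that(1) prolong_eval_closed by blast
      from is_fspaceD(2)[OF _ this that(2)] show ?thesis
        by (simp add: weil_fspace_def is_fspace_initial comp_def)
    qed
    then show "c \<in> curves (prolong E \<pi> W)" unfolding curves using c by blast
  qed
qed

end

section \<open>First-order prolongations\<close>

lemma fn1_prolong_maps_iff:
  assumes "is_fspace E"
  shows "fn1 F \<in> prolong_maps E \<pi> 1 \<longleftrightarrow> F \<in> curves E \<and> (\<forall>t. \<pi> (F t) = \<pi> (F 0))"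
proof -
  have "fn1 F \<in> smooth_maps (euclid 1) E \<longleftrightarrow> F \<in> curves E"
  proof
    assume "fn1 F \<in> smooth_maps (euclid 1) E"
    then have "(\<lambda>t. F (id t)) \<in> curves E" unfolding fn1_smooth_iff using smooth_real_id by blast
    then show "F \<in> curves E" by simp
  next
    assume F: "F \<in> curves E"
    show "fn1 F \<in> smooth_maps (euclid 1) E"
      unfolding fn1_smooth_iff
      using is_fspaceD(1)[OF assms F] curve_reparametrize[OF assms F] by (auto simp: comp_def)
  qed
  moreover have "(\<forall>x\<in>carrier_vec 1. \<pi> (fn1 F x) = \<pi> (fn1 F (0\<^sub>v 1))) \<longleftrightarrow> (\<forall>t. \<pi> (F t) = \<pi> (F 0))"
  proof
    assume *: "\<forall>x\<in>carrier_vec 1. \<pi> (fn1 F x) = \<pi> (fn1 F (0\<^sub>v 1))"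
    show "\<forall>t. \<pi> (F t) = \<pi> (F 0)" using bspec[OF * vec1_simps(2)] by simp
  qed (simp add: fn1_def)
  ultimately show ?thesis by (simp add: prolong_maps_def)
qed

lemma prolong_W_D_pointE:
  assumes "is_fspace E" "u \<in> points (prolong E \<pi> W_D)"
  obtains F where "F \<in> curves E" "\<forall>t. \<pi> (F t) = \<pi> (F 0)" "u = prolong_class E \<pi> W_D (fn1 F)"
proof -
  obtain f where f: "f \<in> prolong_maps E \<pi> (wdim W_D)" "u = prolong_class E \<pi> W_D f"
    by (rule prolong_pointE[OF ideal_W_D assms(2)], rule that)
  have "f = fn1 (\<lambda>t. f (vec1 t))"
    using f(1) by (intro fn1_surj) (auto simp: prolong_maps_def smooth_maps_def PiE_def)
  moreover from this f(1) have "fn1 (\<lambda>t. f (vec1 t)) \<in> prolong_maps E \<pi> 1" by (simp only: wdim_simps)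
  ultimately show thesis
    using f(2) unfolding fn1_prolong_maps_iff[OF assms(1)]
    by (intro that[of "\<lambda>t. f (vec1 t)"]) simp_all
qed

text \<open>Congruence modulo the ideal of \<open>W_D\<close> is equality of first-order jets, tested with smooth
  functions.\<close>

lemma W_D_class_eq_iff:
  assumes E: "is_fspace E"
    and F: "F \<in> curves E" "\<forall>t. \<pi> (F t) = \<pi> (F 0)" and G: "G \<in> curves E" "\<forall>t. \<pi> (G t) = \<pi> (G 0)"
  shows "prolong_class E \<pi> W_D (fn1 F) = prolong_class E \<pi> W_D (fn1 G) \<longleftrightarrow>
    F 0 = G 0 \<and> (\<forall>\<theta>\<in>smooth_maps E real_line. deriv (\<lambda>t. \<theta> (F t)) 0 = deriv (\<lambda>t. \<theta> (G t)) 0)"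
proof -
  have maps: "fn1 F \<in> prolong_maps E \<pi> 1" "fn1 G \<in> prolong_maps E \<pi> 1"
    unfolding fn1_prolong_maps_iff[OF E] using F G by simp_all
  have "prolong_class E \<pi> W_D (fn1 F) = prolong_class E \<pi> W_D (fn1 G) \<longleftrightarrow> (fn1 F, fn1 G) \<in> prolong_rel E \<pi> W_D"
    using maps by (intro prolong_class_eq_iff[OF ideal_W_D]) simp_all
  also have "\<dots> \<longleftrightarrow> F 0 = G 0 \<and> (\<forall>\<theta>\<in>smooth_maps E real_line.
      (\<lambda>x \<in> carrier_vec 1. \<theta> (fn1 F x) - \<theta> (fn1 G x)) \<in> wideal W_D)"
    using maps by (simp add: prolong_rel_iff[OF ideal_W_D])
  also have "\<dots> \<longleftrightarrow> F 0 = G 0 \<and> (\<forall>\<theta>\<in>smooth_maps E real_line.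
      deriv (\<lambda>t. \<theta> (F t)) 0 = deriv (\<lambda>t. \<theta> (G t)) 0)"
  proof (intro conj_cong refl ball_cong)
    fix \<theta> assume 0: "F 0 = G 0" and \<theta>: "\<theta> \<in> smooth_maps E real_line"
    note sm = function_along_curve[OF \<theta> F(1)] function_along_curve[OF \<theta> G(1)]
    have "(\<lambda>x \<in> carrier_vec 1. \<theta> (fn1 F x) - \<theta> (fn1 G x)) = fn1 (\<lambda>t. \<theta> (F t) - \<theta> (G t))"
      by (auto simp: fn1_def fun_eq_iff)
    moreover have "deriv (\<lambda>t. \<theta> (F t) - \<theta> (G t)) 0 = deriv (\<lambda>t. \<theta> (F t)) 0 - deriv (\<lambda>t. \<theta> (G t)) 0"
      by (intro DERIV_imp_deriv DERIV_diff smooth_real_has_derivative sm)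
    ultimately show "(\<lambda>x \<in> carrier_vec 1. \<theta> (fn1 F x) - \<theta> (fn1 G x)) \<in> wideal W_D \<longleftrightarrow>
        deriv (\<lambda>t. \<theta> (F t)) 0 = deriv (\<lambda>t. \<theta> (G t)) 0"
      using 0 by (simp add: W_D_mem_iff[OF smooth_real_diff[OF sm]])
  qed
  finally show ?thesis .
qed

text \<open>The value at \<open>0\<close>, and below the derivative at \<open>0\<close> of a function, along any representative; the
  choice of the representative does not matter by \<open>jet_class\<close>.\<close>

definition jet_value :: "(real vec \<Rightarrow> 'e) set \<Rightarrow> 'e" where
  "jet_value u = (SOME f. f \<in> u) (vec1 0)"

definition jet_deriv :: "('e \<Rightarrow> real) \<Rightarrow> (real vec \<Rightarrow> 'e) set \<Rightarrow> real" where
  "jet_deriv \<theta> u = deriv (\<lambda>t. \<theta> ((SOME f. f \<in> u) (vec1 t))) 0"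

lemma jet_class:
  assumes E: "is_fspace E" and F: "F \<in> curves E" "\<forall>t. \<pi> (F t) = \<pi> (F 0)"
  shows "jet_value (prolong_class E \<pi> W_D (fn1 F)) = F 0"
    "\<theta> \<in> smooth_maps E real_line \<Longrightarrow> jet_deriv \<theta> (prolong_class E \<pi> W_D (fn1 F)) = deriv (\<lambda>t. \<theta> (F t)) 0"
proof -
  let ?u = "prolong_class E \<pi> W_D (fn1 F)"
  define f where "f = (SOME f. f \<in> ?u)"
  have maps: "fn1 F \<in> prolong_maps E \<pi> (wdim W_D)"
    using F by (simp add: fn1_prolong_maps_iff[OF E])
  have "f \<in> ?u" unfolding f_def by (rule someI[of "\<lambda>f. f \<in> ?u", OF prolong_class_self[OF ideal_W_D maps]])
  then have rel: "(fn1 F, f) \<in> prolong_rel E \<pi> W_D" by (simp add: mem_prolong_class[OF ideal_W_D])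
  then have fm: "f \<in> prolong_maps E \<pi> (wdim W_D)" by (simp add: prolong_rel_iff[OF ideal_W_D])
  define G where "G t = f (vec1 t)" for t
  have fG: "f = fn1 G"
    unfolding G_def using fm by (intro fn1_surj) (auto simp: prolong_maps_def smooth_maps_def PiE_def)
  have G: "G \<in> curves E" "\<forall>t. \<pi> (G t) = \<pi> (G 0)"
    using fm unfolding fG wdim_simps fn1_prolong_maps_iff[OF E] by simp_all
  have "prolong_class E \<pi> W_D (fn1 F) = prolong_class E \<pi> W_D (fn1 G)"
    using rel unfolding fG prolong_class_eq_iff[OF ideal_W_D maps fm[unfolded fG]] .
  then have eq: "F 0 = G 0" "\<forall>\<theta>\<in>smooth_maps E real_line. deriv (\<lambda>t. \<theta> (F t)) 0 = deriv (\<lambda>t. \<theta> (G t)) 0"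
    unfolding W_D_class_eq_iff[OF E F G] by simp_all
  show "jet_value ?u = F 0" using eq(1) by (simp add: jet_value_def f_def[symmetric] G_def)
  show "jet_deriv \<theta> ?u = deriv (\<lambda>t. \<theta> (F t)) 0" if "\<theta> \<in> smooth_maps E real_line"
    using bspec[OF eq(2) that] by (simp add: jet_deriv_def f_def[symmetric] G_def)
qed

lemma W_D_point_eqI:
  assumes E: "is_fspace E" and u: "u \<in> points (prolong E \<pi> W_D)" and v: "v \<in> points (prolong E \<pi> W_D)"
    and "jet_value u = jet_value v"
    and "\<And>\<theta>. \<theta> \<in> smooth_maps E real_line \<Longrightarrow> jet_deriv \<theta> u = jet_deriv \<theta> v"
  shows "u = v"
proof -
  obtain F where F: "F \<in> curves E" "\<forall>t. \<pi> (F t) = \<pi> (F 0)" "u = prolong_class E \<pi> W_D (fn1 F)"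
    by (rule prolong_W_D_pointE[OF E u], rule that)
  obtain G where G: "G \<in> curves E" "\<forall>t. \<pi> (G t) = \<pi> (G 0)" "v = prolong_class E \<pi> W_D (fn1 G)"
    by (rule prolong_W_D_pointE[OF E v], rule that)
  show ?thesis
    unfolding F(3) G(3) W_D_class_eq_iff[OF E F(1,2) G(1,2)]
    using assms(4,5) unfolding F(3) G(3) by (simp add: jet_class[OF E F(1,2)] jet_class[OF E G(1,2)])
qed

lemma weil_dual_W_D:
  assumes l: "l \<in> weil_dual W_D" and H: "smooth_real H"
  shows "l (wclass W_D (fn1 H)) = H 0 * l (wclass W_D (fn1 (\<lambda>_. 1))) + deriv H 0 * l (wclass W_D (fn1 (\<lambda>t. t)))"
proof -
  have one: "fn1 (\<lambda>_. 1 :: real) \<in> carrier (Cinf (wdim W_D))" by (simp add: fn1_Cinf smooth_real_const)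
  have ident: "fn1 (\<lambda>t. t) \<in> carrier (Cinf (wdim W_D))" by (simp add: fn1_Cinf smooth_real_ident)
  have scal: "wconst W_D a \<otimes>\<^bsub>walg W_D\<^esub> wclass W_D (fn1 F) = wclass W_D (fn1 (\<lambda>t. a * F t))"
    if "fn1 F \<in> carrier (Cinf (wdim W_D))" for a F
    unfolding wconst_def wclass_mult[OF ideal_W_D Cinf_const that] by (simp only: wdim_simps fn1_ops)
  have sm: "smooth_real (\<lambda>t. H 0 * 1)" "smooth_real (\<lambda>t. deriv H 0 * t)"
    by (intro smooth_real_const smooth_real_cmult smooth_real_ident)+
  have c: "fn1 (\<lambda>t. H 0 * 1) \<in> carrier (Cinf (wdim W_D))" "fn1 (\<lambda>t. deriv H 0 * t) \<in> carrier (Cinf (wdim W_D))"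
    using sm by (simp_all only: wdim_simps fn1_Cinf)
  have "((\<lambda>t. H 0 * 1 + deriv H 0 * t) has_real_derivative 0 + deriv H 0) (at 0)"
    by (intro DERIV_add DERIV_const DERIV_cmult_Id)
  then have "deriv (\<lambda>t. H 0 * 1 + deriv H 0 * t) 0 = deriv H 0" by (intro DERIV_imp_deriv) simp
  then have "wclass W_D (fn1 H) = wclass W_D (fn1 (\<lambda>t. H 0 * 1 + deriv H 0 * t))"
    using wclass_W_D_eq_iff[OF H smooth_real_add[OF sm]] by simp
  also have "\<dots> = wclass W_D (fn1 (\<lambda>t. H 0 * 1)) \<oplus>\<^bsub>walg W_D\<^esub> wclass W_D (fn1 (\<lambda>t. deriv H 0 * t))"
    unfolding wclass_add[OF ideal_W_D c] by (simp only: wdim_simps fn1_ops)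
  also have "\<dots> = (wconst W_D (H 0) \<otimes>\<^bsub>walg W_D\<^esub> wclass W_D (fn1 (\<lambda>_. 1))) \<oplus>\<^bsub>walg W_D\<^esub>
      (wconst W_D (deriv H 0) \<otimes>\<^bsub>walg W_D\<^esub> wclass W_D (fn1 (\<lambda>t. t)))"
    by (simp only: scal[OF one] scal[OF ident])
  also have "l \<dots> = l (wconst W_D (H 0) \<otimes>\<^bsub>walg W_D\<^esub> wclass W_D (fn1 (\<lambda>_. 1))) +
      l (wconst W_D (deriv H 0) \<otimes>\<^bsub>walg W_D\<^esub> wclass W_D (fn1 (\<lambda>t. t)))"
  proof -
    have "wconst W_D (H 0) \<otimes>\<^bsub>walg W_D\<^esub> wclass W_D (fn1 (\<lambda>_. 1)) \<in> carrier (walg W_D)"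
      "wconst W_D (deriv H 0) \<otimes>\<^bsub>walg W_D\<^esub> wclass W_D (fn1 (\<lambda>t. t)) \<in> carrier (walg W_D)"
      unfolding scal[OF one] scal[OF ident] by (intro wclass_closed[OF ideal_W_D] c)+
    then show ?thesis using l by (simp add: weil_dual_def)
  qed
  also have "\<dots> = H 0 * l (wclass W_D (fn1 (\<lambda>_. 1))) + deriv H 0 * l (wclass W_D (fn1 (\<lambda>t. t)))"
    using l wclass_closed[OF ideal_W_D one] wclass_closed[OF ideal_W_D ident] by (simp add: weil_dual_def)
  finally show ?thesis .
qed

text \<open>Linear forms on jets are the linear functionals on the two-dimensional algebra \<open>W_D\<close>.\<close>

lemma coefficient_functional:
  assumes J: "\<And>H K. smooth_real H \<Longrightarrow> smooth_real K \<Longrightarrow> H 0 = K 0 \<Longrightarrow> deriv H 0 = deriv K 0 \<Longrightarrow> J H = J K"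
    and add: "\<And>H K. smooth_real H \<Longrightarrow> smooth_real K \<Longrightarrow> J (\<lambda>t. H t + K t) = J H + J K"
    and scal: "\<And>H a. smooth_real H \<Longrightarrow> J (\<lambda>t. a * H t) = a * (J H :: real)"
  obtains l where "l \<in> weil_dual W_D" "\<And>H. smooth_real H \<Longrightarrow> l (wclass W_D (fn1 H)) = J H"
proof -
  define l where "l = (\<lambda>u\<in>carrier (walg W_D). J (SOME H. smooth_real H \<and> u = wclass W_D (fn1 H)))"
  have l: "l (wclass W_D (fn1 H)) = J H" if H: "smooth_real H" for H
  proof -
    define K where "K = (SOME K. smooth_real K \<and> wclass W_D (fn1 H) = wclass W_D (fn1 K))"
    have K: "smooth_real K" "wclass W_D (fn1 H) = wclass W_D (fn1 K)"
      using someI[of "\<lambda>K. smooth_real K \<and> wclass W_D (fn1 H) = wclass W_D (fn1 K)" H] H by (simp_all add: K_def)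
    have "wclass W_D (fn1 H) \<in> carrier (walg W_D)"
      using H by (intro wclass_closed[OF ideal_W_D]) (simp add: fn1_Cinf)
    then have "l (wclass W_D (fn1 H)) = J K" by (simp add: l_def K_def)
    also have "\<dots> = J H" using K(2) unfolding wclass_W_D_eq_iff[OF H K(1)] by (intro J K H) simp_all
    finally show ?thesis .
  qed
  have "l \<in> weil_dual W_D"
    unfolding weil_dual_def
  proof (intro CollectI conjI ballI allI)
    show "l \<in> carrier (walg W_D) \<rightarrow>\<^sub>E UNIV" by (simp add: l_def)
    fix u v assume u: "u \<in> carrier (walg W_D)" and v: "v \<in> carrier (walg W_D)"
    obtain H where H: "smooth_real H" "u = wclass W_D (fn1 H)" by (rule carrier_walg_W_D[OF u], rule that)
    obtain K where K: "smooth_real K" "v = wclass W_D (fn1 K)" by (rule carrier_walg_W_D[OF v], rule that)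
    have c: "fn1 H \<in> carrier (Cinf (wdim W_D))" "fn1 K \<in> carrier (Cinf (wdim W_D))"
      using H(1) K(1) by (simp_all add: fn1_Cinf)
    have "u \<oplus>\<^bsub>walg W_D\<^esub> v = wclass W_D (fn1 (\<lambda>t. H t + K t))"
      unfolding H(2) K(2) wclass_add[OF ideal_W_D c] by (simp only: wdim_simps fn1_ops)
    then show "l (u \<oplus>\<^bsub>walg W_D\<^esub> v) = l u + l v"
      using H K by (simp add: l smooth_real_add add)
    show "l (wconst W_D a \<otimes>\<^bsub>walg W_D\<^esub> u) = a * l u" for a
    proof -
      have "wconst W_D a \<otimes>\<^bsub>walg W_D\<^esub> u = wclass W_D (fn1 (\<lambda>t. a * H t))"
        unfolding H(2) wconst_def wclass_mult[OF ideal_W_D Cinf_const c(1)] by (simp only: wdim_simps fn1_ops)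
      then show ?thesis using H by (simp add: l smooth_real_cmult scal)
    qed
  qed
  then show thesis using l by (rule that)
qed

text \<open>Every linear functional on \<open>W_D\<close> is a combination of the value and the derivative at \<open>0\<close>, and
  these two are functionals themselves.\<close>

lemma curves_prolong_W_D:
  assumes E: "is_fspace E"
  shows "c \<in> curves (prolong E \<pi> W_D) \<longleftrightarrow> (\<forall>s. c s \<in> points (prolong E \<pi> W_D)) \<and>
     (\<forall>\<theta>\<in>smooth_maps E real_line. smooth_real (\<lambda>s. \<theta> (jet_value (c s))) \<and> smooth_real (\<lambda>s. jet_deriv \<theta> (c s)))"
proof (cases "\<forall>s. c s \<in> points (prolong E \<pi> W_D)")
  case True
  have rep: "\<exists>H. smooth_real H \<and> prolong_eval W_D \<theta> (c s) = wclass W_D (fn1 H) \<and>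
      H 0 = \<theta> (jet_value (c s)) \<and> deriv H 0 = jet_deriv \<theta> (c s)"
    if \<theta>: "\<theta> \<in> smooth_maps E real_line" for \<theta> s
  proof -
    have cs: "c s \<in> points (prolong E \<pi> W_D)" using True by simp
    obtain F where F: "F \<in> curves E" "\<forall>t. \<pi> (F t) = \<pi> (F 0)" "c s = prolong_class E \<pi> W_D (fn1 F)"
      by (rule prolong_W_D_pointE[OF E cs], rule that)
    have maps: "fn1 F \<in> prolong_maps E \<pi> (wdim W_D)" using F by (simp add: fn1_prolong_maps_iff[OF E])
    show ?thesis
    proof (intro exI[of _ "\<lambda>t. \<theta> (F t)"] conjI)
      show "smooth_real (\<lambda>t. \<theta> (F t))" by (rule function_along_curve[OF \<theta> F(1)])
      show "prolong_eval W_D \<theta> (c s) = wclass W_D (fn1 (\<lambda>t. \<theta> (F t)))"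
        unfolding F(3) prolong_eval_class[OF ideal_W_D maps \<theta>] by (simp only: wdim_simps compose_fn)
    qed (simp_all add: F(3) jet_class[OF E F(1,2)] \<theta>)
  qed
  have "(\<forall>l\<in>weil_dual W_D. smooth_real (\<lambda>s. l (prolong_eval W_D \<theta> (c s)))) \<longleftrightarrow>
      smooth_real (\<lambda>s. \<theta> (jet_value (c s))) \<and> smooth_real (\<lambda>s. jet_deriv \<theta> (c s))"
    if \<theta>: "\<theta> \<in> smooth_maps E real_line" for \<theta>
  proof
    assume sm: "\<forall>l\<in>weil_dual W_D. smooth_real (\<lambda>s. l (prolong_eval W_D \<theta> (c s)))"
    obtain l0 where l0: "l0 \<in> weil_dual W_D" "\<And>H. smooth_real H \<Longrightarrow> l0 (wclass W_D (fn1 H)) = H 0"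
      by (rule coefficient_functional[of "\<lambda>H. H 0"]) (simp, simp, simp, rule that)
    obtain l1 where l1: "l1 \<in> weil_dual W_D" "\<And>H. smooth_real H \<Longrightarrow> l1 (wclass W_D (fn1 H)) = deriv H 0"
    proof (rule coefficient_functional[of "\<lambda>H. deriv H 0"])
      show "deriv (\<lambda>t. H t + K t) 0 = deriv H 0 + deriv K 0" if "smooth_real H" "smooth_real K" for H K
        using that by (intro DERIV_imp_deriv DERIV_add smooth_real_has_derivative)
      show "deriv (\<lambda>t. a * H t) 0 = a * deriv H 0" if "smooth_real H" for H a
        using that by (intro DERIV_imp_deriv DERIV_cmult smooth_real_has_derivative)
    qed (assumption, rule that)
    have "l0 (prolong_eval W_D \<theta> (c s)) = \<theta> (jet_value (c s))" "l1 (prolong_eval W_D \<theta> (c s)) = jet_deriv \<theta> (c s)" for s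
      using rep[OF \<theta>, of s] l0(2) l1(2) by auto
    then show "smooth_real (\<lambda>s. \<theta> (jet_value (c s))) \<and> smooth_real (\<lambda>s. jet_deriv \<theta> (c s))"
      using bspec[OF sm l0(1)] bspec[OF sm l1(1)] by simp
  next
    assume sm: "smooth_real (\<lambda>s. \<theta> (jet_value (c s))) \<and> smooth_real (\<lambda>s. jet_deriv \<theta> (c s))"
    show "\<forall>l\<in>weil_dual W_D. smooth_real (\<lambda>s. l (prolong_eval W_D \<theta> (c s)))"
    proof
      fix l assume l: "l \<in> weil_dual W_D"
      have "l (prolong_eval W_D \<theta> (c s)) = \<theta> (jet_value (c s)) * l (wclass W_D (fn1 (\<lambda>_. 1))) +
          jet_deriv \<theta> (c s) * l (wclass W_D (fn1 (\<lambda>t. t)))" for s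
        using rep[OF \<theta>, of s] weil_dual_W_D[OF l] by auto
      then show "smooth_real (\<lambda>s. l (prolong_eval W_D \<theta> (c s)))"
        using sm by (simp add: smooth_real_add smooth_real_mult smooth_real_const)
    qed
  qed
  then show ?thesis unfolding curves_prolong[OF ideal_W_D] by blast
next
  case False
  then show ?thesis using is_fspaceD(1)[OF is_fspace_prolong] by blast
qed

section \<open>The action of morphisms of Weil algebras\<close>

lemma weil_induced_weil_map:
  assumes W: "ideal (wideal W) (Cinf (wdim W))" and W': "ideal (wideal W') (Cinf (wdim W'))"
    and \<phi>: "weil_induced W W' \<phi> g"
  shows "weil_map W W' g"
proof -
  have g: "g \<in> smooth_maps (euclid (wdim W')) (euclid (wdim W))" "g (0\<^sub>v (wdim W')) = 0\<^sub>v (wdim W)"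
    using \<phi> by (auto simp: weil_induced_def)
  have gx: "g x \<in> carrier_vec (wdim W)" if "x \<in> carrier_vec (wdim W')" for x
    using smooth_maps_euclid_point[OF g(1) that] by simp
  have "compose (carrier_vec (wdim W')) h g \<in> wideal W'" if "h \<in> wideal W" for h
  proof -
    have h: "h \<in> carrier (Cinf (wdim W))" using that by (rule ideal.Icarr[OF W])
    have "(\<lambda>x\<in>carrier_vec (wdim W). h x - (\<lambda>x\<in>carrier_vec (wdim W). 0) x) = h"
      using Cinf_ext[OF h] by (simp cong: restrict_cong)
    then have "wclass W h = wclass W (\<lambda>x\<in>carrier_vec (wdim W). 0)"
      using that by (intro iffD2[OF wclass_eq_iff[OF W h Cinf_const]]) simp
    then have "wclass W' (compose (carrier_vec (wdim W')) h g) =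
        wclass W' (compose (carrier_vec (wdim W')) (\<lambda>x\<in>carrier_vec (wdim W). 0) g)"
      using weil_inducedD(2)[OF \<phi> h] weil_inducedD(2)[OF \<phi> Cinf_const, of 0] by simp
    then have "(\<lambda>x\<in>carrier_vec (wdim W'). compose (carrier_vec (wdim W')) h g x -
        compose (carrier_vec (wdim W')) (\<lambda>x\<in>carrier_vec (wdim W). 0) g x) \<in> wideal W'"
      by (rule iffD1[OF wclass_eq_iff[OF W' pullback_closed[OF h g(1)] pullback_closed[OF Cinf_const g(1)]]])
    moreover have "(\<lambda>x\<in>carrier_vec (wdim W'). compose (carrier_vec (wdim W')) h g x -
        compose (carrier_vec (wdim W')) (\<lambda>x\<in>carrier_vec (wdim W). 0) g x) = compose (carrier_vec (wdim W')) h g"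
      using gx by (simp add: compose_def cong: restrict_cong)
    ultimately show ?thesis by (simp only:)
  qed
  then show ?thesis using g by (simp add: weil_map_def)
qed

lemma absolute_maps: "prolong_maps M (\<lambda>_. ()) n = smooth_maps (euclid n) M"
  by (simp add: prolong_maps_def)

lemma compose_smooth_map:
  assumes "f \<in> smooth_maps (euclid n) M" "g \<in> smooth_maps (euclid m) (euclid n)"
  shows "compose (carrier_vec m) f g \<in> smooth_maps (euclid m) M"
  using smooth_maps_compose[OF is_fspace_euclid assms(2,1)] by simp

lemma aprolong_along_class:
  assumes W: "ideal (wideal W) (Cinf (wdim W))" and W': "ideal (wideal W') (Cinf (wdim W'))"
    and g: "weil_map W W' g" and f: "f \<in> smooth_maps (euclid (wdim W)) M"
  shows "aprolong_along M W W' g (aclass M W f) = aclass M W' (compose (carrier_vec (wdim W')) f g)"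
proof -
  have gs: "g \<in> smooth_maps (euclid (wdim W')) (euclid (wdim W))" "g (0\<^sub>v (wdim W')) = 0\<^sub>v (wdim W)"
    using g by (auto simp: weil_map_def)
  have gx: "g x \<in> carrier_vec (wdim W)" if "x \<in> carrier_vec (wdim W')" for x
    using smooth_maps_euclid_point[OF gs(1) that] by simp
  have fm: "f \<in> prolong_maps M (\<lambda>_. ()) (wdim W)" using f by (simp add: absolute_maps)
  have "(THE d. \<exists>f \<in> aclass M W f. d = aclass M W' (compose (carrier_vec (wdim W')) f g)) =
      aclass M W' (compose (carrier_vec (wdim W')) f g)"
  proof (rule the_equality)
    show "\<exists>f' \<in> aclass M W f. aclass M W' (compose (carrier_vec (wdim W')) f g) =
        aclass M W' (compose (carrier_vec (wdim W')) f' g)"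
      by (rule bexI[OF refl prolong_class_self[OF W fm]])
    fix d assume "\<exists>f' \<in> aclass M W f. d = aclass M W' (compose (carrier_vec (wdim W')) f' g)"
    then obtain f' where f': "(f, f') \<in> prolong_rel M (\<lambda>_. ()) W" "d = aclass M W' (compose (carrier_vec (wdim W')) f' g)"
      by (auto simp: mem_prolong_class[OF W])
    have f's: "f' \<in> smooth_maps (euclid (wdim W)) M" and f0: "f (0\<^sub>v (wdim W)) = f' (0\<^sub>v (wdim W))"
      and diff: "\<And>\<theta>. \<theta> \<in> smooth_maps M real_line \<Longrightarrow> (\<lambda>x \<in> carrier_vec (wdim W). \<theta> (f x) - \<theta> (f' x)) \<in> wideal W"
      using f'(1) by (auto simp: prolong_rel_iff[OF W] absolute_maps)
    note maps = compose_smooth_map[OF f gs(1)] compose_smooth_map[OF f's gs(1)]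
    have "(compose (carrier_vec (wdim W')) f g, compose (carrier_vec (wdim W')) f' g) \<in> prolong_rel M (\<lambda>_. ()) W'"
      unfolding prolong_rel_iff[OF W'] absolute_maps
    proof (intro conjI maps ballI)
      show "compose (carrier_vec (wdim W')) f g (0\<^sub>v (wdim W')) = compose (carrier_vec (wdim W')) f' g (0\<^sub>v (wdim W'))"
        using f0 gs(2) by (simp add: compose_def)
      fix \<theta> assume "\<theta> \<in> smooth_maps M real_line"
      then have "compose (carrier_vec (wdim W')) (\<lambda>x \<in> carrier_vec (wdim W). \<theta> (f x) - \<theta> (f' x)) g \<in> wideal W'"
        using g diff unfolding weil_map_def by blast
      also have "compose (carrier_vec (wdim W')) (\<lambda>x \<in> carrier_vec (wdim W). \<theta> (f x) - \<theta> (f' x)) g =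
          (\<lambda>x \<in> carrier_vec (wdim W'). \<theta> (compose (carrier_vec (wdim W')) f g x) - \<theta> (compose (carrier_vec (wdim W')) f' g x))"
        using gx by (simp add: compose_def cong: restrict_cong)
      finally show "(\<lambda>x \<in> carrier_vec (wdim W'). \<theta> (compose (carrier_vec (wdim W')) f g x) -
          \<theta> (compose (carrier_vec (wdim W')) f' g x)) \<in> wideal W'" .
    qed
    then have "aclass M W' (compose (carrier_vec (wdim W')) f g) = aclass M W' (compose (carrier_vec (wdim W')) f' g)"
      using maps by (subst prolong_class_eq_iff[OF W']) (simp_all add: absolute_maps)
    then show "d = aclass M W' (compose (carrier_vec (wdim W')) f g)" by (simp only: f'(2))
  qed
  then show ?thesis
    unfolding aprolong_along_def using prolong_class_point[OF W fm] by simp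
qed

text \<open>Any two maps inducing the same homomorphism are congruent on all functions \<open>\<theta> \<circ> f\<close>, so they
  act in the same way on the prolongation.\<close>

lemma aprolong_hom_eq:
  assumes W: "ideal (wideal W) (Cinf (wdim W))" and W': "ideal (wideal W') (Cinf (wdim W'))"
    and \<phi>: "weil_induced W W' \<phi> g" and c: "c \<in> points (aprolong M W)"
  shows "aprolong_hom M W W' \<phi> c = aprolong_along M W W' g c"
proof -
  obtain f where f: "f \<in> smooth_maps (euclid (wdim W)) M" "c = aclass M W f"
    by (rule prolong_pointE[OF W c]) (simp add: absolute_maps)
  have fm: "f \<in> prolong_maps M (\<lambda>_. ()) (wdim W)" using f(1) by (simp add: absolute_maps)
  have eq: "aprolong_along M W W' g' c = aprolong_along M W W' g c" if \<phi>': "weil_induced W W' \<phi> g'" for g'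
  proof -
    note gm = weil_induced_weil_map[OF W W' \<phi>] weil_induced_weil_map[OF W W' \<phi>']
    have gs: "g \<in> smooth_maps (euclid (wdim W')) (euclid (wdim W))" "g (0\<^sub>v (wdim W')) = 0\<^sub>v (wdim W)"
      "g' \<in> smooth_maps (euclid (wdim W')) (euclid (wdim W))" "g' (0\<^sub>v (wdim W')) = 0\<^sub>v (wdim W)"
      using \<phi> \<phi>' by (auto simp: weil_induced_def)
    have gx: "g x \<in> carrier_vec (wdim W)" "g' x \<in> carrier_vec (wdim W)" if "x \<in> carrier_vec (wdim W')" for x
      using smooth_maps_euclid_point[OF gs(1) that] smooth_maps_euclid_point[OF gs(3) that] by simp_all
    note maps = compose_smooth_map[OF f(1) gs(3)] compose_smooth_map[OF f(1) gs(1)]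
    have "(compose (carrier_vec (wdim W')) f g', compose (carrier_vec (wdim W')) f g) \<in> prolong_rel M (\<lambda>_. ()) W'"
      unfolding prolong_rel_iff[OF W'] absolute_maps
    proof (intro conjI maps ballI)
      show "compose (carrier_vec (wdim W')) f g' (0\<^sub>v (wdim W')) = compose (carrier_vec (wdim W')) f g (0\<^sub>v (wdim W'))"
        using gs by (simp add: compose_def)
      fix \<theta> assume \<theta>: "\<theta> \<in> smooth_maps M real_line"
      let ?h = "compose (carrier_vec (wdim W)) \<theta> f"
      have h: "?h \<in> carrier (Cinf (wdim W))" by (rule prolong_maps_function[OF W fm \<theta>])
      have "wclass W' (compose (carrier_vec (wdim W')) ?h g') = wclass W' (compose (carrier_vec (wdim W')) ?h g)"
        using weil_inducedD(2)[OF \<phi> h] weil_inducedD(2)[OF \<phi>' h] by simp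
      then have "(\<lambda>x\<in>carrier_vec (wdim W'). compose (carrier_vec (wdim W')) ?h g' x -
          compose (carrier_vec (wdim W')) ?h g x) \<in> wideal W'"
        by (rule iffD1[OF wclass_eq_iff[OF W' pullback_closed[OF h gs(3)] pullback_closed[OF h gs(1)]]])
      also have "(\<lambda>x\<in>carrier_vec (wdim W'). compose (carrier_vec (wdim W')) ?h g' x -
          compose (carrier_vec (wdim W')) ?h g x) =
          (\<lambda>x \<in> carrier_vec (wdim W'). \<theta> (compose (carrier_vec (wdim W')) f g' x) - \<theta> (compose (carrier_vec (wdim W')) f g x))"
        using gx by (simp add: compose_def cong: restrict_cong)
      finally show "(\<lambda>x \<in> carrier_vec (wdim W'). \<theta> (compose (carrier_vec (wdim W')) f g' x) -
          \<theta> (compose (carrier_vec (wdim W')) f g x)) \<in> wideal W'" .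
    qed
    then show ?thesis
      unfolding f(2) aprolong_along_class[OF W W' gm(1) f(1)] aprolong_along_class[OF W W' gm(2) f(1)]
      using prolong_class_eq_iff[OF W', of _ M "\<lambda>_. ()"] maps by (simp add: absolute_maps)
  qed
  have "(THE d. \<exists>g. weil_induced W W' \<phi> g \<and> d = aprolong_along M W W' g c) = aprolong_along M W W' g c"
  proof (rule the_equality)
    show "\<exists>g'. weil_induced W W' \<phi> g' \<and> aprolong_along M W W' g c = aprolong_along M W W' g' c"
      by (intro exI[of _ g] conjI \<phi> refl)
    fix d assume "\<exists>g'. weil_induced W W' \<phi> g' \<and> d = aprolong_along M W W' g' c"
    then obtain g' where "weil_induced W W' \<phi> g'" "d = aprolong_along M W W' g' c" by (elim exE conjE)
    then show "d = aprolong_along M W W' g c" using eq by (simp only:)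
  qed
  then show ?thesis unfolding aprolong_hom_def using c by simp
qed

text \<open>The points of a limit are the compatible families of points: a point is a constant map from
  the real line, which is one of the test spaces.\<close>

lemma fs_limit_points:
  assumes L: "fs_limit TYPE(real) S D \<delta> L p"
    and D: "\<And>v. v \<in> verts S \<Longrightarrow> is_fspace (D v)"
    and e: "\<And>v. v \<in> verts S \<Longrightarrow> e v \<in> points (D v)"
    and comm: "\<And>a. a \<in> arrs S \<Longrightarrow> \<delta> a (e (src S a)) = e (tgt S a)"
  obtains l where "l \<in> points L" "\<And>v. v \<in> verts S \<Longrightarrow> p v l = e v"
proof -
  have UNIV: "points real_line = UNIV" by (simp add: real_line_def)
  have "fs_cone S D \<delta> real_line (\<lambda>v _. e v)"
    unfolding fs_cone_def
  proof (intro conjI ballI is_fspace_real_line)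
    fix v assume "v \<in> verts S"
    then show "(\<lambda>_. e v) \<in> smooth_maps real_line (D v)"
      by (intro curve_smooth_map const_in_curves D e)
  next
    fix a assume "a \<in> arrs S"
    then show "compose (points real_line) (\<delta> a) (\<lambda>_. e (src S a)) = (\<lambda>_. e (tgt S a))"
      using comm by (simp add: UNIV compose_def restrict_def)
  qed
  then obtain u where u: "u \<in> smooth_maps real_line L"
    "\<forall>v\<in>verts S. compose (points real_line) (p v) u = (\<lambda>_. e v)"
    using L unfolding fs_limit_def by blast
  show thesis
  proof (rule that[of "u 0"])
    show "u 0 \<in> points L" using u(1) by (auto simp: smooth_maps_def UNIV)
    show "p v (u 0) = e v" if "v \<in> verts S" for v
      using fun_cong[OF bspec[OF u(2) that], of 0] by (simp add: UNIV compose_def restrict_def)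
  qed
qed

section \<open>The tangent projection\<close>

text \<open>The chain rule for the line with slope \<open>y\<close>, read off from the Taylor normal form.\<close>

lemma deriv_along_line:
  assumes "smooth2 H"
  shows "deriv (\<lambda>t. H t (t * y)) 0 = deriv (\<lambda>t. H t 0) 0 + y * deriv (H 0) 0"
proof -
  obtain d A B where AB: "smooth2 A" "smooth2 B" "\<And>x y. H x y = H 0 0 + deriv (\<lambda>t. H t 0) 0 * x +
      deriv (H 0) 0 * y + d * (x * y) + x\<^sup>2 * A x y + y\<^sup>2 * B x y"
    by (rule smooth2_Taylor2_coefficients[OF assms], rule that)
  have sm: "smooth_real (\<lambda>t. S t (t * y))" if "smooth2 S" for S
    by (rule smooth2D[OF that smooth_real_ident]) (intro smooth_real_mult smooth_real_ident smooth_real_const)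
  define b c where "b = deriv (\<lambda>t. H t 0) 0" and "c = deriv (H 0) 0"
  have "deriv (\<lambda>t. H t (t * y)) 0 = b + y * c"
  proof (rule deriv_of_Taylor)
    show "smooth_real (\<lambda>t. d * y + A t (t * y) + y\<^sup>2 * B t (t * y))"
      by (intro smooth_real_add smooth_real_const smooth_real_cmult sm AB)
    show "H t (t * y) = H 0 0 + (b + y * c) * t + t\<^sup>2 * (d * y + A t (t * y) + y\<^sup>2 * B t (t * y))" for t
      using AB(3)[of t "t * y"] by (simp add: b_def c_def power2_eq_square algebra_simps)
  qed
  then show ?thesis by (simp only: b_def c_def)
qed

lemma curves_fs_pullback:
  assumes "is_fspace X" "is_fspace Y"
  shows "c \<in> curves (fs_pullback X Y p q) \<longleftrightarrow>
    (\<lambda>t. fst (c t)) \<in> curves X \<and> (\<lambda>t. snd (c t)) \<in> curves Y \<and> (\<forall>t. p (fst (c t)) = q (snd (c t)))"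
proof
  assume "c \<in> curves (fs_pullback X Y p q)"
  then have pts: "\<And>t. fst (c t) \<in> points X \<and> snd (c t) \<in> points Y \<and> p (fst (c t)) = q (snd (c t))"
    and sm: "\<forall>\<phi>\<in>{\<theta> \<circ> fst |\<theta>. \<theta> \<in> funcs X} \<union> {\<theta> \<circ> snd |\<theta>. \<theta> \<in> funcs Y}. smooth_real (\<lambda>t. \<phi> (c t))"
    unfolding fs_pullback_def curves_initial by (auto simp: case_prod_beta)
  have "(\<lambda>t. fst (c t)) \<in> curves X"
  proof (rule is_fspace_curveI[OF assms(1)])
    fix \<theta> assume "\<theta> \<in> funcs X"
    then have "\<theta> \<circ> fst \<in> {\<theta> \<circ> fst |\<theta>. \<theta> \<in> funcs X} \<union> {\<theta> \<circ> snd |\<theta>. \<theta> \<in> funcs Y}" by blast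
    from bspec[OF sm this] show "smooth_real (\<theta> \<circ> (\<lambda>t. fst (c t)))" by (simp add: comp_def)
  qed (use pts in simp)
  moreover have "(\<lambda>t. snd (c t)) \<in> curves Y"
  proof (rule is_fspace_curveI[OF assms(2)])
    fix \<theta> assume "\<theta> \<in> funcs Y"
    then have "\<theta> \<circ> snd \<in> {\<theta> \<circ> fst |\<theta>. \<theta> \<in> funcs X} \<union> {\<theta> \<circ> snd |\<theta>. \<theta> \<in> funcs Y}" by blast
    from bspec[OF sm this] show "smooth_real (\<theta> \<circ> (\<lambda>t. snd (c t)))" by (simp add: comp_def)
  qed (use pts in simp)
  ultimately show "(\<lambda>t. fst (c t)) \<in> curves X \<and> (\<lambda>t. snd (c t)) \<in> curves Y \<and> (\<forall>t. p (fst (c t)) = q (snd (c t)))"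
    using pts by simp
next
  assume c: "(\<lambda>t. fst (c t)) \<in> curves X \<and> (\<lambda>t. snd (c t)) \<in> curves Y \<and> (\<forall>t. p (fst (c t)) = q (snd (c t)))"
  have "smooth_real (\<lambda>t. \<theta> (fst (c t)))" if "\<theta> \<in> funcs X" for \<theta>
    using is_fspaceD(2)[OF assms(1) conjunct1[OF c] that] by (simp add: comp_def)
  moreover have "smooth_real (\<lambda>t. \<theta> (snd (c t)))" if "\<theta> \<in> funcs Y" for \<theta>
    using is_fspaceD(2)[OF assms(2) conjunct1[OF conjunct2[OF c]] that] by (simp add: comp_def)
  moreover have "fst (c t) \<in> points X" "snd (c t) \<in> points Y" for t
    using is_fspaceD(1)[OF assms(1) conjunct1[OF c]] is_fspaceD(1)[OF assms(2) conjunct1[OF conjunct2[OF c]]] by simp_all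
  ultimately show "c \<in> curves (fs_pullback X Y p q)"
    using c unfolding fs_pullback_def curves_initial by (auto simp: case_prod_beta)
qed

lemma points_fs_pullback [simp]:
  "points (fs_pullback X Y p q) = {(x, y). x \<in> points X \<and> y \<in> points Y \<and> p x = q y}"
  by (simp add: fs_pullback_def)

context
  fixes M :: "'a fspace"
  assumes M: "is_fspace M" and exponentiable: "weil_exponentiable M" and microlinear: "microlinear M"
begin

abbreviation tclass :: "(real \<Rightarrow> 'a) \<Rightarrow> (real vec \<Rightarrow> 'a) set" where
  "tclass F \<equiv> aclass M W_D (fn1 F)"

lemma tangentE:
  assumes "u \<in> points (tangent M)"
  obtains F where "F \<in> curves M" "u = tclass F"
  by (rule prolong_W_D_pointE[OF M assms]) (rule that)

lemma fn1_smooth: "F \<in> curves M \<Longrightarrow> fn1 F \<in> smooth_maps (euclid 1) M"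
  using fn1_prolong_maps_iff[OF M, of F "\<lambda>_. ()"] by (simp add: absolute_maps)

lemma tclass_point: "F \<in> curves M \<Longrightarrow> tclass F \<in> points (tangent M)"
  using fn1_smooth by (intro prolong_class_point[OF ideal_W_D]) (simp add: absolute_maps)

lemma tclass_jet:
  assumes "F \<in> curves M"
  shows "jet_value (tclass F) = F 0"
    "\<theta> \<in> smooth_maps M real_line \<Longrightarrow> jet_deriv \<theta> (tclass F) = deriv (\<lambda>t. \<theta> (F t)) 0"
  by (rule jet_class[OF M assms], simp)+

lemma tclass_eq_iff:
  assumes "F \<in> curves M" "G \<in> curves M"
  shows "tclass F = tclass G \<longleftrightarrow>
    F 0 = G 0 \<and> (\<forall>\<theta>\<in>smooth_maps M real_line. deriv (\<lambda>t. \<theta> (F t)) 0 = deriv (\<lambda>t. \<theta> (G t)) 0)"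
  using assms by (intro W_D_class_eq_iff[OF M]) simp_all

lemma tangent_eqI:
  assumes "u \<in> points (tangent M)" "v \<in> points (tangent M)" "jet_value u = jet_value v"
    "\<And>\<theta>. \<theta> \<in> smooth_maps M real_line \<Longrightarrow> jet_deriv \<theta> u = jet_deriv \<theta> v"
  shows "u = v"
  using assms by (rule W_D_point_eqI[OF M])

lemma tangent_curve_iff:
  "c \<in> curves (tangent M) \<longleftrightarrow> (\<forall>s. c s \<in> points (tangent M)) \<and>
     (\<forall>\<theta>\<in>smooth_maps M real_line. smooth_real (\<lambda>s. \<theta> (jet_value (c s))) \<and> smooth_real (\<lambda>s. jet_deriv \<theta> (c s)))"
  by (rule curves_prolong_W_D[OF M])

lemma is_fspace_tangent: "is_fspace (tangent M)"
  by (rule is_fspace_prolong)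

lemma jet_value_point: "u \<in> points (tangent M) \<Longrightarrow> jet_value u \<in> points M"
  by (erule tangentE) (simp add: tclass_jet is_fspaceD(1)[OF M])

lemma tangent_proj_eq:
  assumes "u \<in> points (tangent M)"
  shows "tangent_proj M u = jet_value u"
proof -
  obtain F where F: "F \<in> curves M" "u = tclass F" by (rule tangentE[OF assms], rule that)
  have maps: "fn1 F \<in> prolong_maps M (\<lambda>_. ()) (wdim W_D)" using fn1_smooth[OF F(1)] by (simp add: absolute_maps)
  have "(THE x. \<exists>f \<in> tclass F. x = f (0\<^sub>v (wdim W_D))) = F 0"
  proof (rule the_equality)
    show "\<exists>f \<in> tclass F. F 0 = f (0\<^sub>v (wdim W_D))"
      by (rule bexI[OF _ prolong_class_self[OF ideal_W_D maps]]) simp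
    show "x = F 0" if "\<exists>f \<in> tclass F. x = f (0\<^sub>v (wdim W_D))" for x
      using that by (auto simp: mem_prolong_class[OF ideal_W_D] prolong_rel_iff[OF ideal_W_D])
  qed
  then show ?thesis using assms by (simp add: tangent_proj_def abase_def F(2) tclass_jet[OF F(1)])
qed

lemma tangent_proj_smooth: "tangent_proj M \<in> smooth_maps (tangent M) M"
proof -
  have "tangent_proj M \<circ> c \<in> curves M" if c: "c \<in> curves (tangent M)" for c
  proof -
    have pts: "c s \<in> points (tangent M)" for s using c by (simp add: tangent_curve_iff)
    have "(\<lambda>s. jet_value (c s)) \<in> curves M"
      using c pts jet_value_point by (intro curveI_smooth_maps[OF M]) (simp_all add: tangent_curve_iff)
    then show ?thesis by (simp add: comp_def tangent_proj_eq[OF pts])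
  qed
  moreover have "tangent_proj M \<in> extensional (points (tangent M))"
    by (simp add: tangent_proj_def abase_def)
  ultimately show ?thesis
    using tangent_proj_eq jet_value_point unfolding smooth_maps_def by (auto simp: PiE_def)
qed

text \<open>Test functions on the tangent space: the values detect that a curve of tangent points stays in
  one fibre, and the derivatives below recover \<open>b\<close> from the class of \<open>t \<mapsto> a + t b\<close>.\<close>

lemma value_function_smooth:
  assumes "\<theta> \<in> smooth_maps M real_line"
  shows "(\<lambda>u\<in>points (tangent M). \<theta> (jet_value u)) \<in> smooth_maps (tangent M) real_line"
  using assms by (intro smooth_maps_real_lineI is_fspace_tangent) (simp add: tangent_curve_iff)

lemma deriv_function_smooth:
  assumes "\<theta> \<in> smooth_maps M real_line"
  shows "(\<lambda>u\<in>points (tangent M). jet_deriv \<theta> u) \<in> smooth_maps (tangent M) real_line"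
  using assms by (intro smooth_maps_real_lineI is_fspace_tangent) (simp add: tangent_curve_iff)

lemma tangent_zero_jet:
  assumes "x \<in> points M"
  shows "tangent_zero M x \<in> points (tangent M)" "jet_value (tangent_zero M x) = x"
    "\<theta> \<in> smooth_maps M real_line \<Longrightarrow> jet_deriv \<theta> (tangent_zero M x) = 0"
proof -
  have c: "(\<lambda>_. x) \<in> curves M" by (rule const_in_curves[OF M assms])
  have "tangent_zero M x = tclass (\<lambda>_. x)" using assms by (simp add: tangent_zero_def fn1_def)
  then show "tangent_zero M x \<in> points (tangent M)" "jet_value (tangent_zero M x) = x"
    "\<theta> \<in> smooth_maps M real_line \<Longrightarrow> jet_deriv \<theta> (tangent_zero M x) = 0"
    using tclass_point[OF c] tclass_jet[OF c] by simp_all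
qed

lemma curve_scale: "F \<in> curves M \<Longrightarrow> (\<lambda>t. F (r * t)) \<in> curves M"
  using curve_reparametrize[OF M _ smooth_real_linear, of F r] by (simp add: comp_def)

lemma along_scaling:
  assumes "F \<in> curves M"
  shows "aprolong_along M W_D W_D (scaling r) (tclass F) = tclass (\<lambda>t. F (r * t))"
  using aprolong_along_class[OF ideal_W_D ideal_W_D weil_map_scaling, of "fn1 F" M r] fn1_smooth[OF assms] by simp

lemma tangent_scale_jet:
  assumes u: "u \<in> points (tangent M)"
  shows "tangent_scale M (r, u) \<in> points (tangent M)" "jet_value (tangent_scale M (r, u)) = jet_value u"
    "\<theta> \<in> smooth_maps M real_line \<Longrightarrow> jet_deriv \<theta> (tangent_scale M (r, u)) = r * jet_deriv \<theta> u"
proof -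
  obtain F where F: "F \<in> curves M" "u = tclass F" by (rule tangentE[OF u], rule that)
  have "(\<lambda>t \<in> carrier_vec 1. vec_of_list [r * t $ 0]) = scaling r"
    by (simp add: scaling_def fn1_def vec1_def)
  then have eq: "tangent_scale M (r, u) = tclass (\<lambda>t. F (r * t))"
    using u by (simp add: tangent_scale_def F(2) along_scaling[OF F(1)])
  note c = curve_scale[OF F(1), of r]
  show "tangent_scale M (r, u) \<in> points (tangent M)" unfolding eq by (rule tclass_point[OF c])
  show "jet_value (tangent_scale M (r, u)) = jet_value u"
    unfolding eq tclass_jet(1)[OF c] unfolding F(2) tclass_jet(1)[OF F(1)] by simp
  show "jet_deriv \<theta> (tangent_scale M (r, u)) = r * jet_deriv \<theta> u" if \<theta>: "\<theta> \<in> smooth_maps M real_line"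
  proof -
    have "((\<lambda>t. \<theta> (F (r * t))) has_real_derivative deriv (\<lambda>t. \<theta> (F t)) (r * 0) * r) (at 0)"
      by (rule DERIV_chain2[OF smooth_real_has_derivative[OF function_along_curve[OF \<theta> F(1)]] DERIV_cmult_Id])
    then have "deriv (\<lambda>t. \<theta> (F (r * t))) 0 = r * deriv (\<lambda>t. \<theta> (F t)) 0"
      by (simp add: DERIV_imp_deriv mult.commute)
    then show ?thesis unfolding eq tclass_jet(2)[OF c \<theta>] unfolding F(2) tclass_jet(2)[OF F(1) \<theta>] .
  qed
qed

lemma smooth_surface:
  assumes "fn2 K \<in> smooth_maps (euclid 2) M"
  shows "smooth_real a \<Longrightarrow> smooth_real b \<Longrightarrow> (\<lambda>t. K (a t) (b t)) \<in> curves M"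
    "\<theta> \<in> smooth_maps M real_line \<Longrightarrow> smooth2 (\<lambda>x y. \<theta> (K x y))"
proof -
  show c: "(\<lambda>t. K (a t) (b t)) \<in> curves M" if "smooth_real a" "smooth_real b" for a b
    using assms that unfolding fn2_smooth_iff by blast
  show "smooth2 (\<lambda>x y. \<theta> (K x y))" if "\<theta> \<in> smooth_maps M real_line"
    unfolding smooth2_def by (intro allI impI function_along_curve[OF that] c)
qed

lemma along_line:
  assumes W: "W = W_D2 \<or> W = W_DD" and K: "fn2 K \<in> smooth_maps (euclid 2) M"
  shows "aprolong_along M W W_D (line \<alpha> \<beta>) (aclass M W (fn2 K)) = tclass (\<lambda>t. K (\<alpha> * t) (\<beta> * t))"
  using W
proof
  assume "W = W_D2"
  then show ?thesis
    using aprolong_along_class[OF ideal_W_D2 ideal_W_D weil_map_line, of "fn2 K" M \<alpha> \<beta>] K by simp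
next
  assume "W = W_DD"
  then show ?thesis
    using aprolong_along_class[OF ideal_W_DD ideal_W_D weil_map_line_DD, of "fn2 K" M \<alpha> \<beta>] K by simp
qed

lemma planeE:
  assumes W: "ideal (wideal W) (Cinf (wdim W))" "wdim W = 2" and k: "k \<in> points (aprolong M W)"
  obtains K where "fn2 K \<in> smooth_maps (euclid 2) M" "k = aclass M W (fn2 K)"
proof -
  obtain f where f: "f \<in> prolong_maps M (\<lambda>_. ()) (wdim W)" "k = aclass M W f"
    by (rule prolong_pointE[OF W(1) k], rule that)
  then have "f \<in> smooth_maps (euclid 2) M" by (simp add: absolute_maps W(2))
  moreover from this have "f = fn2 (\<lambda>s t. f (vec2 s t))" by (intro fn2_surj) (auto simp: smooth_maps_def PiE_def)
  ultimately show thesis using f(2) by (intro that[of "\<lambda>s t. f (vec2 s t)"]) simp_all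
qed

text \<open>Microlinearity for the fibre product: two tangent points over the same point are the
  restrictions to the axes of one surface in \<open>M\<close>.\<close>

lemma pair_lift:
  assumes u: "u \<in> points (tangent M)" and v: "v \<in> points (tangent M)" and base: "jet_value u = jet_value v"
  obtains K where "fn2 K \<in> smooth_maps (euclid 2) M" "u = tclass (\<lambda>t. K t 0)" "v = tclass (\<lambda>t. K 0 t)"
proof -
  obtain z where z: "weil_induced W_D W_D z (scaling 0)"
    using weil_map_induces[OF weil_algebra_W_D weil_algebra_W_D weil_map_scaling] by blast
  obtain p0 where p0: "weil_induced W_D2 W_D p0 (line 1 0)"
    using weil_map_induces[OF weil_algebra_W_D2 weil_algebra_W_D weil_map_line] by blast
  obtain p1 where p1: "weil_induced W_D2 W_D p1 (line 0 1)"
    using weil_map_induces[OF weil_algebra_W_D2 weil_algebra_W_D weil_map_line] by blast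
  obtain p2 where p2: "weil_induced W_D2 W_D p2 (line 0 0)"
    using weil_map_induces[OF weil_algebra_W_D2 weil_algebra_W_D weil_map_line] by blast
  let ?p = "\<lambda>v::nat. if v = 0 then p0 else if v = 1 then p1 else p2"
  have "weil_diagram pair_shape (\<lambda>_. W_D) (\<lambda>_. z)"
    using weil_algebra_W_D weil_inducedD(1)[OF z] by (simp add: weil_diagram_def)
  then have lim: "fs_limit TYPE(real) pair_shape (\<lambda>_. tangent M) (\<lambda>a. aprolong_hom M W_D W_D z)
      (aprolong M W_D2) (\<lambda>v. aprolong_hom M W_D2 W_D (?p v))"
    using microlinear weil_limit_pair[OF z p0 p1 p2] finite_pair_shape connected_pair_shape
    unfolding microlinear_def by blast
  obtain F where F: "F \<in> curves M" "u = tclass F" by (rule tangentE[OF u], rule that)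
  obtain G where G: "G \<in> curves M" "v = tclass G" by (rule tangentE[OF v], rule that)
  have FG: "F 0 = G 0" using base by (simp add: F G tclass_jet)
  let ?e = "\<lambda>w::nat. if w = 0 then u else if w = 1 then v else tclass (\<lambda>t. F (0 * t))"
  obtain l where l: "l \<in> points (aprolong M W_D2)"
    "\<And>w. w \<in> verts pair_shape \<Longrightarrow> aprolong_hom M W_D2 W_D (?p w) l = ?e w"
  proof (rule fs_limit_points[OF lim, of ?e])
    show "?e w \<in> points (tangent M)" if "w \<in> verts pair_shape" for w
      using u v tclass_point[OF curve_scale[OF F(1), of 0]] by simp
    have "aprolong_hom M W_D W_D z u = tclass (\<lambda>t. F (0 * t))"
      using aprolong_hom_eq[OF ideal_W_D ideal_W_D z u] along_scaling[OF F(1)] by (simp add: F(2))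
    moreover have "aprolong_hom M W_D W_D z v = tclass (\<lambda>t. F (0 * t))"
      using aprolong_hom_eq[OF ideal_W_D ideal_W_D z v] along_scaling[OF G(1)] by (simp add: G(2) FG)
    ultimately show "aprolong_hom M W_D W_D z (?e (src pair_shape a)) = ?e (tgt pair_shape a)"
      if "a \<in> arrs pair_shape" for a
      using that by auto
  qed (rule is_fspace_tangent, rule that)
  obtain K where K: "fn2 K \<in> smooth_maps (euclid 2) M" "l = aclass M W_D2 (fn2 K)"
    by (rule planeE[OF ideal_W_D2 wdim_simps(2) l(1)], rule that)
  show thesis
  proof (rule that[OF K(1)])
    show "u = tclass (\<lambda>t. K t 0)"
      using l(2)[of 0] aprolong_hom_eq[OF ideal_W_D2 ideal_W_D p0 l(1)] along_line[OF disjI1[OF refl] K(1), of 1 0]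
      by (simp add: K(2))
    show "v = tclass (\<lambda>t. K 0 t)"
      using l(2)[of 1] aprolong_hom_eq[OF ideal_W_D2 ideal_W_D p1 l(1)] along_line[OF disjI1[OF refl] K(1), of 0 1]
      by (simp add: K(2))
  qed
qed

text \<open>A first-order jet of a surface is determined by its restrictions to the axes; this is the
  uniqueness that makes the description of the sum on representatives meaningful.\<close>

lemma W_D2_class_eqI:
  assumes K: "fn2 K \<in> smooth_maps (euclid 2) M" and L: "fn2 L \<in> smooth_maps (euclid 2) M"
    and x: "tclass (\<lambda>t. K t 0) = tclass (\<lambda>t. L t 0)" and y: "tclass (\<lambda>t. K 0 t) = tclass (\<lambda>t. L 0 t)"
  shows "aclass M W_D2 (fn2 K) = aclass M W_D2 (fn2 L)"
proof -
  note cK = smooth_surface(1)[OF K smooth_real_ident smooth_real_const] smooth_surface(1)[OF K smooth_real_const smooth_real_ident]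
  note cL = smooth_surface(1)[OF L smooth_real_ident smooth_real_const] smooth_surface(1)[OF L smooth_real_const smooth_real_ident]
  have x': "K 0 0 = L 0 0" "\<And>\<theta>. \<theta> \<in> smooth_maps M real_line \<Longrightarrow>
      deriv (\<lambda>t. \<theta> (K t 0)) 0 = deriv (\<lambda>t. \<theta> (L t 0)) 0"
    using x unfolding tclass_eq_iff[OF cK(1) cL(1)] by simp_all
  have y': "deriv (\<lambda>t. \<theta> (K 0 t)) 0 = deriv (\<lambda>t. \<theta> (L 0 t)) 0" if "\<theta> \<in> smooth_maps M real_line" for \<theta>
    using y that unfolding tclass_eq_iff[OF cK(2) cL(2)] by simp
  have "(fn2 K, fn2 L) \<in> prolong_rel M (\<lambda>_. ()) W_D2"
    unfolding prolong_rel_iff[OF ideal_W_D2] absolute_maps wdim_simps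
  proof (intro conjI K L ballI)
    show "fn2 K (0\<^sub>v 2) = fn2 L (0\<^sub>v 2)" using x'(1) by simp
    fix \<theta> assume \<theta>: "\<theta> \<in> smooth_maps M real_line"
    note sK = smooth_surface(2)[OF K \<theta>] and sL = smooth_surface(2)[OF L \<theta>]
    have "deriv (\<lambda>t. \<theta> (K t 0) - \<theta> (L t 0)) 0 = deriv (\<lambda>t. \<theta> (K t 0)) 0 - deriv (\<lambda>t. \<theta> (L t 0)) 0"
      by (intro DERIV_imp_deriv DERIV_diff smooth_real_has_derivative smooth2_fix(1)[OF sK] smooth2_fix(1)[OF sL])
    moreover have "deriv (\<lambda>t. \<theta> (K 0 t) - \<theta> (L 0 t)) 0 = deriv (\<lambda>t. \<theta> (K 0 t)) 0 - deriv (\<lambda>t. \<theta> (L 0 t)) 0"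
      by (intro DERIV_imp_deriv DERIV_diff smooth_real_has_derivative smooth2_fix(2)[OF sK] smooth2_fix(2)[OF sL])
    ultimately have "fn2 (\<lambda>x y. \<theta> (K x y) - \<theta> (L x y)) \<in> wideal W_D2"
      unfolding W_D2_mem_iff[OF smooth2_intros(5)[OF sK sL]] using x'(1) x'(2)[OF \<theta>] y'[OF \<theta>] by simp
    also have "fn2 (\<lambda>x y. \<theta> (K x y) - \<theta> (L x y)) = (\<lambda>x\<in>carrier_vec 2. \<theta> (fn2 K x) - \<theta> (fn2 L x))"
      by (auto simp: fn2_def fun_eq_iff)
    finally show "(\<lambda>x\<in>carrier_vec 2. \<theta> (fn2 K x) - \<theta> (fn2 L x)) \<in> wideal W_D2" .
  qed
  then show ?thesis
    using K L by (subst prolong_class_eq_iff[OF ideal_W_D2]) (simp_all add: absolute_maps)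
qed

lemma tangent_add_eq:
  assumes K: "fn2 K \<in> smooth_maps (euclid 2) M"
  shows "tangent_add M (tclass (\<lambda>t. K t 0), tclass (\<lambda>t. K 0 t)) = tclass (\<lambda>t. K t t)"
proof -
  note cK = smooth_surface(1)[OF K smooth_real_ident smooth_real_const] smooth_surface(1)[OF K smooth_real_const smooth_real_ident]
  let ?u = "tclass (\<lambda>t. K t 0)" and ?v = "tclass (\<lambda>t. K 0 t)" and ?k = "aclass M W_D2 (fn2 K)"
  have lines: "(\<lambda>t \<in> carrier_vec 1. vec_of_list [t $ 0, 0]) = line 1 0"
    "(\<lambda>t \<in> carrier_vec 1. vec_of_list [0, t $ 0]) = line 0 1"
    "(\<lambda>t \<in> carrier_vec 1. vec_of_list [t $ 0, t $ 0]) = line 1 1"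
    by (simp_all add: line_def fn1_def vec2_def)
  have along: "aprolong_along M W_D2 W_D (line 1 0) (aclass M W_D2 (fn2 L)) = tclass (\<lambda>t. L t 0)"
    "aprolong_along M W_D2 W_D (line 0 1) (aclass M W_D2 (fn2 L)) = tclass (\<lambda>t. L 0 t)"
    "aprolong_along M W_D2 W_D (line 1 1) (aclass M W_D2 (fn2 L)) = tclass (\<lambda>t. L t t)"
    if "fn2 L \<in> smooth_maps (euclid 2) M" for L
    using along_line[OF disjI1[OF refl] that, of 1 0] along_line[OF disjI1[OF refl] that, of 0 1]
      along_line[OF disjI1[OF refl] that, of 1 1] by simp_all
  have "(THE k. k \<in> points (aprolong M W_D2) \<and> aprolong_along M W_D2 W_D (line 1 0) k = ?u \<and>
      aprolong_along M W_D2 W_D (line 0 1) k = ?v) = ?k"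
  proof (rule the_equality)
    show "?k \<in> points (aprolong M W_D2) \<and> aprolong_along M W_D2 W_D (line 1 0) ?k = ?u \<and>
        aprolong_along M W_D2 W_D (line 0 1) ?k = ?v"
      using K along[OF K] prolong_class_point[OF ideal_W_D2, of "fn2 K" M "\<lambda>_. ()"] by (simp add: absolute_maps)
    fix k assume k: "k \<in> points (aprolong M W_D2) \<and> aprolong_along M W_D2 W_D (line 1 0) k = ?u \<and>
        aprolong_along M W_D2 W_D (line 0 1) k = ?v"
    obtain L where L: "fn2 L \<in> smooth_maps (euclid 2) M" "k = aclass M W_D2 (fn2 L)"
      by (rule planeE[OF ideal_W_D2 wdim_simps(2) conjunct1[OF k]], rule that)
    show "k = ?k"
      unfolding L(2) using k by (intro W_D2_class_eqI[OF L(1) K]) (simp_all add: L(2) along[OF L(1)])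
  qed
  moreover have "(?u, ?v) \<in> points (fs_pullback (tangent M) (tangent M) (tangent_proj M) (tangent_proj M))"
    using tclass_point[OF cK(1)] tclass_point[OF cK(2)]
    by (simp add: tangent_proj_eq tclass_jet(1)[OF cK(1)] tclass_jet(1)[OF cK(2)])
  ultimately show ?thesis
    unfolding tangent_add_def Let_def lines by (simp add: along[OF K])
qed

text \<open>The derivative along the diagonal of a surface is the sum of the derivatives along the axes,
  so the addition of tangent points is the addition of their jets.\<close>

lemma tangent_add_jet:
  assumes u: "u \<in> points (tangent M)" and v: "v \<in> points (tangent M)" and base: "jet_value u = jet_value v"
  shows "tangent_add M (u, v) \<in> points (tangent M)" "jet_value (tangent_add M (u, v)) = jet_value u"
    "\<theta> \<in> smooth_maps M real_line \<Longrightarrow> jet_deriv \<theta> (tangent_add M (u, v)) = jet_deriv \<theta> u + jet_deriv \<theta> v"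
proof -
  obtain K where K: "fn2 K \<in> smooth_maps (euclid 2) M" "u = tclass (\<lambda>t. K t 0)" "v = tclass (\<lambda>t. K 0 t)"
    by (rule pair_lift[OF assms], rule that)
  note c = smooth_surface(1)[OF K(1) smooth_real_ident smooth_real_const] smooth_surface(1)[OF K(1) smooth_real_const smooth_real_ident]
    smooth_surface(1)[OF K(1) smooth_real_ident smooth_real_ident]
  have eq: "tangent_add M (u, v) = tclass (\<lambda>t. K t t)" unfolding K(2,3) by (rule tangent_add_eq[OF K(1)])
  show "tangent_add M (u, v) \<in> points (tangent M)" unfolding eq by (rule tclass_point[OF c(3)])
  show "jet_value (tangent_add M (u, v)) = jet_value u"
    unfolding eq tclass_jet(1)[OF c(3)] unfolding K(2) tclass_jet(1)[OF c(1)] ..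
  show "jet_deriv \<theta> (tangent_add M (u, v)) = jet_deriv \<theta> u + jet_deriv \<theta> v" if \<theta>: "\<theta> \<in> smooth_maps M real_line"
    unfolding eq tclass_jet(2)[OF c(3) \<theta>] unfolding K(2,3) tclass_jet(2)[OF c(1) \<theta>] tclass_jet(2)[OF c(2) \<theta>]
    using deriv_along_line[OF smooth_surface(2)[OF K(1) \<theta>], of 1] by simp
qed

text \<open>Since the operations act on jets as addition and multiplication of real numbers, every axiom
  becomes an identity of real numbers, and the operations preserve curves because smooth
  functions are closed under sums and products.\<close>

lemma prevector_bundle_tangent:
  "prevector_bundle (tangent M) M (tangent_proj M) (tangent_add M) (tangent_zero M) (tangent_scale M)"
proof -
  have add_smooth: "tangent_add M \<in> smooth_maps (fs_pullback (tangent M) (tangent M) (tangent_proj M) (tangent_proj M)) (tangent M)"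
    (is "_ \<in> smooth_maps ?P _")
  proof -
    have "tangent_add M \<circ> c \<in> curves (tangent M)" if "c \<in> curves ?P" for c
    proof -
      have c: "(\<lambda>t. fst (c t)) \<in> curves (tangent M)" "(\<lambda>t. snd (c t)) \<in> curves (tangent M)"
        "\<And>t. tangent_proj M (fst (c t)) = tangent_proj M (snd (c t))"
        using that unfolding curves_fs_pullback[OF is_fspace_tangent is_fspace_tangent] by simp_all
      have pts: "fst (c t) \<in> points (tangent M)" "snd (c t) \<in> points (tangent M)" for t
        using c(1,2) by (simp_all add: tangent_curve_iff)
      have base: "jet_value (fst (c t)) = jet_value (snd (c t))" for t
        using c(3)[of t] pts by (simp add: tangent_proj_eq)
      note jet = tangent_add_jet[OF pts base, unfolded prod.collapse]
      show ?thesis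
        using c(1,2) by (simp add: tangent_curve_iff comp_def jet smooth_real_add)
    qed
    moreover have "tangent_add M \<in> extensional (points ?P)" by (simp add: tangent_add_def)
    moreover have "tangent_add M p \<in> points (tangent M)" if "p \<in> points ?P" for p
      using that by (auto simp: tangent_proj_eq intro: tangent_add_jet(1))
    ultimately show ?thesis by (simp add: smooth_maps_def PiE_def Pi_def del: points_fs_pullback)
  qed
  have zero_smooth: "tangent_zero M \<in> smooth_maps M (tangent M)"
  proof -
    have "tangent_zero M \<circ> c \<in> curves (tangent M)" if c: "c \<in> curves M" for c
      using is_fspaceD(1)[OF M c] function_along_curve[OF _ c]
      by (simp add: tangent_curve_iff tangent_zero_jet smooth_real_const)
    moreover have "tangent_zero M \<in> extensional (points M)" by (simp add: tangent_zero_def)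
    ultimately show ?thesis using tangent_zero_jet(1) by (simp add: smooth_maps_def PiE_def Pi_def)
  qed
  have scale_smooth: "tangent_scale M \<in> smooth_maps (fs_prod real_line (tangent M)) (tangent M)"
  proof -
    have pts: "points (fs_prod real_line (tangent M)) = UNIV \<times> points (tangent M)"
      by (auto simp: fs_prod_def real_line_def)
    have "tangent_scale M \<circ> c \<in> curves (tangent M)" if "c \<in> curves (fs_prod real_line (tangent M))" for c
    proof -
      have c: "smooth_real (\<lambda>t. fst (c t))" "(\<lambda>t. snd (c t)) \<in> curves (tangent M)"
        using that unfolding fs_prod_def curves_fs_pullback[OF is_fspace_real_line is_fspace_tangent]
        by (simp_all add: real_line_def)
      have "snd (c t) \<in> points (tangent M)" for t using c(2) by (simp add: tangent_curve_iff)
      then have jet: "tangent_scale M (c t) \<in> points (tangent M)" "jet_value (tangent_scale M (c t)) = jet_value (snd (c t))"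
        "\<theta> \<in> smooth_maps M real_line \<Longrightarrow> jet_deriv \<theta> (tangent_scale M (c t)) = fst (c t) * jet_deriv \<theta> (snd (c t))"
        for t \<theta>
        using tangent_scale_jet[where u = "snd (c t)" and r = "fst (c t)"] by simp_all
      show ?thesis using c by (simp add: tangent_curve_iff comp_def jet smooth_real_mult)
    qed
    moreover have "tangent_scale M \<in> extensional (UNIV \<times> points (tangent M))" by (simp add: tangent_scale_def)
    ultimately show ?thesis using tangent_scale_jet(1) by (auto simp: smooth_maps_def PiE_def Pi_def pts)
  qed
  note jets = tangent_add_jet tangent_scale_jet tangent_zero_jet jet_value_point
  show ?thesis
    unfolding prevector_bundle_def
  proof (intro conjI is_fspace_tangent M tangent_proj_smooth add_smooth zero_smooth scale_smooth ballI allI impI)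
    fix a b assume ab: "a \<in> points (tangent M)" "b \<in> points (tangent M)" "tangent_proj M a = tangent_proj M b"
    then have base: "jet_value a = jet_value b" by (simp add: tangent_proj_eq)
    show "tangent_proj M (tangent_add M (a, b)) = tangent_proj M a"
      using ab base by (simp add: tangent_proj_eq jets)
    show "tangent_add M (a, b) = tangent_add M (b, a)"
      using ab base by (intro tangent_eqI) (simp_all add: jets)
    show "tangent_scale M (r, tangent_add M (a, b)) = tangent_add M (tangent_scale M (r, a), tangent_scale M (r, b))" for r
      using ab base by (intro tangent_eqI) (simp_all add: jets distrib_left)
  next
    fix x assume "x \<in> points M"
    then show "tangent_proj M (tangent_zero M x) = x" by (simp add: tangent_proj_eq jets)
  next
    fix r a assume a: "a \<in> points (tangent M)"
    show "tangent_proj M (tangent_scale M (r, a)) = tangent_proj M a" using a by (simp add: tangent_proj_eq jets)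
  next
    fix a b c assume abc: "a \<in> points (tangent M)" "b \<in> points (tangent M)" "c \<in> points (tangent M)"
      "tangent_proj M a = tangent_proj M b \<and> tangent_proj M b = tangent_proj M c"
    then have base: "jet_value a = jet_value b" "jet_value b = jet_value c" by (simp_all add: tangent_proj_eq)
    show "tangent_add M (tangent_add M (a, b), c) = tangent_add M (a, tangent_add M (b, c))"
      using abc(1-3) base by (intro tangent_eqI) (simp_all add: jets)
  next
    fix a assume a: "a \<in> points (tangent M)"
    show "tangent_add M (tangent_zero M (tangent_proj M a), a) = a"
      using a by (intro tangent_eqI) (simp_all add: jets tangent_proj_eq)
    show "tangent_add M (tangent_scale M (- 1, a), a) = tangent_zero M (tangent_proj M a)"
      using a by (intro tangent_eqI) (simp_all add: jets tangent_proj_eq)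
    show "tangent_scale M (1, a) = a"
      using a by (intro tangent_eqI) (simp_all add: jets)
    show "tangent_scale M (r + s, a) = tangent_add M (tangent_scale M (r, a), tangent_scale M (s, a))" for r s
      using a by (intro tangent_eqI) (simp_all add: jets distrib_right)
    show "tangent_scale M (r * s, a) = tangent_scale M (r, tangent_scale M (s, a))" for r s
      using a by (intro tangent_eqI) (simp_all add: jets)
  qed
qed

section \<open>The Euclidean property\<close>

abbreviation add_scaled :: "(real vec \<Rightarrow> 'a) set \<Rightarrow> (real vec \<Rightarrow> 'a) set \<Rightarrow> real \<Rightarrow> (real vec \<Rightarrow> 'a) set" where
  "add_scaled a b t \<equiv> tangent_add M (a, tangent_scale M (t, b))"

lemma affine_jet:
  assumes a: "a \<in> points (tangent M)" and b: "b \<in> points (tangent M)" and base: "jet_value a = jet_value b"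
  shows "add_scaled a b t \<in> points (tangent M)" "jet_value (add_scaled a b t) = jet_value a"
    "\<theta> \<in> smooth_maps M real_line \<Longrightarrow> jet_deriv \<theta> (add_scaled a b t) = jet_deriv \<theta> a + t * jet_deriv \<theta> b"
proof -
  have s: "tangent_scale M (t, b) \<in> points (tangent M)" "jet_value a = jet_value (tangent_scale M (t, b))"
    using tangent_scale_jet(1,2)[OF b, of t] base by simp_all
  show "add_scaled a b t \<in> points (tangent M)" "jet_value (add_scaled a b t) = jet_value a"
    "\<theta> \<in> smooth_maps M real_line \<Longrightarrow> jet_deriv \<theta> (add_scaled a b t) = jet_deriv \<theta> a + t * jet_deriv \<theta> b"
    using tangent_add_jet[OF a s] tangent_scale_jet(3)[OF b] by simp_all
qed

lemma affine_at_zero: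
  assumes "a \<in> points (tangent M)" "b \<in> points (tangent M)" "jet_value a = jet_value b"
  shows "add_scaled a b 0 = a"
  by (rule tangent_eqI[OF affine_jet(1)[OF assms] assms(1)]) (simp_all add: affine_jet[OF assms])

text \<open>Moving \<open>a\<close>, \<open>b\<close> and the parameter at the same time: the jet of \<open>a + t b\<close> is polynomial in the
  jets of \<open>a\<close> and \<open>b\<close> and in \<open>t\<close>.\<close>

lemma affine_family:
  assumes a: "a \<in> curves (tangent M)" and b: "b \<in> curves (tangent M)"
    and base: "\<And>s. jet_value (a s) = jet_value (b s)"
    and p: "smooth_real p" and q: "smooth_real q"
  shows "(\<lambda>x. add_scaled (a (p x)) (b (p x)) (q x)) \<in> curves (tangent M)"
proof -
  have pts: "a s \<in> points (tangent M)" "b s \<in> points (tangent M)" for s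
    using a b by (simp_all add: tangent_curve_iff)
  note jet = affine_jet[OF pts base]
  have "smooth_real (\<lambda>x. \<theta> (jet_value (a (p x))))" "smooth_real (\<lambda>x. jet_deriv \<theta> (a (p x)))"
    "smooth_real (\<lambda>x. jet_deriv \<theta> (b (p x)))" if "\<theta> \<in> smooth_maps M real_line" for \<theta>
    using a b that
      smooth_real_compose[OF _ p, of "\<lambda>s. \<theta> (jet_value (a s))"]
      smooth_real_compose[OF _ p, of "\<lambda>s. jet_deriv \<theta> (a s)"]
      smooth_real_compose[OF _ p, of "\<lambda>s. jet_deriv \<theta> (b s)"]
    by (simp_all add: tangent_curve_iff)
  then show ?thesis
    unfolding tangent_curve_iff by (simp add: jet smooth_real_add smooth_real_mult q)
qed

lemma affine_curve:
  assumes "a \<in> points (tangent M)" "b \<in> points (tangent M)" "jet_value a = jet_value b"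
  shows "add_scaled a b \<in> curves (tangent M)"
  using affine_family[OF const_in_curves[OF is_fspace_tangent assms(1)] const_in_curves[OF is_fspace_tangent assms(2)]
      assms(3) smooth_real_ident smooth_real_ident] .

abbreviation vertical :: "(real vec \<Rightarrow> (real vec \<Rightarrow> 'a) set) set fspace" where
  "vertical \<equiv> prolong (tangent M) (tangent_proj M) W_D"

abbreviation fibre_square :: "((real vec \<Rightarrow> 'a) set \<times> (real vec \<Rightarrow> 'a) set) fspace" where
  "fibre_square \<equiv> fs_pullback (tangent M) (tangent M) (tangent_proj M) (tangent_proj M)"

abbreviation emap :: "(real vec \<Rightarrow> 'a) set \<times> (real vec \<Rightarrow> 'a) set \<Rightarrow> (real vec \<Rightarrow> (real vec \<Rightarrow> 'a) set) set" where
  "emap \<equiv> euclidean_map (tangent M) (tangent_proj M) (tangent_add M) (tangent_scale M)"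

lemma fibre_square_iff:
  "(a, b) \<in> points fibre_square \<longleftrightarrow>
    a \<in> points (tangent M) \<and> b \<in> points (tangent M) \<and> jet_value a = jet_value b"
  by (auto simp: tangent_proj_eq)

lemma affine_vertical:
  assumes "a \<in> points (tangent M)" "b \<in> points (tangent M)" "jet_value a = jet_value b"
  shows "\<forall>t. tangent_proj M (add_scaled a b t) = tangent_proj M (add_scaled a b 0)"
  by (simp add: tangent_proj_eq affine_jet[OF assms])

text \<open>The value at \<open>0\<close> recovers \<open>a\<close>; differentiating the functions \<open>jet_deriv \<theta>\<close> along \<open>t \<mapsto> a + t b\<close>
  recovers \<open>b\<close>.\<close>

lemma euclidean_jet:
  assumes ab: "a \<in> points (tangent M)" "b \<in> points (tangent M)" "jet_value a = jet_value b"
  shows "emap (a, b) = prolong_class (tangent M) (tangent_proj M) W_D (fn1 (add_scaled a b))"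
    "emap (a, b) \<in> points vertical" "jet_value (emap (a, b)) = a"
    "\<Theta> \<in> smooth_maps (tangent M) real_line \<Longrightarrow> jet_deriv \<Theta> (emap (a, b)) = deriv (\<lambda>t. \<Theta> (add_scaled a b t)) 0"
    "\<theta> \<in> smooth_maps M real_line \<Longrightarrow> jet_deriv (\<lambda>u\<in>points (tangent M). jet_deriv \<theta> u) (emap (a, b)) = jet_deriv \<theta> b"
proof -
  have "(a, b) \<in> points fibre_square" using ab unfolding fibre_square_iff by simp
  then show eq: "emap (a, b) = prolong_class (tangent M) (tangent_proj M) W_D (fn1 (add_scaled a b))"
    by (simp add: euclidean_map_def fn1_def)
  note jet = jet_class[OF is_fspace_tangent affine_curve[OF ab] affine_vertical[OF ab]]
  have "fn1 (add_scaled a b) \<in> prolong_maps (tangent M) (tangent_proj M) (wdim W_D)"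
    using affine_curve[OF ab] affine_vertical[OF ab] unfolding wdim_simps fn1_prolong_maps_iff[OF is_fspace_tangent] by simp
  then show "emap (a, b) \<in> points vertical" unfolding eq by (rule prolong_class_point[OF ideal_W_D])
  show "jet_value (emap (a, b)) = a" unfolding eq jet(1) by (rule affine_at_zero[OF ab])
  show d: "jet_deriv \<Theta> (emap (a, b)) = deriv (\<lambda>t. \<Theta> (add_scaled a b t)) 0"
    if "\<Theta> \<in> smooth_maps (tangent M) real_line" for \<Theta>
    unfolding eq by (rule jet(2)[OF that])
  show "jet_deriv (\<lambda>u\<in>points (tangent M). jet_deriv \<theta> u) (emap (a, b)) = jet_deriv \<theta> b"
    if \<theta>: "\<theta> \<in> smooth_maps M real_line"
  proof -
    have "((\<lambda>t. jet_deriv \<theta> a + t * jet_deriv \<theta> b) has_real_derivative 0 + jet_deriv \<theta> b) (at 0)"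
      by (intro DERIV_add DERIV_const DERIV_cmult_right[OF DERIV_ident, simplified])
    then have "deriv (\<lambda>t. jet_deriv \<theta> a + t * jet_deriv \<theta> b) 0 = jet_deriv \<theta> b"
      by (intro DERIV_imp_deriv) simp
    then show ?thesis
      unfolding d[OF deriv_function_smooth[OF \<theta>]] by (simp add: affine_jet[OF ab] \<theta>)
  qed
qed

lemma euclidean_inj:
  assumes ab: "a \<in> points (tangent M)" "b \<in> points (tangent M)" "jet_value a = jet_value b"
    and ab': "a' \<in> points (tangent M)" "b' \<in> points (tangent M)" "jet_value a' = jet_value b'"
    and eq: "emap (a, b) = emap (a', b')"
  shows "a = a' \<and> b = b'"
proof
  show a: "a = a'" using eq euclidean_jet(3)[OF ab] euclidean_jet(3)[OF ab'] by simp
  show "b = b'"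
  proof (rule tangent_eqI[OF ab(2) ab'(2)])
    show "jet_value b = jet_value b'" using ab(3) ab'(3) a by simp
    show "jet_deriv \<theta> b = jet_deriv \<theta> b'" if "\<theta> \<in> smooth_maps M real_line" for \<theta>
      using eq euclidean_jet(5)[OF ab that] euclidean_jet(5)[OF ab' that] by simp
  qed
qed

lemma weil_curry_fn2: "weil_curry M W_D W_D (fn2 f) = fn1 (\<lambda>y. tclass (\<lambda>x. f x y))"
proof -
  have app: "fn2 f (x @\<^sub>v y) = f (x $ 0) (y $ 0)" if "x \<in> carrier_vec 1" "y \<in> carrier_vec 1" for x y
  proof -
    have "x @\<^sub>v y \<in> carrier_vec 2" using append_carrier_vec[OF that] by simp
    moreover have "(x @\<^sub>v y) $ 0 = x $ 0" "(x @\<^sub>v y) $ 1 = y $ 0"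
      using that by (simp_all add: index_append_vec)
    ultimately show ?thesis by (simp add: fn2_def)
  qed
  have inner: "(\<lambda>x\<in>carrier_vec 1. fn2 f (x @\<^sub>v y)) = fn1 (\<lambda>x. f x (y $ 0))" if "y \<in> carrier_vec 1" for y
    unfolding fn1_def by (rule restrict_ext) (rule app[OF _ that])
  show ?thesis
    unfolding weil_curry_def wdim_simps fn1_def[of "\<lambda>y. tclass (\<lambda>x. f x y)"]
    by (rule restrict_ext) (simp only: inner)
qed

text \<open>The instance of Weil exponentiability for two copies of \<open>W_D\<close>, in terms of surfaces \<open>f\<close>: every
  curve of tangent points agrees to first order with one of the form \<open>y \<mapsto> [x \<mapsto> f x y]\<close>.\<close>

lemma curry_isomorphism:
  obtains \<Phi> where "\<And>v. v \<in> points (aprolong (tangent M) W_D) \<Longrightarrow> \<exists>x\<in>points (aprolong M W_DD). v = \<Phi> x"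
    "\<And>f. fn2 f \<in> smooth_maps (euclid 2) M \<Longrightarrow> (\<lambda>y. tclass (\<lambda>x. f x y)) \<in> curves (tangent M)"
    "\<And>f. fn2 f \<in> smooth_maps (euclid 2) M \<Longrightarrow>
      \<Phi> (aclass M W_DD (fn2 f)) = aclass (tangent M) W_D (fn1 (\<lambda>y. tclass (\<lambda>x. f x y)))"
proof -
  obtain \<Psi> where "\<forall>W1 W2. weil_algebra W1 \<and> weil_algebra W2 \<longrightarrow>
           fs_iso (aprolong M (weil_tensor W1 W2)) (aprolong (aprolong M W1) W2) (\<Psi> W1 W2) \<and>
           (\<forall>f \<in> smooth_maps (euclid (wdim W1 + wdim W2)) M.
              weil_curry M W1 W2 f \<in> smooth_maps (euclid (wdim W2)) (aprolong M W1) \<and>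
              \<Psi> W1 W2 (aclass M (weil_tensor W1 W2) f) =
                aclass (aprolong M W1) W2 (weil_curry M W1 W2 f))"
    using exponentiable unfolding weil_exponentiable_def by blast
  then have iso: "fs_iso (aprolong M W_DD) (aprolong (tangent M) W_D) (\<Psi> W_D W_D)"
    and curry: "\<forall>f \<in> smooth_maps (euclid (wdim W_D + wdim W_D)) M.
              weil_curry M W_D W_D f \<in> smooth_maps (euclid (wdim W_D)) (tangent M) \<and>
              \<Psi> W_D W_D (aclass M W_DD f) = aclass (tangent M) W_D (weil_curry M W_D W_D f)"
    using weil_algebra_W_D by blast+
  have curry': "fn1 (\<lambda>y. tclass (\<lambda>x. f x y)) \<in> smooth_maps (euclid 1) (tangent M)"
    "\<Psi> W_D W_D (aclass M W_DD (fn2 f)) = aclass (tangent M) W_D (fn1 (\<lambda>y. tclass (\<lambda>x. f x y)))"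
    if "fn2 f \<in> smooth_maps (euclid 2) M" for f
    using bspec[OF curry, of "fn2 f"] that unfolding weil_curry_fn2 wdim_simps by simp_all
  show thesis
  proof (rule that[of "\<Psi> W_D W_D"])
    fix v assume v: "v \<in> points (aprolong (tangent M) W_D)"
    obtain g where g: "g \<in> smooth_maps (aprolong (tangent M) W_D) (aprolong M W_DD)"
      "\<forall>y\<in>points (aprolong (tangent M) W_D). \<Psi> W_D W_D (g y) = y"
      using iso unfolding fs_iso_def by (elim conjE bexE)
    have "g v \<in> points (aprolong M W_DD)" using g(1) v by (auto simp: smooth_maps_def)
    then show "\<exists>x\<in>points (aprolong M W_DD). v = \<Psi> W_D W_D x"
      using bspec[OF g(2) v] by (intro bexI[of _ "g v"]) simp_all
  next
    fix f assume f: "fn2 f \<in> smooth_maps (euclid 2) M"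
    show "(\<lambda>y. tclass (\<lambda>x. f x y)) \<in> curves (tangent M)"
      using curry'(1)[OF f] fn1_prolong_maps_iff[OF is_fspace_tangent, of _ "\<lambda>_. ()"] by (simp add: absolute_maps)
    show "\<Psi> W_D W_D (aclass M W_DD (fn2 f)) = aclass (tangent M) W_D (fn1 (\<lambda>y. tclass (\<lambda>x. f x y)))"
      by (rule curry'(2)[OF f])
  qed
qed

text \<open>Microlinearity for the equalizer: a surface whose restriction to the axis \<open>x = 0\<close> is constant
  to first order factors through the blow-down, modulo the squares of the coordinates.\<close>

lemma blowdown_lift:
  assumes f: "fn2 f \<in> smooth_maps (euclid 2) M" and const: "tclass (\<lambda>t. f 0 t) = tclass (\<lambda>_. f 0 0)"
  obtains h where "fn2 h \<in> smooth_maps (euclid 2) M"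
    "aclass M W_DD (fn2 (\<lambda>x y. h x (x * y))) = aclass M W_DD (fn2 f)"
proof -
  obtain d0 where d0: "weil_induced W_DD W_D d0 (line 0 1)"
    using weil_map_induces[OF weil_algebra_W_DD weil_algebra_W_D weil_map_line_DD] by blast
  obtain d1 where d1: "weil_induced W_DD W_D d1 (line 0 0)"
    using weil_map_induces[OF weil_algebra_W_DD weil_algebra_W_D weil_map_line_DD] by blast
  obtain p0 where p0: "weil_induced W_D2 W_DD p0 blowdown"
    using weil_map_induces[OF weil_algebra_W_D2 weil_algebra_W_DD weil_map_blowdown] by blast
  obtain p1 where p1: "weil_induced W_D2 W_D p1 (line 0 0)"
    using weil_map_induces[OF weil_algebra_W_D2 weil_algebra_W_D weil_map_line] by blast
  let ?D = "\<lambda>v::nat. if v = 0 then W_DD else W_D" and ?d = "\<lambda>a::nat. if a = 0 then d0 else d1"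
    and ?p = "\<lambda>v::nat. if v = 0 then p0 else p1"
  have "weil_diagram equalizer_shape ?D ?d"
    using weil_algebra_W_D weil_algebra_W_DD weil_inducedD(1)[OF d0] weil_inducedD(1)[OF d1]
    by (simp add: weil_diagram_def)
  then have lim: "fs_limit TYPE(real) equalizer_shape (\<lambda>v. aprolong M (?D v))
      (\<lambda>a. aprolong_hom M (?D (src equalizer_shape a)) (?D (tgt equalizer_shape a)) (?d a))
      (aprolong M W_D2) (\<lambda>v. aprolong_hom M W_D2 (?D v) (?p v))"
    using microlinear weil_limit_equalizer[OF d0 d1 p0 p1] finite_equalizer_shape connected_equalizer_shape
    unfolding microlinear_def by blast
  let ?x = "aclass M W_DD (fn2 f)"
  have x: "?x \<in> points (aprolong M W_DD)"
    using f by (intro prolong_class_point[OF ideal_W_DD]) (simp add: absolute_maps)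
  let ?e = "\<lambda>v::nat. if v = 0 then ?x else tclass (\<lambda>_. f 0 0)"
  obtain l where l: "l \<in> points (aprolong M W_D2)"
    "\<And>v. v \<in> verts equalizer_shape \<Longrightarrow> aprolong_hom M W_D2 (?D v) (?p v) l = ?e v"
  proof (rule fs_limit_points[OF lim, of ?e])
    show "?e v \<in> points (aprolong M (?D v))" if "v \<in> verts equalizer_shape" for v
      using x tclass_point[OF smooth_surface(1)[OF f smooth_real_const[of 0] smooth_real_const[of 0]]] by simp
    have "aprolong_hom M W_DD W_D d0 ?x = tclass (\<lambda>_. f 0 0)"
      using aprolong_hom_eq[OF ideal_W_DD ideal_W_D d0 x] along_line[OF disjI2[OF refl] f, of 0 1] const by simp
    moreover have "aprolong_hom M W_DD W_D d1 ?x = tclass (\<lambda>_. f 0 0)"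
      using aprolong_hom_eq[OF ideal_W_DD ideal_W_D d1 x] along_line[OF disjI2[OF refl] f, of 0 0] by simp
    ultimately show "aprolong_hom M (?D (src equalizer_shape a)) (?D (tgt equalizer_shape a)) (?d a)
        (?e (src equalizer_shape a)) = ?e (tgt equalizer_shape a)"
      if "a \<in> arrs equalizer_shape" for a
      by simp
  qed (rule is_fspace_prolong, rule that)
  obtain h where h: "fn2 h \<in> smooth_maps (euclid 2) M" "l = aclass M W_D2 (fn2 h)"
    by (rule planeE[OF ideal_W_D2 wdim_simps(2) l(1)], rule that)
  have "aclass M W_DD (fn2 (\<lambda>x y. h x (x * y))) = aprolong_hom M W_D2 W_DD p0 l"
    using aprolong_hom_eq[OF ideal_W_D2 ideal_W_DD p0 l(1)]
      aprolong_along_class[OF ideal_W_D2 ideal_W_DD weil_map_blowdown, of "fn2 h" M] h by simp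
  also have "\<dots> = ?x" using l(2)[of 0] by simp
  finally show thesis by (rule that[OF h(1)])
qed

text \<open>The blow-down maps the horizontal line at height \<open>y\<close> to the line with slope \<open>y\<close>, along which
  the derivative is affine in \<open>y\<close>.\<close>

lemma blowdown_is_affine:
  assumes h: "fn2 h \<in> smooth_maps (euclid 2) M"
  shows "tclass (\<lambda>x. h x (x * y)) = add_scaled (tclass (\<lambda>x. h x 0)) (tclass (\<lambda>z. h 0 z)) y"
proof -
  note c = smooth_surface(1)[OF h smooth_real_ident smooth_real_const[of 0]]
    smooth_surface(1)[OF h smooth_real_const[of 0] smooth_real_ident]
    smooth_surface(1)[OF h smooth_real_ident smooth_real_mult[OF smooth_real_ident smooth_real_const[of y]]]
  have base: "jet_value (tclass (\<lambda>x. h x 0)) = jet_value (tclass (\<lambda>z. h 0 z))"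
    unfolding tclass_jet(1)[OF c(1)] tclass_jet(1)[OF c(2)] ..
  note jet = affine_jet[OF tclass_point[OF c(1)] tclass_point[OF c(2)] base]
  show ?thesis
  proof (rule tangent_eqI[OF tclass_point[OF c(3)] jet(1)])
    show "jet_value (tclass (\<lambda>x. h x (x * y))) = jet_value (add_scaled (tclass (\<lambda>x. h x 0)) (tclass (\<lambda>z. h 0 z)) y)"
      unfolding jet(2) unfolding tclass_jet(1)[OF c(3)] tclass_jet(1)[OF c(1)] by simp
    fix \<theta> assume \<theta>: "\<theta> \<in> smooth_maps M real_line"
    show "jet_deriv \<theta> (tclass (\<lambda>x. h x (x * y))) = jet_deriv \<theta> (add_scaled (tclass (\<lambda>x. h x 0)) (tclass (\<lambda>z. h 0 z)) y)"
      unfolding jet(3)[OF \<theta>]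
      unfolding tclass_jet(2)[OF c(3) \<theta>] tclass_jet(2)[OF c(2) \<theta>] tclass_jet(2)[OF c(1) \<theta>]
      by (rule deriv_along_line[OF smooth_surface(2)[OF h \<theta>]])
  qed
qed

text \<open>A curve \<open>F\<close> in one fibre agrees to first order with \<open>y \<mapsto> [x \<mapsto> f x y]\<close> for a surface \<open>f\<close>. As
  the base point of \<open>F\<close> does not move, \<open>f 0 y\<close> is constant to first order, so \<open>f\<close> may be
  replaced by \<open>h x (x * y)\<close>, for which \<open>y \<mapsto> [x \<mapsto> h x (x * y)]\<close> is the affine curve through
  \<open>a = [x \<mapsto> h x 0]\<close> with direction \<open>b = [z \<mapsto> h 0 z]\<close>.\<close>

lemma euclidean_surj:
  assumes w: "w \<in> points vertical"
  obtains a b where "a \<in> points (tangent M)" "b \<in> points (tangent M)" "jet_value a = jet_value b" "emap (a, b) = w"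
proof -
  obtain F where F: "F \<in> curves (tangent M)" "\<forall>t. tangent_proj M (F t) = tangent_proj M (F 0)"
    "w = prolong_class (tangent M) (tangent_proj M) W_D (fn1 F)"
    by (rule prolong_W_D_pointE[OF is_fspace_tangent w], rule that)
  have Fpt: "F t \<in> points (tangent M)" for t using F(1) by (simp add: tangent_curve_iff)
  obtain \<Phi> where surj: "\<And>v. v \<in> points (aprolong (tangent M) W_D) \<Longrightarrow> \<exists>x\<in>points (aprolong M W_DD). v = \<Phi> x"
    and curry_curve: "\<And>f. fn2 f \<in> smooth_maps (euclid 2) M \<Longrightarrow> (\<lambda>y. tclass (\<lambda>x. f x y)) \<in> curves (tangent M)"
    and curry: "\<And>f. fn2 f \<in> smooth_maps (euclid 2) M \<Longrightarrow>
      \<Phi> (aclass M W_DD (fn2 f)) = aclass (tangent M) W_D (fn1 (\<lambda>y. tclass (\<lambda>x. f x y)))"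
    by (rule curry_isomorphism, rule that)
  have "fn1 F \<in> prolong_maps (tangent M) (\<lambda>_. ()) (wdim W_D)"
    unfolding wdim_simps fn1_prolong_maps_iff[OF is_fspace_tangent] using F(1) by simp
  from surj[OF prolong_class_point[OF ideal_W_D this]]
  obtain x where x: "x \<in> points (aprolong M W_DD)" "aclass (tangent M) W_D (fn1 F) = \<Phi> x" by (elim bexE)
  obtain f where f: "fn2 f \<in> smooth_maps (euclid 2) M" "x = aclass M W_DD (fn2 f)"
    by (rule planeE[OF ideal_W_DD wdim_simps(3) x(1)], rule that)
  have class_iff: "aclass (tangent M) W_D (fn1 G) = aclass (tangent M) W_D (fn1 H) \<longleftrightarrow>
      G 0 = H 0 \<and> (\<forall>\<Theta>\<in>smooth_maps (tangent M) real_line. deriv (\<lambda>t. \<Theta> (G t)) 0 = deriv (\<lambda>t. \<Theta> (H t)) 0)"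
    if "G \<in> curves (tangent M)" "H \<in> curves (tangent M)" for G H
    using that by (intro W_D_class_eq_iff[OF is_fspace_tangent]) simp_all
  have "aclass (tangent M) W_D (fn1 F) = aclass (tangent M) W_D (fn1 (\<lambda>y. tclass (\<lambda>x. f x y)))"
    unfolding x(2) f(2) by (rule curry[OF f(1)])
  then have derivs: "\<forall>\<Theta>\<in>smooth_maps (tangent M) real_line.
      deriv (\<lambda>t. \<Theta> (F t)) 0 = deriv (\<lambda>y. \<Theta> (tclass (\<lambda>x. f x y))) 0"
    unfolding class_iff[OF F(1) curry_curve[OF f(1)]] by simp
  \<comment> \<open>Test the agreement of \<open>F\<close> and \<open>f\<close> with the functions of the base point.\<close>
  have const: "tclass (\<lambda>t. f 0 t) = tclass (\<lambda>_. f 0 0)"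
  proof -
    note c = smooth_surface(1)[OF f(1) smooth_real_const[of 0] smooth_real_ident]
      smooth_surface(1)[OF f(1) smooth_real_const[of 0] smooth_real_const[of 0]]
    have "deriv (\<lambda>t. \<theta> (f 0 t)) 0 = deriv (\<lambda>_. \<theta> (f 0 0)) 0" if \<theta>: "\<theta> \<in> smooth_maps M real_line" for \<theta>
    proof -
      have slice: "(\<lambda>x. f x y) \<in> curves M" for y
        by (rule smooth_surface(1)[OF f(1) smooth_real_ident smooth_real_const[of y]])
      have "jet_value (F t) = jet_value (F 0)" for t
        using F(2) Fpt by (simp add: tangent_proj_eq)
      then have "(\<lambda>u\<in>points (tangent M). \<theta> (jet_value u)) (F t) = \<theta> (jet_value (F 0))" for t
        using Fpt[of t] by (metis restrict_apply')
      then have "deriv (\<lambda>t. (\<lambda>u\<in>points (tangent M). \<theta> (jet_value u)) (F t)) 0 = 0" by simp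
      moreover have "(\<lambda>u\<in>points (tangent M). \<theta> (jet_value u)) (tclass (\<lambda>x. f x y)) = \<theta> (f 0 y)" for y
        using tclass_point[OF slice] by (simp add: tclass_jet(1)[OF slice])
      ultimately show ?thesis
        using bspec[OF derivs value_function_smooth[OF \<theta>]] by simp
    qed
    then show ?thesis unfolding tclass_eq_iff[OF c] by simp
  qed
  obtain h where h: "fn2 h \<in> smooth_maps (euclid 2) M"
    "aclass M W_DD (fn2 (\<lambda>x y. h x (x * y))) = aclass M W_DD (fn2 f)"
    by (rule blowdown_lift[OF f(1) const], rule that)
  have hb: "fn2 (\<lambda>x y. h x (x * y)) \<in> smooth_maps (euclid 2) M"
    using compose_smooth_map[OF h(1), of blowdown 2] weil_map_blowdown by (simp add: weil_map_def)
  let ?a = "tclass (\<lambda>x. h x 0)" and ?b = "tclass (\<lambda>z. h 0 z)"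
  note c = smooth_surface(1)[OF h(1) smooth_real_ident smooth_real_const[of 0]]
    smooth_surface(1)[OF h(1) smooth_real_const[of 0] smooth_real_ident]
  have ab: "?a \<in> points (tangent M)" "?b \<in> points (tangent M)" "jet_value ?a = jet_value ?b"
    using tclass_point[OF c(1)] tclass_point[OF c(2)] by (simp_all add: tclass_jet(1)[OF c(1)] tclass_jet(1)[OF c(2)])
  \<comment> \<open>The comparison map sends the common class of \<open>f\<close> and \<open>h x (x * y)\<close> to the classes of both
    curves.\<close>
  have "aclass (tangent M) W_D (fn1 F) = aclass (tangent M) W_D (fn1 (add_scaled ?a ?b))"
    using curry[OF hb] unfolding h(2) x(2) f(2) blowdown_is_affine[OF h(1)] .
  then have "F 0 = add_scaled ?a ?b 0 \<and> (\<forall>\<Theta>\<in>smooth_maps (tangent M) real_line.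
      deriv (\<lambda>t. \<Theta> (F t)) 0 = deriv (\<lambda>t. \<Theta> (add_scaled ?a ?b t)) 0)"
    unfolding class_iff[OF F(1) affine_curve[OF ab]] .
  then have "w = emap (?a, ?b)"
    \<comment> \<open>Absolute and relative classes of curves in one fibre are given by the same conditions on
      jets.\<close>
    unfolding F(3) euclidean_jet(1)[OF ab]
      W_D_class_eq_iff[OF is_fspace_tangent F(1,2) affine_curve[OF ab] affine_vertical[OF ab]] .
  then show thesis by (intro that[OF ab]) simp
qed

text \<open>The derivative of \<open>\<Theta> (a s + t b s)\<close> at \<open>t = 0\<close> depends smoothly on \<open>s\<close>, because this
  expression is smooth along all curves in the \<open>(s, t)\<close>-plane.\<close>

lemma euclidean_map_smooth: "emap \<in> smooth_maps fibre_square vertical"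
proof -
  have "emap \<circ> c \<in> curves vertical" if "c \<in> curves fibre_square" for c
  proof -
    have c: "(\<lambda>t. fst (c t)) \<in> curves (tangent M)" "(\<lambda>t. snd (c t)) \<in> curves (tangent M)"
      "\<And>t. tangent_proj M (fst (c t)) = tangent_proj M (snd (c t))"
      using that unfolding curves_fs_pullback[OF is_fspace_tangent is_fspace_tangent] by simp_all
    have pts: "fst (c t) \<in> points (tangent M)" "snd (c t) \<in> points (tangent M)" for t
      using c(1,2) by (simp_all add: tangent_curve_iff)
    have base: "jet_value (fst (c t)) = jet_value (snd (c t))" for t
      using c(3)[of t] pts by (simp add: tangent_proj_eq)
    note jet = euclidean_jet(2,3,4)[OF pts base, unfolded prod.collapse]
    have "smooth_real (\<lambda>s. deriv (\<lambda>t. \<Theta> (add_scaled (fst (c s)) (snd (c s)) t)) 0)"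
      if \<Theta>: "\<Theta> \<in> smooth_maps (tangent M) real_line" for \<Theta>
    proof (rule smooth2_normal_derivative)
      show "smooth2 (\<lambda>s t. \<Theta> (add_scaled (fst (c s)) (snd (c s)) t))"
        unfolding smooth2_def
        by (intro allI impI function_along_curve[OF \<Theta>] affine_family[OF c(1,2) base])
    qed
    then show ?thesis
      unfolding curves_prolong_W_D[OF is_fspace_tangent]
      using function_along_curve[OF _ c(1)] by (simp add: jet)
  qed
  moreover have "emap \<in> extensional (points fibre_square)" by (simp add: euclidean_map_def)
  moreover have "emap (a, b) \<in> points vertical" if "(a, b) \<in> points fibre_square" for a b
    using that unfolding fibre_square_iff by (intro euclidean_jet(2)) simp_all
  ultimately show ?thesis by (auto simp: smooth_maps_def PiE_def Pi_def simp del: points_fs_pullback)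
qed

text \<open>The inverse is smooth because \<open>a\<close> is the value of the class of \<open>t \<mapsto> a + t b\<close> at \<open>0\<close> and the
  derivatives of \<open>b\<close> are derivatives of this class along smooth functions on the tangent space.\<close>

lemma euclidean_map_iso: "fs_iso fibre_square vertical emap"
proof -
  define g where "g = (\<lambda>w\<in>points vertical. inv_into (points fibre_square) emap w)"
  have inj: "inj_on emap (points fibre_square)"
  proof (rule inj_onI)
    fix p q assume "p \<in> points fibre_square" "q \<in> points fibre_square" "emap p = emap q"
    moreover obtain a b a' b' where "p = (a, b)" "q = (a', b')" by (cases p, cases q)
    ultimately show "p = q"
      unfolding fibre_square_iff using euclidean_inj[of a b a' b'] by (auto simp only: fibre_square_iff)
  qed
  have surj: "w \<in> emap ` points fibre_square" if w: "w \<in> points vertical" for w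
  proof -
    obtain a b where ab: "a \<in> points (tangent M)" "b \<in> points (tangent M)" "jet_value a = jet_value b" "emap (a, b) = w"
      by (rule euclidean_surj[OF w], rule that)
    show ?thesis
    proof (rule image_eqI)
      show "w = emap (a, b)" by (simp only: ab(4))
      show "(a, b) \<in> points fibre_square" unfolding fibre_square_iff using ab by simp
    qed
  qed
  have g: "g w \<in> points fibre_square" "emap (g w) = w" if "w \<in> points vertical" for w
    using that inv_into_into[OF surj[OF that]] f_inv_into_f[OF surj[OF that]] unfolding g_def by (simp_all only: restrict_apply if_True)
  have g_emap: "g (emap p) = p" if "p \<in> points fibre_square" for p
  proof (rule inj_onD[OF inj _ _ that])
    have "emap p \<in> points vertical" using that euclidean_map_smooth unfolding smooth_maps_def PiE_def by blast
    then show "emap (g (emap p)) = emap p" "g (emap p) \<in> points fibre_square" by (rule g(2), rule g(1))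
  qed
  have "g \<circ> c \<in> curves fibre_square" if c: "c \<in> curves vertical" for c
  proof -
    have cv: "c s \<in> points vertical" for s using c unfolding curves_prolong_W_D[OF is_fspace_tangent] by simp
    have "(fst (g (c s)), snd (g (c s))) \<in> points fibre_square" for s
      using g(1)[OF cv] by (simp only: prod.collapse)
    then have ab: "fst (g (c s)) \<in> points (tangent M)" "snd (g (c s)) \<in> points (tangent M)"
      "jet_value (fst (g (c s))) = jet_value (snd (g (c s)))" for s
      unfolding fibre_square_iff by simp_all
    note jet = euclidean_jet(3,5)[OF ab, unfolded prod.collapse, unfolded g(2)[OF cv]]
    have smooth: "smooth_real (\<lambda>s. \<Theta> (jet_value (c s)))" "smooth_real (\<lambda>s. jet_deriv \<Theta> (c s))"
      if "\<Theta> \<in> smooth_maps (tangent M) real_line" for \<Theta>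
      using c that unfolding curves_prolong_W_D[OF is_fspace_tangent] by simp_all
    have a: "(\<lambda>s. fst (g (c s))) \<in> curves (tangent M)"
    proof (rule curveI_smooth_maps[OF is_fspace_tangent ab(1)])
      show "smooth_real (\<lambda>s. \<Theta> (fst (g (c s))))" if "\<Theta> \<in> smooth_maps (tangent M) real_line" for \<Theta>
        using smooth(1)[OF that] by (simp only: jet(1))
    qed
    have b: "(\<lambda>s. snd (g (c s))) \<in> curves (tangent M)"
      unfolding tangent_curve_iff
    proof (intro conjI allI ballI ab)
      fix \<theta> assume \<theta>: "\<theta> \<in> smooth_maps M real_line"
      show "smooth_real (\<lambda>s. \<theta> (jet_value (snd (g (c s)))))"
        using a \<theta> by (simp add: tangent_curve_iff flip: ab(3))
      show "smooth_real (\<lambda>s. jet_deriv \<theta> (snd (g (c s))))"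
        using smooth(2)[OF deriv_function_smooth[OF \<theta>]] by (simp only: jet(2)[OF \<theta>])
    qed
    show ?thesis
      unfolding curves_fs_pullback[OF is_fspace_tangent is_fspace_tangent] comp_def
      using a b ab by (simp add: tangent_proj_eq)
  qed
  then have "g \<in> smooth_maps vertical fibre_square"
    using g(1) unfolding smooth_maps_def by (simp add: g_def PiE_def Pi_def del: points_fs_pullback)
  then show ?thesis
    unfolding fs_iso_def using euclidean_map_smooth g_emap g(2) by blast
qed

end

theorem theorem47:
  fixes M :: "'a fspace"
  assumes "is_fspace M"
    and "weil_exponentiable M"
    and "microlinear M"
  shows "vector_bundle (tangent M) M (tangent_proj M)
           (tangent_add M) (tangent_zero M) (tangent_scale M)"
  unfolding vector_bundle_def
  by (intro conjI prevector_bundle_tangent euclidean_map_iso assms)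

end
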